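(* Let $p$ be a prime, let $c\geq 1$ be an integer, and let $G$ be a finite powerful $p$-group with $d(G)=d$. Then $$d(M^{(c)}(G))\leq \chi_{c+1}(d).$$
   Context: For a group $X$, $d(X)$ denotes the minimal number of generators of $X$, and $\mho_i(X)$ denotes the subgroup of $X$ generated by all $p^i$-th powers of elements of $X$. A $p$-group $G$ is called powerful if $p$ is odd and $G'\leq \mho_1(G)$, or $p=2$ and $G'\leq \mho_2(G)$, where $G'=[G,G]$. For a group $G$ with a free presentation $G\cong F/R$ ($F$ a free group, $R$ a normal subgroup of $F$), the $c$-nilpotent multiplier of $G$ is the abelian group $$M^{(c)}(G)=\frac{R\cap\gamma_{c+1}(F)}{[R,{}_cF]},$$ where $\gamma_{c+1}(F)$ is the $(c+1)$-st term of the lower central series of $F$ (with $\gamma_1(F)=F$) and $[R,{}_cF]=[R,F,\ldots,F]$ with $F$ occurring $c$ times (left-normed). Up to isomorphism it does not depend on the free presentation chosen. $\chi_{n}(d)$ denotes the number of basic commutators of weight $n$ on $d$ letters (in the sense of M. Hall), i.e. $\chi_n(d)=\frac1n\sum_{m\mid n}\mu(m)d^{n/m}$ with $\mu$ the Möbius function. *)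

theory Defs
  imports
    "HOL-Computational_Algebra.Primes"
    "HOL-Algebra.Generated_Groups"
    "HOL-Algebra.Multiplicative_Group"
    "HOL-Library.Extended_Nat"
begin

section \<open>Free groups\<close>

text \<open>
  A letter \<open>(x, True)\<close> stands for the generator \<open>x\<close> and \<open>(x, False)\<close> for its inverse. The free
  group on \<open>B\<close> is realised on the reduced words over \<open>B\<close>, multiplied by concatenation followed by
  free reduction.
\<close>

type_synonym 'x word = "('x \<times> bool) list"

definition letter_inv :: "'x \<times> bool \<Rightarrow> 'x \<times> bool" where
  "letter_inv l = (fst l, \<not> snd l)"

definition reduced :: "'x word \<Rightarrow> bool" where
  "reduced w \<longleftrightarrow> successively (\<lambda>l m. m \<noteq> letter_inv l) w"

fun rcons :: "'x \<times> bool \<Rightarrow> 'x word \<Rightarrow> 'x word" where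
  "rcons l [] = [l]"
| "rcons l (m # w) = (if m = letter_inv l then w else l # m # w)"

definition free_group :: "'x set \<Rightarrow> 'x word monoid" where
  "free_group B =
     \<lparr>carrier = {w \<in> lists (B \<times> UNIV). reduced w}, monoid.mult = (\<lambda>u v. foldr rcons u v), one = []\<rparr>"

lemma letter_inv_letter_inv [simp]: "letter_inv (letter_inv l) = l"
  by (simp add: letter_inv_def)

lemma letter_inv_in [simp]: "letter_inv l \<in> B \<times> UNIV \<longleftrightarrow> l \<in> B \<times> UNIV"
  by (cases l) (simp add: letter_inv_def)

lemma letter_inv_eq_iff: "m = letter_inv l \<longleftrightarrow> l = letter_inv m"
  by (metis letter_inv_letter_inv)

lemma reduced_Nil [simp]: "reduced []"
  by (simp add: reduced_def)

lemma reduced_Cons: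
  "reduced (l # w) \<longleftrightarrow> reduced w \<and> (w = [] \<or> hd w \<noteq> letter_inv l)"
  by (auto simp: reduced_def successively_Cons)

lemma reduced_rcons: "reduced w \<Longrightarrow> reduced (rcons l w)"
  by (cases w) (auto simp: reduced_Cons)

lemma rcons_in_lists: "l \<in> B \<times> UNIV \<Longrightarrow> w \<in> lists (B \<times> UNIV) \<Longrightarrow> rcons l w \<in> lists (B \<times> UNIV)"
  by (cases w) auto

lemma rcons_letter_inv: "reduced w \<Longrightarrow> rcons (letter_inv l) (rcons l w) = w"
proof (cases w)
  case (Cons m v)
  assume "reduced w"
  with Cons show ?thesis by (cases v) (auto simp: reduced_Cons)
qed simp

lemma reduced_foldr: "reduced v \<Longrightarrow> reduced (foldr rcons u v)"
  by (induction u) (auto intro: reduced_rcons)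

lemma foldr_rcons_in_lists:
  "u \<in> lists (B \<times> UNIV) \<Longrightarrow> v \<in> lists (B \<times> UNIV) \<Longrightarrow> foldr rcons u v \<in> lists (B \<times> UNIV)"
  by (induction u) (simp_all add: rcons_in_lists del: in_lists_conv_set)

lemma foldr_rcons_reduced: "reduced w \<Longrightarrow> foldr rcons w [] = w"
proof (induction w)
  case (Cons l w)
  then show ?case by (cases w) (auto simp: reduced_Cons)
qed simp

lemma foldr_rcons_rcons:
  assumes "reduced w"
  shows "foldr rcons (rcons l u) w = rcons l (foldr rcons u w)"
proof (cases u)
  case (Cons m u')
  show ?thesis
  proof (cases "m = letter_inv l")
    case True
    then show ?thesis
      using rcons_letter_inv[of "foldr rcons u' w" m] reduced_foldr[OF assms] Cons by simp
  qed (simp add: Cons)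
qed simp

lemma foldr_rcons_assoc:
  "reduced w \<Longrightarrow> foldr rcons (foldr rcons u v) w = foldr rcons u (foldr rcons v w)"
  by (induction u) (simp_all add: foldr_rcons_rcons)

lemma foldr_rcons_inverse:
  assumes "reduced w"
  shows "foldr rcons (rev (map letter_inv u)) (foldr rcons u w) = w"
proof (induction u)
  case (Cons l u)
  then show ?case
    using rcons_letter_inv[of "foldr rcons u w" l] reduced_foldr[OF assms] by simp
qed simp

lemma group_free_group: "group (free_group B)"
proof (rule groupI)
  fix w assume w: "w \<in> carrier (free_group B)"
  let ?v = "foldr rcons (rev (map letter_inv w)) []"
  have "rev (map letter_inv w) \<in> lists (B \<times> UNIV)"
    using w by (fastforce simp: free_group_def letter_inv_def)
  then have "?v \<in> carrier (free_group B)"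
    using reduced_foldr[of "[]" "rev (map letter_inv w)"]
      foldr_rcons_in_lists[of "rev (map letter_inv w)" B "[]"]
    by (simp add: free_group_def)
  moreover have "?v \<otimes>\<^bsub>free_group B\<^esub> w = \<one>\<^bsub>free_group B\<^esub>"
    using foldr_rcons_inverse[of "[]" w] w foldr_rcons_reduced[of w]
    by (simp add: free_group_def foldr_rcons_assoc)
  ultimately show "\<exists>v\<in>carrier (free_group B). v \<otimes>\<^bsub>free_group B\<^esub> w = \<one>\<^bsub>free_group B\<^esub>"
    by blast
next
  fix u v assume "u \<in> carrier (free_group B)" "v \<in> carrier (free_group B)"
  then show "u \<otimes>\<^bsub>free_group B\<^esub> v \<in> carrier (free_group B)"
    using foldr_rcons_in_lists[of u B v] by (simp add: free_group_def reduced_foldr)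
qed (simp_all add: free_group_def foldr_rcons_assoc)

definition free_eval :: "('a, 'm) monoid_scheme \<Rightarrow> ('x \<Rightarrow> 'a) \<Rightarrow> 'x word \<Rightarrow> 'a" where
  "free_eval G f w =
     foldr (\<lambda>l a. (if snd l then f (fst l) else inv\<^bsub>G\<^esub> f (fst l)) \<otimes>\<^bsub>G\<^esub> a) w \<one>\<^bsub>G\<^esub>"

text \<open>The universal property of \<^term>\<open>free_group B\<close>: existence and uniqueness.\<close>

lemma (in group) free_eval_hom:
  assumes f: "f \<in> B \<rightarrow> carrier G"
  shows "free_eval G f \<in> hom (free_group B) G"
    and "x \<in> B \<Longrightarrow> free_eval G f [(x, True)] = f x"
proof -
  let ?e = "free_eval G f" and ?L = "\<lambda>l. if snd l then f (fst l) else inv f (fst l)"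
  have Cons: "?e (l # w) = ?L l \<otimes> ?e w" for l w
    by (simp add: free_eval_def)
  have L: "?L l \<in> carrier G" if "l \<in> B \<times> UNIV" for l
    using that f by (auto simp: Pi_iff)
  have closed: "?e w \<in> carrier G" if "w \<in> lists (B \<times> UNIV)" for w
    using that
  proof (induction w)
    case (Cons l w)
    then show ?case using L[of l] by (simp add: \<open>\<And>w l. ?e (l # w) = ?L l \<otimes> ?e w\<close>)
  qed (simp add: free_eval_def)
  have rc: "?e (rcons l w) = ?L l \<otimes> ?e w" if "l \<in> B \<times> UNIV" "w \<in> lists (B \<times> UNIV)" for l w
  proof (cases w)
    case w: (Cons m w')
    show ?thesis
    proof (cases "m = letter_inv l")
      case True
      have c: "?e w' \<in> carrier G" using closed that w by simp
      have "?L l \<otimes> ?L m = \<one>"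
        using True that(1) f by (auto simp: letter_inv_def Pi_iff)
      moreover have "?L l \<otimes> (?L m \<otimes> ?e w') = ?L l \<otimes> ?L m \<otimes> ?e w'"
        using m_assoc[of "?L l" "?L m" "?e w'"] L[of l] L[of m] that w c by simp
      ultimately show ?thesis using True w c Cons[of m w'] by simp
    qed (simp add: w Cons)
  qed (simp add: Cons)
  have mult: "?e (foldr rcons u v) = ?e u \<otimes> ?e v"
    if "u \<in> lists (B \<times> UNIV)" "v \<in> lists (B \<times> UNIV)" for u v
    using that
  proof (induction u)
    case Nil
    then show ?case using closed[of v] by (simp add: free_eval_def)
  next
    case (Cons l u)
    have "?e (foldr rcons (l # u) v) = ?L l \<otimes> (?e u \<otimes> ?e v)"
      using rc[of l "foldr rcons u v"] Cons foldr_rcons_in_lists[of u B v] by simp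
    then show ?case
      using m_assoc[of "?L l" "?e u" "?e v"] L[of l] closed Cons
      by (simp add: \<open>\<And>w l. ?e (l # w) = ?L l \<otimes> ?e w\<close>)
  qed
  show "?e \<in> hom (free_group B) G"
    using closed mult by (auto simp: hom_def free_group_def simp del: in_lists_conv_set)
  show "free_eval G f [(x, True)] = f x" if "x \<in> B"
    using that f by (auto simp: free_eval_def Pi_iff)
qed

lemma (in group) free_group_hom_unique:
  assumes g: "g \<in> hom (free_group B) G" and h: "h \<in> hom (free_group B) G"
    and eq: "\<And>x. x \<in> B \<Longrightarrow> g [(x, True)] = h [(x, True)]"
    and w: "w \<in> carrier (free_group B)"
  shows "g w = h w"
proof -
  interpret F: group "free_group B" by (rule group_free_group)
  interpret g: group_hom "free_group B" G g using g by unfold_locales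
  interpret h: group_hom "free_group B" G h using h by unfold_locales
  have single: "[(x, b)] \<in> carrier (free_group B)" if "x \<in> B" for x b
    using that by (simp add: free_group_def reduced_def)
  have inv: "[(x, False)] = inv\<^bsub>free_group B\<^esub> [(x, True)]" if "x \<in> B" for x
    using F.inv_equality[of "[(x, False)]" "[(x, True)]"] single[OF that]
    by (simp add: free_group_def letter_inv_def)
  have letter: "g [l] = h [l]" if "l \<in> B \<times> UNIV" for l
  proof (cases l)
    case (Pair x b)
    have x: "x \<in> B" using that Pair by simp
    then have "g [(x, False)] = h [(x, False)]"
      using eq[OF x] single[OF x] inv[OF x] by simp
    with eq[OF x] Pair show ?thesis by (cases b) simp_all
  qed
  show ?thesis using w
  proof (induction w)
    case Nil
    then show ?case using g.hom_one h.hom_one by (simp add: free_group_def)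
  next
    case (Cons l w)
    then have l: "l \<in> B \<times> UNIV" and w': "w \<in> carrier (free_group B)"
      by (auto simp: free_group_def reduced_Cons)
    have "l # w = [l] \<otimes>\<^bsub>free_group B\<^esub> w"
      using Cons.prems by (cases w) (auto simp: free_group_def reduced_Cons)
    moreover have "[l] \<in> carrier (free_group B)"
      using l single[of "fst l" "snd l"] by (cases l) simp
    ultimately show ?case using Cons.IH[OF w'] letter[OF l] w' by simp
  qed
qed


section \<open>Commutator subgroups and the \<open>c\<close>-nilpotent multiplier\<close>

text \<open>
  The commutator is \<open>h k h\<inverse> k\<inverse>\<close>, as in \<^const>\<open>derived\<close>; the convention does not affect the
  subgroups generated.
\<close>

definition commutator_subgroup :: "('a, 'm) monoid_scheme \<Rightarrow> 'a set \<Rightarrow> 'a set \<Rightarrow> 'a set" where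
  "commutator_subgroup G H K =
     generate G {h \<otimes>\<^bsub>G\<^esub> k \<otimes>\<^bsub>G\<^esub> (inv\<^bsub>G\<^esub> h) \<otimes>\<^bsub>G\<^esub> (inv\<^bsub>G\<^esub> k) | h k. h \<in> H \<and> k \<in> K}"

lemma derived_eq_commutator_subgroup: "derived G H = commutator_subgroup G H H"
  unfolding derived_def commutator_subgroup_def by (rule arg_cong[of _ _ "generate G"]) auto

text \<open>\<open>iterated_commutator G H c\<close> is the left-normed \<open>[H, G, \<dots>, G]\<close> with \<open>c\<close> occurrences of \<open>G\<close>.\<close>

primrec iterated_commutator :: "('a, 'm) monoid_scheme \<Rightarrow> 'a set \<Rightarrow> nat \<Rightarrow> 'a set" where
  "iterated_commutator G H 0 = H"
| "iterated_commutator G H (Suc c) =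
     commutator_subgroup G (iterated_commutator G H c) (carrier G)"

text \<open>Indexed so that the first term is \<open>G\<close>; the value at index 0 is immaterial.\<close>

definition lower_central :: "('a, 'm) monoid_scheme \<Rightarrow> nat \<Rightarrow> 'a set" where
  "lower_central G n = iterated_commutator G (carrier G) (n - 1)"

text \<open>The multiplier of \<open>F/R\<close> computed from the presentation with kernel \<open>R\<close>.\<close>

definition nilpotent_multiplier ::
    "nat \<Rightarrow> ('a, 'm) monoid_scheme \<Rightarrow> 'a set \<Rightarrow> 'a set monoid" where
  "nilpotent_multiplier c F R =
     (F\<lparr>carrier := R \<inter> lower_central F (c + 1)\<rparr>) Mod (iterated_commutator F R c)"


section \<open>Powerful \<open>p\<close>-groups and numbers of generators\<close>

definition p_group :: "nat \<Rightarrow> ('a, 'm) monoid_scheme \<Rightarrow> bool" where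
  "p_group p G \<longleftrightarrow> group G \<and> (\<forall>x\<in>carrier G. \<exists>k. group.ord G x = p ^ k)"

definition agemo :: "nat \<Rightarrow> nat \<Rightarrow> ('a, 'm) monoid_scheme \<Rightarrow> 'a set" where
  "agemo p i G = generate G {x [^]\<^bsub>G\<^esub> (p ^ i) | x. x \<in> carrier G}"

definition powerful :: "nat \<Rightarrow> ('a, 'm) monoid_scheme \<Rightarrow> bool" where
  "powerful p G \<longleftrightarrow>
     odd p \<and> derived G (carrier G) \<subseteq> agemo p 1 G \<or>
     p = 2 \<and> derived G (carrier G) \<subseteq> agemo p 2 G"

text \<open>
  The value is \<open>\<infinity>\<close> (the infimum of the empty set) if the group is not finitely generated, so that
  an upper bound by a natural number includes finite generation.
\<close>

definition min_generators :: "('a, 'm) monoid_scheme \<Rightarrow> enat" where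
  "min_generators G =
     (INF S\<in>{S. S \<subseteq> carrier G \<and> finite S \<and> generate G S = carrier G}. enat (card S))"


section \<open>Basic commutators\<close>

datatype comm = Letter nat | Br comm comm

primrec weight :: "comm \<Rightarrow> nat" where
  "weight (Letter i) = 1"
| "weight (Br u v) = weight u + weight v"

text \<open>
  Hall's construction needs a total order on the basic commutators that respects weight and is
  otherwise arbitrary; within each weight the lexicographic order is chosen here. The number of
  basic commutators of each weight does not depend on this choice.
\<close>

fun comm_less :: "comm \<Rightarrow> comm \<Rightarrow> bool" where
  "comm_less (Letter i) (Letter j) \<longleftrightarrow> i < j"
| "comm_less (Letter i) (Br u v) \<longleftrightarrow> True"
| "comm_less (Br u v) (Letter i) \<longleftrightarrow> False"
| "comm_less (Br u v) (Br u' v') \<longleftrightarrow>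
     weight (Br u v) < weight (Br u' v') \<or>
     weight (Br u v) = weight (Br u' v') \<and> (comm_less u u' \<or> u = u' \<and> comm_less v v')"

inductive basic_commutator :: "nat \<Rightarrow> comm \<Rightarrow> bool" for d where
  letter: "i < d \<Longrightarrow> basic_commutator d (Letter i)"
| bracket: "basic_commutator d u \<Longrightarrow> basic_commutator d v \<Longrightarrow> comm_less v u \<Longrightarrow>
    (\<And>s t. u = Br s t \<Longrightarrow> \<not> comm_less v t) \<Longrightarrow> basic_commutator d (Br u v)"

definition num_basic_commutators :: "nat \<Rightarrow> nat \<Rightarrow> nat" where
  "num_basic_commutators n d = card {t. basic_commutator d t \<and> weight t = n}"

lemma comm_less_weight: "comm_less u v \<Longrightarrow> weight u \<le> weight v"
proof -
  have pos: "weight w \<ge> 1" for w by (induction w) auto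
  show "comm_less u v \<Longrightarrow> weight u \<le> weight v"
  proof (cases u; cases v)
    fix i a b assume "u = Letter i" "v = Br a b"
    then show ?thesis using pos[of a] by simp
  qed auto
qed

lemma weight_less_comm_less: "weight u < weight v \<Longrightarrow> comm_less u v"
proof -
  have pos: "weight w \<ge> 1" for w by (induction w) auto
  show "weight u < weight v \<Longrightarrow> comm_less u v"
  proof (cases u; cases v)
    fix i a b assume "weight u < weight v" "u = Br a b" "v = Letter i"
    then show ?thesis using pos[of a] by simp
  qed auto
qed

lemma comm_less_irrefl: "\<not> comm_less u u"
  by (induction u) auto

lemma comm_less_total: "comm_less u v \<or> u = v \<or> comm_less v u"
proof (induction u arbitrary: v)
  case (Letter i)
  then show ?case by (cases v) auto
next
  case (Br a b)
  then show ?case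
  proof (cases v)
    case v: (Br a' b')
    then show ?thesis
      using Br.IH(1)[of a'] Br.IH(2)[of b']
        linorder_less_linear[of "weight (Br a b)" "weight (Br a' b')"]
      unfolding v comm_less.simps by metis
  qed simp
qed

lemma comm_less_trans: "comm_less u v \<Longrightarrow> comm_less v w \<Longrightarrow> comm_less u w"
proof (induction u arbitrary: v w)
  case (Letter i)
  then show ?case by (cases v; cases w) auto
next
  case (Br a b)
  show ?case
  proof (cases v; cases w)
    fix a' b' a'' b'' assume v: "v = Br a' b'" and w: "w = Br a'' b''"
    have "weight (Br a b) < weight v \<or>
        weight (Br a b) = weight v \<and> (comm_less a a' \<or> a = a' \<and> comm_less b b')"
      using Br.prems(1) unfolding v comm_less.simps .
    moreover have "weight v < weight w \<or>
        weight v = weight w \<and> (comm_less a' a'' \<or> a' = a'' \<and> comm_less b' b'')"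
      using Br.prems(2) unfolding v w comm_less.simps .
    ultimately have "weight (Br a b) < weight w \<or>
        weight (Br a b) = weight w \<and> (comm_less a a'' \<or> a = a'' \<and> comm_less b b'')"
      using Br.IH(1)[of a' a''] Br.IH(2)[of b' b''] by (metis order.strict_trans)
    then show ?thesis unfolding w comm_less.simps .
  qed (use Br.prems in auto)
qed

lemma finite_basic_commutators: "finite {t. basic_commutator d t \<and> weight t = n}"
proof (induction n rule: less_induct)
  case (less n)
  let ?B = "\<lambda>m. {t. basic_commutator d t \<and> weight t = m}"
  have pos: "weight w \<ge> 1" for w by (induction w) auto
  have "?B n \<subseteq> Letter ` {..<d} \<union> (\<lambda>(u, v). Br u v) ` ((\<Union>m<n. ?B m) \<times> (\<Union>m<n. ?B m))"
  proof
    fix t assume t: "t \<in> ?B n"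
    then have "basic_commutator d t" by simp
    then show "t \<in> Letter ` {..<d} \<union> (\<lambda>(u, v). Br u v) ` ((\<Union>m<n. ?B m) \<times> (\<Union>m<n. ?B m))"
    proof cases
      case (bracket u v)
      with t show ?thesis using pos[of u] pos[of v] by (auto intro!: image_eqI[of _ _ "(u, v)"])
    qed auto
  qed
  moreover have "finite (\<Union>m<n. ?B m)" using less by auto
  ultimately show ?case by (meson finite_SigmaI finite_UnI finite_imageI finite_lessThan finite_subset)
qed

end

theory Submission
  imports Defs "HOL-Algebra.Group_Action" "HOL-Algebra.Sylow"
begin

text \<open>
  Let \<open>h\<close> be a homomorphism from \<open>F\<close> onto \<open>G\<close> with kernel \<open>R\<close>. Put \<open>P\<^sub>i = h\<inverse>(\<mho>\<^sub>i(G))\<close> and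
  \<open>N\<^sub>i = [P\<^sub>i, F, \<dots>, F]\<close> with \<open>c\<close> entries \<open>F\<close>. Then \<open>P\<^sub>0 = F\<close>, and \<open>P\<^sub>k = R\<close> as soon as \<open>p\<^sup>k\<close> kills
  \<open>G\<close>; so \<open>N\<^sub>0\<close> is \<open>\<gamma>\<^sub>c\<^sub>+\<^sub>1(F)\<close>, \<open>N\<^sub>k\<close> is \<open>[R, F, \<dots>, F]\<close>, and the multiplier is the subgroup
  \<open>(R \<inter> N\<^sub>0) / N\<^sub>k\<close> of \<open>N\<^sub>0 / N\<^sub>k\<close>.

  In a powerful group the series \<open>\<mho>\<^sub>i(G)\<close> behaves as if \<open>G\<close> were abelian:
  \<open>[\<mho>\<^sub>i(G), G]\<close> lies in \<open>\<mho>\<^sub>i\<^sub>+\<^sub>1(G)\<close>, for \<open>p = 2\<close> even in \<open>\<mho>\<^sub>i\<^sub>+\<^sub>2(G)\<close> (\<open>powerful_commutator_agemo\<close>).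
  This passes to the \<open>N\<^sub>i\<close>: the quotients \<open>N\<^sub>i / N\<^sub>i\<^sub>+\<^sub>1\<close> are central and elementary abelian, and raising
  to the power \<open>p\<close> induces homomorphisms from \<open>N\<^sub>i / N\<^sub>i\<^sub>+\<^sub>1\<close> onto \<open>N\<^sub>i\<^sub>+\<^sub>1 / N\<^sub>i\<^sub>+\<^sub>2\<close>
  (\<open>pow_D\<close>, \<open>D_generated\<close>, \<open>commutator_D_D\<close>).

  Hence the direct sum of the \<open>N\<^sub>i / N\<^sub>i\<^sub>+\<^sub>1\<close> is a finite module over \<open>\<bbbF>\<^sub>p[t]\<close>, with \<open>t\<close> acting as the
  \<open>p\<close>-th power, that is generated in degree 0. For such a module the kernel of \<open>t\<close> has as many
  elements as its cokernel \<open>N\<^sub>0 / N\<^sub>1\<close>; therefore a subgroup of exponent \<open>p\<close> of \<open>N\<^sub>0 / N\<^sub>k\<close> has at most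
  \<open>|N\<^sub>0 / N\<^sub>1|\<close> elements (\<open>card_exponent_subgroup\<close>). The multiplier \<open>M\<close> is abelian, because
  \<open>[R, \<gamma>\<^sub>c\<^sub>+\<^sub>1(F)]\<close> is contained in \<open>[R, F, \<dots>, F]\<close>, and a finite abelian \<open>p\<close>-group in which the equation
  \<open>x\<^sup>p = 1\<close> has at most \<open>p\<^sup>m\<close> solutions is generated by \<open>m\<close> elements
  (\<open>exists_generators_card_le\<close>).

  It remains to see that \<open>N\<^sub>0 / N\<^sub>1\<close> has at most \<open>p\<close> to the power \<open>\<chi>\<^sub>c\<^sub>+\<^sub>1(d)\<close> elements. Modulo \<open>P\<^sub>1\<close>, which
  contains the derived subgroup, \<open>F\<close> is generated by \<open>d\<close> elements, and so \<open>\<gamma>\<^sub>c\<^sub>+\<^sub>1(F)\<close> is generated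
  modulo \<open>N\<^sub>1\<close> by the basic commutators of weight \<open>c + 1\<close> in these elements
  (\<open>lower_central_generated\<close>). This is the spanning half of Hall's basis theorem for free Lie rings,
  applied to the Lie ring that the quotients \<open>\<gamma>\<^sub>n(F) / [P\<^sub>1, F, \<dots>, F]\<close> form.
\<close>


section \<open>Commutator calculus\<close>

text \<open>
  The recursion equation would rewrite \<open>[H, G, \<dots>, G]\<close> into a nest of commutator subgroups, to
  which the lemmas on iterated commutators do not apply.
\<close>

declare iterated_commutator.simps(2) [simp del]

text \<open>
  The convention is that of \<^const>\<open>commutator_subgroup\<close>.
\<close>

definition commutator :: "('a, 'm) monoid_scheme \<Rightarrow> 'a \<Rightarrow> 'a \<Rightarrow> 'a" (infixl \<open>\<diamondop>\<index>\<close> 72) where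
  "x \<diamondop>\<^bsub>G\<^esub> y = x \<otimes>\<^bsub>G\<^esub> y \<otimes>\<^bsub>G\<^esub> inv\<^bsub>G\<^esub> x \<otimes>\<^bsub>G\<^esub> inv\<^bsub>G\<^esub> y"

context group
begin

lemma commutator_closed [simp, intro]:
  "\<lbrakk>x \<in> carrier G; y \<in> carrier G\<rbrakk> \<Longrightarrow> x \<diamondop> y \<in> carrier G"
  by (simp add: commutator_def)

lemma cancel_inv_mult: "\<lbrakk>x \<in> carrier G; y \<in> carrier G\<rbrakk> \<Longrightarrow> inv x \<otimes> (x \<otimes> y) = y"
  and cancel_mult_inv: "\<lbrakk>x \<in> carrier G; y \<in> carrier G\<rbrakk> \<Longrightarrow> x \<otimes> (inv x \<otimes> y) = y"
  by (simp_all flip: m_assoc)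

lemmas group_normalize = m_assoc inv_mult_group cancel_inv_mult cancel_mult_inv

lemma commutator_mult_left:
  "\<lbrakk>x \<in> carrier G; y \<in> carrier G; z \<in> carrier G\<rbrakk> \<Longrightarrow>
     (x \<otimes> y) \<diamondop> z = (x \<diamondop> (y \<diamondop> z)) \<otimes> (y \<diamondop> z) \<otimes> (x \<diamondop> z)"
  by (simp add: commutator_def group_normalize)

lemma commutator_mult_right:
  "\<lbrakk>x \<in> carrier G; y \<in> carrier G; z \<in> carrier G\<rbrakk> \<Longrightarrow>
     x \<diamondop> (y \<otimes> z) = (x \<diamondop> y) \<otimes> (y \<diamondop> (x \<diamondop> z)) \<otimes> (x \<diamondop> z)"
  by (simp add: commutator_def group_normalize)

lemma inv_commutator: "\<lbrakk>x \<in> carrier G; y \<in> carrier G\<rbrakk> \<Longrightarrow> inv (x \<diamondop> y) = y \<diamondop> x"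
  by (simp add: commutator_def group_normalize)

lemma commutator_inv_left:
  "\<lbrakk>x \<in> carrier G; y \<in> carrier G\<rbrakk> \<Longrightarrow> inv x \<diamondop> y = inv (inv (x \<diamondop> y \<diamondop> inv x) \<otimes> (x \<diamondop> y))"
  by (simp add: commutator_def group_normalize)

lemma commutator_inv_right:
  "\<lbrakk>x \<in> carrier G; y \<in> carrier G\<rbrakk> \<Longrightarrow> x \<diamondop> inv y = inv (inv (x \<diamondop> y \<diamondop> inv y) \<otimes> (x \<diamondop> y))"
  by (simp add: commutator_def group_normalize)

lemma conj_commutator:
  "\<lbrakk>x \<in> carrier G; y \<in> carrier G; g \<in> carrier G\<rbrakk> \<Longrightarrow>
     g \<otimes> (x \<diamondop> y) \<otimes> inv g = (g \<otimes> x \<otimes> inv g) \<diamondop> (g \<otimes> y \<otimes> inv g)"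
  by (simp add: commutator_def group_normalize)

lemma commutator_one_iff:
  assumes "x \<in> carrier G" "y \<in> carrier G"
  shows "x \<diamondop> y = \<one> \<longleftrightarrow> x \<otimes> y = y \<otimes> x"
proof -
  have "x \<otimes> y = (x \<diamondop> y) \<otimes> (y \<otimes> x)"
    using assms by (simp add: commutator_def group_normalize)
  then show ?thesis using assms by (metis commutator_closed l_one m_closed r_cancel_one)
qed

text \<open>
  The identity behind both the three subgroups lemma and the Jacobi identity of the associated
  graded Lie ring.
\<close>

lemma Hall_Witt:
  "\<lbrakk>x \<in> carrier G; y \<in> carrier G; z \<in> carrier G\<rbrakk> \<Longrightarrow>
     (y \<diamondop> x \<diamondop> (x \<otimes> z \<otimes> inv x)) \<otimes> (x \<diamondop> z \<diamondop> (z \<otimes> y \<otimes> inv z)) \<otimes> (z \<diamondop> y \<diamondop> (y \<otimes> x \<otimes> inv y)) = \<one>"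
  by (simp add: commutator_def group_normalize)

lemma commutator_inv_right_mem:
  assumes "subgroup S G" "x \<in> carrier G" "y \<in> carrier G" "x \<diamondop> y \<in> S" "x \<diamondop> y \<diamondop> inv y \<in> S"
  shows "x \<diamondop> inv y \<in> S"
  unfolding commutator_inv_right[OF assms(2,3)]
  using assms(1,4,5) by (intro subgroup.m_inv_closed subgroup.m_closed)

lemma commutator_inv_left_mem:
  assumes "subgroup S G" "x \<in> carrier G" "y \<in> carrier G" "x \<diamondop> y \<in> S" "x \<diamondop> y \<diamondop> inv x \<in> S"
  shows "inv x \<diamondop> y \<in> S"
  unfolding commutator_inv_left[OF assms(2,3)]
  using assms(1,4,5) by (intro subgroup.m_inv_closed subgroup.m_closed)

text \<open>
  As \<open>[ab, y] = [a, [b, y]] [b, y] [a, y]\<close>, the map \<open>a \<mapsto> [a, y]\<close> is a homomorphism up to errors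
  that \<open>S\<close> absorbs. Membership of commutators in \<open>S\<close> can therefore be tested on generators, in
  either entry.
\<close>

lemma subgroup_commutator_left:
  assumes A: "subgroup A G" and S: "subgroup S G" and y: "y \<in> carrier G"
    and sub: "\<And>a g. \<lbrakk>a \<in> A; g \<in> A\<rbrakk> \<Longrightarrow> a \<diamondop> y \<diamondop> g \<in> S"
  shows "subgroup {a \<in> A. a \<diamondop> y \<in> S} G"
proof -
  interpret A: subgroup A G by (rule A)
  interpret S: subgroup S G by (rule S)
  show ?thesis
  proof (rule subgroup.intro)
    show "\<one> \<in> {a \<in> A. a \<diamondop> y \<in> S}" using y by (simp add: commutator_def)
  next
    fix a b assume "a \<in> {a \<in> A. a \<diamondop> y \<in> S}" "b \<in> {a \<in> A. a \<diamondop> y \<in> S}"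
    then have *: "a \<in> A" "b \<in> A" "a \<diamondop> y \<in> S" "b \<diamondop> y \<in> S" by auto
    have "inv (b \<diamondop> y \<diamondop> a) \<in> S" using sub * by blast
    then show "a \<otimes> b \<in> {a \<in> A. a \<diamondop> y \<in> S}"
      using * y by (simp add: commutator_mult_left inv_commutator)
  next
    fix a assume "a \<in> {a \<in> A. a \<diamondop> y \<in> S}"
    then have *: "a \<in> A" "a \<diamondop> y \<in> S" by auto
    then have "a \<diamondop> y \<diamondop> inv a \<in> S" using sub by blast
    with * y show "inv a \<in> {a \<in> A. a \<diamondop> y \<in> S}"
      using commutator_inv_left_mem[OF S] by simp
  qed auto
qed

lemma subgroup_commutator_right:
  assumes B: "subgroup B G" and S: "subgroup S G" and x: "x \<in> carrier G"
    and sub: "\<And>g h. \<lbrakk>g \<in> B; h \<in> B\<rbrakk> \<Longrightarrow> x \<diamondop> g \<diamondop> h \<in> S"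
  shows "subgroup {g \<in> B. x \<diamondop> g \<in> S} G"
proof -
  interpret B: subgroup B G by (rule B)
  interpret S: subgroup S G by (rule S)
  show ?thesis
  proof (rule subgroup.intro)
    show "\<one> \<in> {g \<in> B. x \<diamondop> g \<in> S}" using x by (simp add: commutator_def)
  next
    fix a b assume "a \<in> {g \<in> B. x \<diamondop> g \<in> S}" "b \<in> {g \<in> B. x \<diamondop> g \<in> S}"
    then have *: "a \<in> B" "b \<in> B" "x \<diamondop> a \<in> S" "x \<diamondop> b \<in> S" by auto
    have "inv (x \<diamondop> b \<diamondop> a) \<in> S" using sub * by blast
    then show "a \<otimes> b \<in> {g \<in> B. x \<diamondop> g \<in> S}"
      using * x by (simp add: commutator_mult_right inv_commutator)
  next
    fix a assume "a \<in> {g \<in> B. x \<diamondop> g \<in> S}"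
    then have *: "a \<in> B" "x \<diamondop> a \<in> S" by auto
    then have "x \<diamondop> a \<diamondop> inv a \<in> S" using sub by blast
    with * x show "inv a \<in> {g \<in> B. x \<diamondop> g \<in> S}"
      using commutator_inv_right_mem[OF S] by simp
  qed auto
qed

lemma commutator_mem_normal_left:
  assumes "N \<lhd> G" "x \<in> N" "y \<in> carrier G" shows "x \<diamondop> y \<in> N"
proof -
  interpret normal N G by fact
  have "x \<otimes> (y \<otimes> inv x \<otimes> inv y) \<in> N" using assms inv_op_closed2 by simp
  then show ?thesis using assms by (simp add: commutator_def m_assoc)
qed

lemma commutator_mem_swap:
  assumes "subgroup S G" "x \<in> carrier G" "y \<in> carrier G"
  shows "x \<diamondop> y \<in> S \<longleftrightarrow> y \<diamondop> x \<in> S"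
proof -
  have "x \<diamondop> y = inv (y \<diamondop> x)" "y \<diamondop> x = inv (x \<diamondop> y)"
    using assms by (simp_all only: inv_commutator)
  then show ?thesis using subgroup.m_inv_closed[OF assms(1)] by metis
qed

lemma commutator_mem_normal_right:
  assumes "N \<lhd> G" "y \<in> N" "x \<in> carrier G" shows "x \<diamondop> y \<in> N"
proof -
  have N: "subgroup N G" using assms(1) by (rule normal_imp_subgroup)
  show ?thesis
    using commutator_mem_normal_left[OF assms] commutator_mem_swap[OF N assms(3)]
      subgroup.mem_carrier[OF N assms(2)] by blast
qed

lemma commutator_subgroupI:
  "\<lbrakk>h \<in> H; k \<in> K\<rbrakk> \<Longrightarrow> h \<diamondop> k \<in> commutator_subgroup G H K"
  unfolding commutator_subgroup_def commutator_def by (rule generate.incl) auto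

lemma commutator_subgroup_least:
  assumes "subgroup S G" "\<And>h k. \<lbrakk>h \<in> H; k \<in> K\<rbrakk> \<Longrightarrow> h \<diamondop> k \<in> S"
  shows "commutator_subgroup G H K \<subseteq> S"
  unfolding commutator_subgroup_def
  using assms by (intro generate_subgroup_incl) (auto simp: commutator_def)

lemma subgroup_commutator_subgroup:
  assumes "H \<subseteq> carrier G" "K \<subseteq> carrier G"
  shows "subgroup (commutator_subgroup G H K) G"
  unfolding commutator_subgroup_def using assms by (intro generate_is_subgroup) blast

lemma normal_commutator_subgroup:
  assumes "H \<lhd> G" "K \<lhd> G"
  shows "commutator_subgroup G H K \<lhd> G"
  unfolding commutator_subgroup_def
proof (rule normal_generateI)
  have HK: "H \<subseteq> carrier G" "K \<subseteq> carrier G"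
    using assms normal_imp_subgroup subgroup.subset by blast+
  then show "{h \<otimes> k \<otimes> inv h \<otimes> inv k |h k. h \<in> H \<and> k \<in> K} \<subseteq> carrier G" by blast
  fix w g assume "w \<in> {h \<otimes> k \<otimes> inv h \<otimes> inv k |h k. h \<in> H \<and> k \<in> K}" and g: "g \<in> carrier G"
  then obtain h k where hk: "h \<in> H" "k \<in> K" "w = h \<diamondop> k" by (auto simp: commutator_def)
  have "g \<otimes> w \<otimes> inv g = (g \<otimes> h \<otimes> inv g) \<diamondop> (g \<otimes> k \<otimes> inv g)"
    using hk g HK conj_commutator by blast
  moreover have "g \<otimes> h \<otimes> inv g \<in> H" "g \<otimes> k \<otimes> inv g \<in> K"
    using normal.inv_op_closed2[OF assms(1) g] normal.inv_op_closed2[OF assms(2) g] hk by blast+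
  ultimately show "g \<otimes> w \<otimes> inv g \<in> {h \<otimes> k \<otimes> inv h \<otimes> inv k |h k. h \<in> H \<and> k \<in> K}"
    by (auto simp: commutator_def)
qed

lemma commutator_subgroup_mono:
  assumes "H \<subseteq> H'" "K \<subseteq> K'" "H' \<subseteq> carrier G" "K' \<subseteq> carrier G"
  shows "commutator_subgroup G H K \<subseteq> commutator_subgroup G H' K'"
  using assms by (intro commutator_subgroup_least subgroup_commutator_subgroup commutator_subgroupI) auto

lemma normal_iterated_commutator: "H \<lhd> G \<Longrightarrow> iterated_commutator G H n \<lhd> G"
  by (induction n) (simp_all add: iterated_commutator.simps(2) normal_commutator_subgroup normal_self)

text \<open>
  Splitting off the innermost commutator instead of the outermost one: an inclusion for
  \<open>[H, G]\<close> is turned into one for \<open>[H, G, \<dots>, G]\<close>.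
\<close>

lemma iterated_commutator_Suc_eq:
  "iterated_commutator G H (Suc n) = iterated_commutator G (commutator_subgroup G H (carrier G)) n"
  by (induction n) (simp_all add: iterated_commutator.simps(2))

lemma iterated_commutator_subset_carrier: "H \<lhd> G \<Longrightarrow> iterated_commutator G H n \<subseteq> carrier G"
  by (intro subgroup.subset normal_imp_subgroup normal_iterated_commutator)

lemma iterated_commutator_mono:
  assumes "H \<subseteq> K" "K \<lhd> G"
  shows "iterated_commutator G H n \<subseteq> iterated_commutator G K n"
proof (induction n)
  case (Suc n)
  then show ?case unfolding iterated_commutator.simps
    using assms by (intro commutator_subgroup_mono iterated_commutator_subset_carrier) auto
qed (use assms in simp)

lemma commutator_subgroup_subset_left:
  "N \<lhd> G \<Longrightarrow> commutator_subgroup G N (carrier G) \<subseteq> N"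
  by (intro commutator_subgroup_least commutator_mem_normal_left normal_imp_subgroup)

lemma iterated_commutator_Suc_subset:
  "H \<lhd> G \<Longrightarrow> iterated_commutator G H (Suc n) \<subseteq> iterated_commutator G H n"
  by (simp add: iterated_commutator.simps(2) commutator_subgroup_subset_left normal_iterated_commutator)

lemma commutator_iterated:
  "\<lbrakk>x \<in> iterated_commutator G H n; y \<in> carrier G\<rbrakk> \<Longrightarrow> x \<diamondop> y \<in> iterated_commutator G H (Suc n)"
  by (simp add: iterated_commutator.simps(2) commutator_subgroupI)

text \<open>
  By the three subgroups lemma \<open>[A, [\<gamma>\<^sub>n, G]]\<close> is contained in the product of
  \<open>[[A, \<gamma>\<^sub>n], G]\<close> and \<open>[[A, G], \<gamma>\<^sub>n]\<close>. To the first factor the induction hypothesis applies with \<open>A\<close>,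
  to the second one with \<open>[A, G]\<close>. Indices of \<^const>\<open>iterated_commutator\<close> start at 0, so that
  \<open>g\<close> ranges over \<open>\<gamma>\<^sub>n\<^sub>+\<^sub>1\<close>.
\<close>

lemma commutator_lower_central:
  assumes "A \<lhd> G" "a \<in> A" "g \<in> iterated_commutator G (carrier G) n"
  shows "a \<diamondop> g \<in> iterated_commutator G A (Suc n)"
  using assms
proof (induction n arbitrary: A a g)
  case 0
  then show ?case by (simp add: iterated_commutator.simps(2) commutator_subgroupI)
next
  case (Suc n)
  let ?L = "iterated_commutator G (carrier G)"
  let ?W = "iterated_commutator G A (Suc (Suc n))"
  have A: "A \<subseteq> carrier G" using Suc.prems normal_imp_subgroup subgroup.subset by blast
  have Lc: "?L m \<subseteq> carrier G" for m
    by (simp add: iterated_commutator_subset_carrier normal_self)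
  have W: "?W \<lhd> G" using Suc.prems(1) normal_iterated_commutator by blast
  then have Ws: "subgroup ?W G" by (rule normal_imp_subgroup)
  let ?C = "{g \<in> carrier G. \<forall>a\<in>A. a \<diamondop> g \<in> ?W}"
  have C: "subgroup ?C G"
  proof (rule subgroup.intro)
    show "\<one> \<in> ?C" using A subgroup.one_closed[OF Ws] by (auto simp: commutator_def)
  next
    fix g h assume *: "g \<in> ?C" "h \<in> ?C"
    { fix a assume a: "a \<in> A"
      then have "a \<diamondop> g \<in> ?W" "a \<diamondop> h \<in> ?W" using * by auto
      moreover from this have "g \<diamondop> (a \<diamondop> h) \<in> ?W" using * W commutator_mem_normal_right by blast
      ultimately have "a \<diamondop> (g \<otimes> h) \<in> ?W" using * a A subgroup.m_closed[OF Ws]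
        by (simp add: commutator_mult_right subset_iff) }
    with * show "g \<otimes> h \<in> ?C" by auto
  next
    fix g assume *: "g \<in> ?C"
    then have gc: "g \<in> carrier G" by simp
    { fix a assume a: "a \<in> A"
      have 1: "a \<diamondop> g \<in> ?W" using * a by blast
      have 2: "a \<diamondop> g \<diamondop> inv g \<in> ?W" using gc by (intro commutator_mem_normal_left[OF W 1]) simp
      have "a \<diamondop> inv g \<in> ?W"
        by (rule commutator_inv_right_mem[OF Ws _ gc 1 2]) (use a A in blast) }
    with gc show "inv g \<in> ?C" by simp
  qed auto
  have "?L (Suc n) \<subseteq> ?C"
    unfolding iterated_commutator.simps(2)[of G "carrier G" n]
  proof (rule commutator_subgroup_least[OF C])
    fix h f assume h: "h \<in> ?L n" and f: "f \<in> carrier G"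
    have hc: "h \<in> carrier G" using h Lc by blast
    { fix a assume a: "a \<in> A"
      \<comment> \<open>the conjugate for which the last factor of the Hall-Witt identity is \<open>[[h, f], a]\<close>\<close>
      let ?a = "inv f \<otimes> a \<otimes> f"
      have a': "?a \<in> A" using Suc.prems(1) a f normal.inv_op_closed1 by metis
      have ac: "?a \<in> carrier G" "a \<in> carrier G" using a a' A by auto
      have 1: "f \<diamondop> ?a \<diamondop> (?a \<otimes> h \<otimes> inv ?a) \<in> ?W"
      proof -
        have "subgroup (commutator_subgroup G A (carrier G)) G"
          by (rule subgroup_commutator_subgroup[OF A order_refl])
        then have "f \<diamondop> ?a \<in> commutator_subgroup G A (carrier G)"
          using commutator_subgroupI[OF a' f] f ac commutator_mem_swap by blast
        moreover have "?a \<otimes> h \<otimes> inv ?a \<in> ?L n"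
          using h ac normal.inv_op_closed2 normal_iterated_commutator normal_self by metis
        ultimately show ?thesis
          unfolding iterated_commutator_Suc_eq[of A "Suc n"]
          using Suc.IH[OF normal_commutator_subgroup[OF Suc.prems(1) normal_self]] by blast
      qed
      have 2: "?a \<diamondop> h \<diamondop> (h \<otimes> f \<otimes> inv h) \<in> ?W"
        by (rule commutator_iterated[OF Suc.IH[OF Suc.prems(1) a' h]]) (use hc f in simp)
      have e: "(f \<diamondop> ?a \<diamondop> (?a \<otimes> h \<otimes> inv ?a)) \<otimes> (?a \<diamondop> h \<diamondop> (h \<otimes> f \<otimes> inv h)) \<otimes>
          (h \<diamondop> f \<diamondop> (f \<otimes> ?a \<otimes> inv f)) = \<one>"
        by (rule Hall_Witt) (use ac hc f in auto)
      have "f \<otimes> ?a \<otimes> inv f = a" using ac f by (simp add: group_normalize)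
      have c: "h \<diamondop> f \<diamondop> a \<in> carrier G" using hc f ac by simp
      have "inv (h \<diamondop> f \<diamondop> a) = (f \<diamondop> ?a \<diamondop> (?a \<otimes> h \<otimes> inv ?a)) \<otimes> (?a \<diamondop> h \<diamondop> (h \<otimes> f \<otimes> inv h))"
        by (rule inv_equality[OF e[unfolded \<open>f \<otimes> ?a \<otimes> inv f = a\<close>] c]) (use ac hc f in simp)
      then have "inv (h \<diamondop> f \<diamondop> a) \<in> ?W"
        using subgroup.m_closed[OF Ws 1 2] by presburger
      then have "h \<diamondop> f \<diamondop> a \<in> ?W"
        using subgroup.m_inv_closed[OF Ws] inv_inv[OF c] by metis
      then have "a \<diamondop> (h \<diamondop> f) \<in> ?W"
        using commutator_mem_swap[OF Ws] hc f ac by blast }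
    then show "h \<diamondop> f \<in> ?C" using hc f by blast
  qed
  with Suc.prems show ?case by blast
qed

end


section \<open>Calculations modulo a normal subgroup\<close>

context group
begin

lemma group_hom_rcos: "T \<lhd> G \<Longrightarrow> group_hom G (G Mod T) (\<lambda>x. T #> x)"
  by (simp add: group_hom_def group_hom_axioms_def normal.factorgroup_is_group
      normal.r_coset_hom_Mod group_axioms)

lemma rcos_eq_iff:
  assumes "T \<lhd> G" "x \<in> carrier G" "y \<in> carrier G"
  shows "T #> x = T #> y \<longleftrightarrow> x \<otimes> inv y \<in> T"
proof -
  interpret normal T G by fact
  have T: "T \<subseteq> carrier G" by (rule subset)
  show ?thesis
  proof
    assume "T #> x = T #> y"
    then have "T #> (x \<otimes> inv y) = T" by (rule coset_mult_inv2) (use assms T in auto)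
    then show "x \<otimes> inv y \<in> T" by (rule coset_join1) (use assms subgroup_axioms in auto)
  next
    assume "x \<otimes> inv y \<in> T"
    then have "T #> (x \<otimes> inv y) = T" by (intro coset_join2) (use assms subgroup_axioms in auto)
    then show "T #> x = T #> y" by (rule coset_mult_inv1) (use assms T in auto)
  qed
qed

lemma rcos_eq_self_iff:
  assumes "T \<lhd> G" "x \<in> carrier G"
  shows "T #> x = T \<longleftrightarrow> x \<in> T"
  using assms coset_join1 coset_join2 normal_imp_subgroup by metis

end

lemma (in group_hom) hom_commutator:
  "\<lbrakk>x \<in> carrier G; y \<in> carrier G\<rbrakk> \<Longrightarrow> h (x \<diamondop>\<^bsub>G\<^esub> y) = h x \<diamondop>\<^bsub>H\<^esub> h y"
  by (simp add: commutator_def)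

context group
begin

lemma mult_comm_if_commutator_mem:
  assumes "T \<lhd> G" "x \<in> carrier G" "y \<in> carrier G" "x \<diamondop> y \<in> T"
  shows "(T #> x) \<otimes>\<^bsub>G Mod T\<^esub> (T #> y) = (T #> y) \<otimes>\<^bsub>G Mod T\<^esub> (T #> x)"
proof -
  interpret h: group_hom G "G Mod T" "\<lambda>x. T #> x" by (rule group_hom_rcos) fact
  have "T #> (x \<diamondop> y) = \<one>\<^bsub>G Mod T\<^esub>" using assms rcos_eq_self_iff by simp
  then show ?thesis
    using assms h.hom_commutator h.H.commutator_one_iff h.hom_closed by metis
qed

text \<open>
  Conjugation by \<open>a\<close> multiplies \<open>b = [a, y]\<close> by \<open>z = [a, b]\<close>, which commutes with \<open>a\<close> and \<open>b\<close>. As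
  \<open>[a\<^sup>n, y]\<close> is the product of the conjugates of \<open>b\<close> by \<open>a\<^sup>n\<^sup>-\<^sup>1, \<dots>, a, 1\<close>, the factors \<open>z\<close> number
  \<open>(n - 1) + \<dots> + 1 + 0\<close>.
\<close>

lemma commutator_pow:
  fixes n :: nat
  assumes a: "a \<in> carrier G" and y: "y \<in> carrier G"
    and za: "(a \<diamondop> (a \<diamondop> y)) \<otimes> a = a \<otimes> (a \<diamondop> (a \<diamondop> y))"
    and zb: "(a \<diamondop> (a \<diamondop> y)) \<otimes> (a \<diamondop> y) = (a \<diamondop> y) \<otimes> (a \<diamondop> (a \<diamondop> y))"
  shows "(a [^] n) \<diamondop> y = (a \<diamondop> (a \<diamondop> y)) [^] (n choose 2) \<otimes> (a \<diamondop> y) [^] n"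
proof -
  define b where "b = a \<diamondop> y"
  define z where "z = a \<diamondop> b"
  have b: "b \<in> carrier G" and z: "z \<in> carrier G" using a y by (simp_all add: b_def z_def)
  have za: "z [^] (m::nat) \<otimes> a = a \<otimes> z [^] m" for m
    using za a z by (intro group_commutes_pow) (simp_all add: z_def b_def)
  have zb: "z \<otimes> b [^] m = b [^] m \<otimes> z" for m :: nat
    using zb b z by (intro group_commutes_pow[symmetric]) (simp_all add: z_def b_def)
  have ab: "a \<otimes> b = z \<otimes> b \<otimes> a"
    using a b by (simp add: z_def commutator_def group_normalize)
  have abn: "a \<otimes> b [^] m = z [^] m \<otimes> b [^] m \<otimes> a" for m :: nat
  proof (induction m)
    case (Suc m)
    have "a \<otimes> b [^] Suc m = (a \<otimes> b [^] m) \<otimes> b" using a b by (simp add: m_assoc)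
    also have "\<dots> = z [^] m \<otimes> b [^] m \<otimes> (a \<otimes> b)" using Suc a b z by (simp add: m_assoc)
    also have "\<dots> = z [^] m \<otimes> (b [^] m \<otimes> z) \<otimes> b \<otimes> a" using ab a b z by (simp add: m_assoc)
    also have "\<dots> = z [^] Suc m \<otimes> b [^] Suc m \<otimes> a" using zb[of m, symmetric] a b z by (simp add: m_assoc)
    finally show ?case .
  qed (use a in simp)
  have "(a [^] n) \<diamondop> y = z [^] (n choose 2) \<otimes> b [^] n"
  proof (induction n)
    case 0
    then show ?case using y by (simp add: commutator_def numeral_2_eq_2)
  next
    case (Suc n)
    have "(a [^] Suc n) \<diamondop> y = (a \<otimes> a [^] n) \<diamondop> y"
      using nat_pow_Suc2[OF a] by simp
    also have "\<dots> = a \<otimes> (a [^] n \<diamondop> y) \<otimes> inv a \<otimes> b"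
      using a y by (simp add: b_def commutator_def group_normalize)
    also have "\<dots> = (a \<otimes> z [^] (n choose 2)) \<otimes> b [^] n \<otimes> inv a \<otimes> b"
      using Suc a b z by (simp add: m_assoc)
    also have "\<dots> = z [^] (n choose 2) \<otimes> (a \<otimes> b [^] n) \<otimes> inv a \<otimes> b"
      using a b z by (simp add: m_assoc flip: za)
    also have "\<dots> = z [^] (n choose 2) \<otimes> z [^] n \<otimes> b [^] n \<otimes> b"
      unfolding abn using a b z by (simp add: group_normalize)
    also have "\<dots> = z [^] (Suc n choose 2) \<otimes> b [^] Suc n"
      using a b z by (simp add: m_assoc nat_pow_mult numeral_2_eq_2 add.commute)
    finally show ?case .
  qed
  then show ?thesis by (simp add: z_def b_def)
qed

text \<open>
  The hypotheses say that, in the quotient by \<open>T\<close>, the element \<open>[a, [a, y]]\<close> commutes with \<open>a\<close> and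
  \<open>[a, y]\<close> and has the required power equal to 1.
\<close>

lemma commutator_pow_mod:
  fixes n :: nat
  assumes T: "T \<lhd> G" and a: "a \<in> carrier G" and y: "y \<in> carrier G"
    and za: "a \<diamondop> (a \<diamondop> y) \<diamondop> a \<in> T"
    and zb: "a \<diamondop> (a \<diamondop> y) \<diamondop> (a \<diamondop> y) \<in> T"
    and z: "(a \<diamondop> (a \<diamondop> y)) [^] (n choose 2) \<in> T"
  shows "((a [^] n) \<diamondop> y) \<otimes> inv ((a \<diamondop> y) [^] n) \<in> T"
proof -
  interpret h: group_hom G "G Mod T" "\<lambda>x. T #> x" by (rule group_hom_rcos) fact
  let ?b = "a \<diamondop> y" and ?z = "a \<diamondop> (a \<diamondop> y)"
  have bz: "?b \<in> carrier G" "?z \<in> carrier G" using a y by simp_all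
  have b: "(T #> a) \<diamondop>\<^bsub>G Mod T\<^esub> (T #> y) = T #> ?b"
    using a y by (rule h.hom_commutator[symmetric])
  have z': "(T #> a) \<diamondop>\<^bsub>G Mod T\<^esub> (T #> ?b) = T #> ?z"
    using a bz(1) by (rule h.hom_commutator[symmetric])
  have "(T #> a) [^]\<^bsub>G Mod T\<^esub> n \<diamondop>\<^bsub>G Mod T\<^esub> (T #> y) =
      (T #> ?z) [^]\<^bsub>G Mod T\<^esub> (n choose 2) \<otimes>\<^bsub>G Mod T\<^esub> (T #> ?b) [^]\<^bsub>G Mod T\<^esub> n"
    using h.H.commutator_pow[of "T #> a" "T #> y" n, unfolded b z', OF h.hom_closed[OF a]
        h.hom_closed[OF y] mult_comm_if_commutator_mem[OF T bz(2) a za]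
        mult_comm_if_commutator_mem[OF T bz(2,1) zb]] .
  moreover have "(T #> ?z) [^]\<^bsub>G Mod T\<^esub> (n choose 2) = \<one>\<^bsub>G Mod T\<^esub>"
    using rcos_eq_self_iff[OF T nat_pow_closed[OF bz(2)], of "n choose 2"] z
      h.hom_nat_pow[OF bz(2), of "n choose 2"] by simp
  ultimately have e: "(T #> a) [^]\<^bsub>G Mod T\<^esub> n \<diamondop>\<^bsub>G Mod T\<^esub> (T #> y) = (T #> ?b) [^]\<^bsub>G Mod T\<^esub> n"
    using h.H.l_one[OF h.H.nat_pow_closed[OF h.hom_closed[OF bz(1)]], of n] by simp
  have "T #> ((a [^] n) \<diamondop> y) = (T #> a [^] n) \<diamondop>\<^bsub>G Mod T\<^esub> (T #> y)"
    by (rule h.hom_commutator) (use a y in auto)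
  also have "\<dots> = T #> (?b [^] n)"
    unfolding h.hom_nat_pow[OF a] h.hom_nat_pow[OF bz(1)] by (rule e)
  finally show ?thesis by (rule rcos_eq_iff[OF T, THEN iffD1, rotated 2]) (use a y in auto)
qed

lemma commutator_pow_mod_central:
  fixes n :: nat
  assumes T: "T \<lhd> G" and a: "a \<in> carrier G" and y: "y \<in> carrier G"
    and z: "a \<diamondop> y \<diamondop> a \<in> T"
  shows "((a [^] n) \<diamondop> y) \<otimes> inv ((a \<diamondop> y) [^] n) \<in> T"
proof -
  have Ts: "subgroup T G" using T by (rule normal_imp_subgroup)
  have 1: "a \<diamondop> (a \<diamondop> y) \<in> T" using z commutator_mem_swap[OF Ts] a y by blast
  have "u [^] m \<in> T" if "u \<in> T" for u and m :: nat
    using that subgroup.one_closed[OF Ts] subgroup.m_closed[OF Ts] by (induction m) simp_all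
  with 1 show ?thesis
    using a y by (intro commutator_pow_mod[OF T] commutator_mem_normal_left[OF T 1]) auto
qed

lemma mult_pow_mod:
  fixes n :: nat
  assumes T: "T \<lhd> G" and x: "x \<in> carrier G" and y: "y \<in> carrier G" and "x \<diamondop> y \<in> T"
  shows "(x \<otimes> y) [^] n \<otimes> inv (x [^] n \<otimes> y [^] n) \<in> T"
proof -
  interpret h: group_hom G "G Mod T" "\<lambda>x. T #> x" by (rule group_hom_rcos) fact
  note hc = h.hom_closed[OF x] h.hom_closed[OF y]
  have "T #> ((x \<otimes> y) [^] n) = ((T #> x) \<otimes>\<^bsub>G Mod T\<^esub> (T #> y)) [^]\<^bsub>G Mod T\<^esub> n"
    unfolding h.hom_nat_pow[OF m_closed[OF x y]] h.hom_mult[OF x y] ..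
  also have "\<dots> = (T #> x) [^]\<^bsub>G Mod T\<^esub> n \<otimes>\<^bsub>G Mod T\<^esub> (T #> y) [^]\<^bsub>G Mod T\<^esub> n"
    by (rule h.H.pow_mult_distrib[OF mult_comm_if_commutator_mem[OF assms] hc])
  also have "\<dots> = T #> (x [^] n \<otimes> y [^] n)"
    unfolding h.hom_nat_pow[OF x, symmetric] h.hom_nat_pow[OF y, symmetric]
    by (rule h.hom_mult[symmetric]) (use x y in auto)
  finally show ?thesis by (rule rcos_eq_iff[OF T, THEN iffD1, rotated 2]) (use x y in auto)
qed

lemma mem_if_quotient_mem:
  assumes "subgroup S G" "x \<otimes> inv y \<in> S" "x \<in> carrier G" "y \<in> carrier G"
  shows "x \<in> S \<longleftrightarrow> y \<in> S"
proof -
  interpret subgroup S G by fact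
  have e: "x = (x \<otimes> inv y) \<otimes> y" "y = inv (x \<otimes> inv y) \<otimes> x"
    using assms by (simp_all add: group_normalize)
  have "y \<in> S \<Longrightarrow> x \<in> S" using m_closed[OF assms(2), of y] e(1) by simp
  moreover have "x \<in> S \<Longrightarrow> y \<in> S" using m_closed[OF m_inv_closed[OF assms(2)], of x] e(2) by simp
  ultimately show ?thesis by blast
qed

lemma subgroup_pow_mod:
  fixes n :: nat
  assumes A: "subgroup A G" and T: "T \<lhd> G" and AA: "\<And>x y. \<lbrakk>x \<in> A; y \<in> A\<rbrakk> \<Longrightarrow> x \<diamondop> y \<in> T"
  shows "subgroup {x \<in> A. x [^] n \<in> T} G"
proof -
  interpret A: subgroup A G by (rule A)
  interpret T: normal T G by (rule T)
  show ?thesis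
  proof (rule subgroup.intro)
    fix x y assume "x \<in> {x \<in> A. x [^] n \<in> T}" "y \<in> {x \<in> A. x [^] n \<in> T}"
    then have *: "x \<in> A" "y \<in> A" "x [^] n \<in> T" "y [^] n \<in> T" by auto
    then have c: "x \<in> carrier G" "y \<in> carrier G" by simp_all
    have "(x \<otimes> y) [^] n \<otimes> inv (x [^] n \<otimes> y [^] n) \<in> T"
      by (rule mult_pow_mod[OF T c AA[OF *(1,2)]])
    then have "(x \<otimes> y) [^] n \<in> T"
      using mem_if_quotient_mem[OF T.subgroup_axioms] T.m_closed[OF *(3,4)] c
      by (metis m_closed nat_pow_closed)
    with A.m_closed[OF *(1,2)] show "x \<otimes> y \<in> {x \<in> A. x [^] n \<in> T}" by blast
  next
    fix x assume "x \<in> {x \<in> A. x [^] n \<in> T}"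
    then have *: "x \<in> A" "x [^] n \<in> T" by auto
    then have "inv x [^] n \<in> T" using nat_pow_inv[of x n] A.mem_carrier T.m_inv_closed by metis
    with A.m_inv_closed[OF *(1)] show "inv x \<in> {x \<in> A. x [^] n \<in> T}" by blast
  qed (auto simp: T.one_closed)
qed

end


section \<open>Finite \<open>p\<close>-groups\<close>

context group
begin

text \<open>
  A prime \<open>q\<close> dividing the order gives, by Sylow's theorem, a subgroup of order \<open>q\<close>, hence an
  element of order \<open>q\<close>; so \<open>q = p\<close>.
\<close>

lemma p_group_order:
  assumes p: "Factorial_Ring.prime p" and pg: "p_group p G" and fin: "finite (carrier G)"
  shows "\<exists>n. order G = p ^ n"
proof -
  have "q = p" if q: "Factorial_Ring.prime q" and dvd: "q dvd order G" for q
  proof -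
    obtain m where "order G = q ^ 1 * m" using dvd unfolding dvd_def power_one_right by blast
    then obtain H where H: "subgroup H G" "card H = q"
      using sylow_thm[OF q group_axioms _ fin, of 1] unfolding power_one_right by blast
    have "H \<noteq> {\<one>}"
    proof
      assume "H = {\<one>}"
      then have "q = 1" using H(2) by simp
      then show False using q by simp
    qed
    then obtain x where x: "x \<in> H" "x \<noteq> \<one>" using subgroup.one_closed[OF H(1)] by blast
    have xc: "x \<in> carrier G" by (rule subgroup.mem_carrier[OF H(1) x(1)])
    interpret H: group "G\<lparr>carrier := H\<rparr>" using H by (simp add: subgroup_imp_group)
    have "x [^]\<^bsub>G\<lparr>carrier := H\<rparr>\<^esub> order (G\<lparr>carrier := H\<rparr>) = \<one>"
      using H.pow_order_eq_1[of x] x(1) by simp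
    then have "x [^] q = \<one>"
      using H(2) nat_pow_consistent[of x q H] by (simp add: order_def)
    then have "ord x dvd q" using pow_eq_id[OF xc] by blast
    moreover have "ord x \<noteq> 1" using ord_eq_1[OF xc] x(2) by simp
    ultimately have "ord x = q" using q prime_nat_iff by blast
    moreover obtain k where "ord x = p ^ k" using pg xc unfolding p_group_def by blast
    ultimately have "q dvd p ^ k" by simp
    then show ?thesis using q p prime_dvd_power primes_dvd_imp_eq by blast
  qed
  moreover have "order G \<noteq> 0" using fin order_gt_0_iff_finite by simp
  moreover obtain r where r: "order G = p ^ multiplicity p (order G) * r" "\<not> p dvd r"
    using multiplicity_decompose'[of "order G" p] \<open>order G \<noteq> 0\<close> p not_prime_unit by blast
  ultimately have "r = 1"
    using prime_factor_nat[of r] dvd_mult[of _ r "p ^ multiplicity p (order G)"] by force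
  then show ?thesis using r(1) by auto
qed

text \<open>
  The class equation: if the centre were trivial, all conjugacy classes but one would have size
  divisible by \<open>p\<close>.
\<close>

lemma p_group_center_nontrivial:
  assumes p: "Factorial_Ring.prime p" and ord: "order G = p ^ n" and n: "n \<noteq> 0"
  shows "\<exists>z\<in>carrier G. z \<noteq> \<one> \<and> (\<forall>g\<in>carrier G. z \<otimes> g = g \<otimes> z)"
proof (rule ccontr)
  assume "\<not> ?thesis"
  then have triv: "z = \<one>" if "z \<in> carrier G" "\<And>g. g \<in> carrier G \<Longrightarrow> z \<otimes> g = g \<otimes> z" for z
    using that by blast
  define \<phi> where "\<phi> = (\<lambda>g. \<lambda>h\<in>carrier G. g \<otimes> h \<otimes> inv g)"
  interpret act: group_action G "carrier G" \<phi> unfolding \<phi>_def by (rule action_by_conjugation)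
  have fin: "finite (carrier G)"
    using ord p order_gt_0_iff_finite by (simp add: prime_gt_0_nat)
  let ?O = "orbits G (carrier G) \<phi>"
  have finO: "finite ?O" using fin by (simp add: orbits_def)
  have one: "{\<one>} \<in> ?O"
  proof -
    have "orbit G \<phi> \<one> = {\<one>}" by (auto simp: orbit_def \<phi>_def intro!: exI[of _ \<one>])
    then show ?thesis unfolding orbits_def using one_closed by blast
  qed
  have dvd: "p dvd card B" if "B \<in> ?O - {{\<one>}}" for B
  proof -
    have "\<exists>x. B = orbit G \<phi> x \<and> x \<in> carrier G"
      using DiffD1[OF that] unfolding orbits_def mem_Collect_eq .
    then obtain x where x: "x \<in> carrier G" "B = orbit G \<phi> x" by (elim exE conjE)
    have "card B dvd p ^ n" using act.orbit_stabilizer_theorem[OF x(1)] x ord by (metis dvd_triv_left)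
    then obtain k where k: "card B = p ^ k" using divides_primepow_nat p by blast
    have "k \<noteq> 0"
    proof
      assume "k = 0"
      then have "card B = 1" using k by simp
      moreover have xB: "x \<in> B" using act.orbit_refl x by simp
      ultimately have B: "B = {x}" by (metis card_1_singletonE singletonD)
      have "x = \<one>"
      proof (rule triv)
        fix g assume g: "g \<in> carrier G"
        have "g \<otimes> x \<otimes> inv g \<in> B" using x g by (auto simp: orbit_def \<phi>_def)
        then have e: "g \<otimes> x \<otimes> inv g = x" using B by simp
        have "g \<otimes> x = g \<otimes> x \<otimes> inv g \<otimes> g" using g x by (simp add: group_normalize)
        then show "x \<otimes> g = g \<otimes> x" unfolding e by simp
      qed (use x in simp)
      with B that show False by simp
    qed
    then show ?thesis using k by simp
  qed
  have "p ^ n = (\<Sum>x\<in>carrier G. 1)" using ord by (simp add: order_def)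
  also have "\<dots> = (\<Sum>B\<in>?O. card B)" using act.disjoint_sum[OF fin, of "\<lambda>_. 1::nat"] by simp
  also have "\<dots> = 1 + (\<Sum>B\<in>?O - {{\<one>}}. card B)"
    using sum.remove[OF finO one, of card] by simp
  finally have e: "p ^ n = 1 + (\<Sum>B\<in>?O - {{\<one>}}. card B)" .
  have "p dvd (\<Sum>B\<in>?O - {{\<one>}}. card B)" using dvd by (rule dvd_sum)
  moreover have "p dvd p ^ n" using n by simp
  ultimately have "p dvd 1" using e by (metis dvd_add_left_iff)
  then show False using p by simp
qed

text \<open>
  To prove \<open>N \<le> W\<close> in a finite \<open>p\<close>-group, it may be assumed that \<open>N\<close> is central modulo the
  subgroup in question. Indeed, let \<open>T\<close> be maximal among the normal subgroups that contain \<open>W\<close> but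
  not \<open>N\<close>. The preimage of the centre of \<open>G / T\<close> is larger than \<open>T\<close> and so contains \<open>N\<close>; now the
  assumption gives \<open>N \<le> T\<close>, a contradiction. This is the form in which nilpotency of \<open>G\<close> is used.
\<close>

lemma subset_if_central_mod:
  assumes p: "Factorial_Ring.prime p" and ord: "order G = p ^ n"
    and N: "N \<lhd> G" and W: "W \<lhd> G"
    and step: "\<And>T. \<lbrakk>T \<lhd> G; W \<subseteq> T; \<And>x g. \<lbrakk>x \<in> N; g \<in> carrier G\<rbrakk> \<Longrightarrow> x \<diamondop> g \<in> T\<rbrakk> \<Longrightarrow> N \<subseteq> T"
  shows "N \<subseteq> W"
proof (rule ccontr)
  assume "\<not> N \<subseteq> W"
  let ?F = "{T. T \<lhd> G \<and> W \<subseteq> T \<and> \<not> N \<subseteq> T}"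
  have fin: "finite (carrier G)"
    using ord p order_gt_0_iff_finite by (simp add: prime_gt_0_nat)
  have "?F \<subseteq> Pow (carrier G)" using normal_imp_subgroup subgroup.subset by blast
  then have "finite ?F" using fin by (meson finite_Pow_iff finite_subset)
  moreover have "?F \<noteq> {}" using W \<open>\<not> N \<subseteq> W\<close> by blast
  ultimately have "\<exists>T\<in>?F. \<forall>C\<in>?F. T \<subseteq> C \<longrightarrow> T = C" by (rule finite_has_maximal)
  then obtain T where T: "T \<in> ?F" and max: "\<forall>C\<in>?F. T \<subseteq> C \<longrightarrow> T = C" ..
  interpret T: normal T G using T by simp
  have Tn: "T \<lhd> G" by (rule T.normal_axioms)
  interpret h: group_hom G "G Mod T" "\<lambda>x. T #> x" by (rule group_hom_rcos[OF Tn])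
  have "order (G Mod T) * card T = p ^ n"
    using lagrange[OF T.subgroup_axioms] ord by (simp add: FactGroup_def order_def)
  then obtain k where k: "order (G Mod T) = p ^ k"
    using divides_primepow_nat[OF p] by (metis dvd_triv_left)
  have "k \<noteq> 0"
  proof
    assume "k = 0"
    then have "carrier (G Mod T) = {T}"
      using k h.H.order_one_triv_iff by simp
    then have "T #> x = T" if "x \<in> carrier G" for x using h.hom_closed[OF that] by blast
    then have "carrier G \<subseteq> T" using rcos_eq_self_iff[OF Tn] by blast
    then show False using T N normal_imp_subgroup subgroup.subset by blast
  qed
  then obtain z' where z': "z' \<in> carrier (G Mod T)" "z' \<noteq> \<one>\<^bsub>G Mod T\<^esub>"
      "\<And>g. g \<in> carrier (G Mod T) \<Longrightarrow> z' \<otimes>\<^bsub>G Mod T\<^esub> g = g \<otimes>\<^bsub>G Mod T\<^esub> z'"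
    using h.H.p_group_center_nontrivial[OF p k] by blast
  obtain z where z: "z \<in> carrier G" "z' = T #> z" using z'(1) by (auto simp: carrier_FactGroup)
  have zT: "z \<notin> T" using z' z rcos_eq_self_iff[OF Tn] by auto
  \<comment> \<open>the preimage of the centre of \<open>G / T\<close>\<close>
  let ?C = "{x \<in> carrier G. \<forall>g\<in>carrier G. x \<diamondop> g \<in> T}"
  have zC: "z \<in> ?C"
  proof -
    { fix g assume g: "g \<in> carrier G"
      have "T #> (z \<diamondop> g) = \<one>\<^bsub>G Mod T\<^esub>"
        unfolding h.hom_commutator[OF z(1) g]
        using z'(3)[OF h.hom_closed[OF g]] z'(1) h.hom_closed[OF g] h.H.commutator_one_iff
        unfolding z(2) by blast
      then have "z \<diamondop> g \<in> T" using rcos_eq_self_iff[OF Tn] z g by simp }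
    then show ?thesis using z by blast
  qed
  have C: "subgroup ?C G"
  proof (rule subgroup.intro)
    fix x y assume *: "x \<in> ?C" "y \<in> ?C"
    { fix g assume g: "g \<in> carrier G"
      have "x \<diamondop> (y \<diamondop> g) \<in> T" "y \<diamondop> g \<in> T" "x \<diamondop> g \<in> T" using * g by auto
      then have "(x \<otimes> y) \<diamondop> g \<in> T" using * g commutator_mult_left[of x y g] by simp }
    then show "x \<otimes> y \<in> ?C" using * by auto
  next
    fix x assume *: "x \<in> ?C"
    { fix g assume g: "g \<in> carrier G"
      have 1: "x \<diamondop> g \<in> T" using * g by auto
      have "inv x \<diamondop> g \<in> T"
        using * by (intro commutator_inv_left_mem[OF T.subgroup_axioms _ g 1]
            commutator_mem_normal_left[OF Tn 1]) auto }
    then show "inv x \<in> ?C" using * by auto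
  qed (auto simp: commutator_def)
  have CN: "?C \<lhd> G"
    unfolding normal_inv_iff
  proof (intro conjI C ballI)
    fix g x assume g: "g \<in> carrier G" and x: "x \<in> ?C"
    { fix k assume k: "k \<in> carrier G"
      have "x \<diamondop> (inv g \<otimes> k \<otimes> g) \<in> T" using x g k by simp
      then have "g \<otimes> (x \<diamondop> (inv g \<otimes> k \<otimes> g)) \<otimes> inv g \<in> T" using T.inv_op_closed2 g by blast
      also have "g \<otimes> (x \<diamondop> (inv g \<otimes> k \<otimes> g)) \<otimes> inv g = (g \<otimes> x \<otimes> inv g) \<diamondop> k"
        using g k x conj_commutator[of x "inv g \<otimes> k \<otimes> g" g] by (simp add: group_normalize)
      finally have "(g \<otimes> x \<otimes> inv g) \<diamondop> k \<in> T" . }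
    then show "g \<otimes> x \<otimes> inv g \<in> ?C" using g x by auto
  qed
  have "T \<subseteq> ?C" using commutator_mem_normal_left[OF Tn] T.subset by blast
  with max zC zT CN T have "N \<subseteq> ?C" by blast
  then have "N \<subseteq> T" using step[OF Tn] T by blast
  with T show False by blast
qed

end


section \<open>The power series of a powerful \<open>p\<close>-group\<close>

context group
begin

lemma conj_pow:
  fixes n :: nat
  assumes "g \<in> carrier G" "x \<in> carrier G"
  shows "g \<otimes> x [^] n \<otimes> inv g = (g \<otimes> x \<otimes> inv g) [^] n"
proof (induction n)
  case (Suc n)
  have "g \<otimes> x [^] Suc n \<otimes> inv g = (g \<otimes> x [^] n \<otimes> inv g) \<otimes> (g \<otimes> x \<otimes> inv g)"
    using assms by (simp add: group_normalize)
  then show ?case using Suc by simp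
qed (use assms in simp)

lemma pow_mem: "\<lbrakk>subgroup S G; x \<in> S\<rbrakk> \<Longrightarrow> x [^] (n::nat) \<in> S"
  by (induction n) (simp_all add: subgroup.one_closed subgroup.m_closed)

text \<open>
  Removes the error term \<open>z\<close> of the formula for \<open>[a\<^sup>p, y]\<close>: for odd \<open>p\<close> its exponent is a multiple
  of \<open>p\<close>, for \<open>p = 2\<close> it is 1. This is where the two cases in the definition of powerful groups
  come from.
\<close>

lemma pow_choose_two_mem:
  assumes p: "Factorial_Ring.prime p" and S: "subgroup S G" and x: "x \<in> carrier G"
    and "p = 2 \<Longrightarrow> x \<in> S" and "x [^] p \<in> S"
  shows "x [^] (p choose 2) \<in> S"
proof (cases "p = 2")
  case False
  then have "odd p" using p prime_odd_nat prime_ge_2_nat[OF p] by auto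
  then obtain k where "p = 2 * k + 1" by (elim oddE)
  then have "p choose 2 = p * k" by (simp add: choose_two)
  then show ?thesis using pow_mem[OF S assms(5), of k] nat_pow_pow[OF x, of p k] by simp
qed (use assms in \<open>simp add: pow_mem\<close>)

lemma commutator_flip_mem:
  assumes T: "T \<lhd> G" and c: "x \<in> carrier G" "y \<in> carrier G" "g \<in> carrier G"
    and mem: "x \<diamondop> y \<diamondop> g \<in> T"
  shows "y \<diamondop> x \<diamondop> g \<in> T"
  unfolding inv_commutator[OF c(1,2), symmetric]
  by (rule commutator_inv_left_mem[OF normal_imp_subgroup[OF T] _ c(3) mem])
    (use c in \<open>auto intro: commutator_mem_normal_left[OF T mem]\<close>)

lemma pow_commutator_mem_iff:
  fixes n :: nat
  assumes T: "T \<lhd> G" and c: "x \<in> carrier G" "y \<in> carrier G" and z: "x \<diamondop> y \<diamondop> x \<in> T"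
  shows "(x [^] n) \<diamondop> y \<in> T \<longleftrightarrow> (x \<diamondop> y) [^] n \<in> T"
  using mem_if_quotient_mem[OF normal_imp_subgroup[OF T] commutator_pow_mod_central[OF T c z, of n]] c
  by simp

lemma commutator_pow_mem_iff:
  fixes n :: nat
  assumes T: "T \<lhd> G" and c: "x \<in> carrier G" "y \<in> carrier G" and z: "x \<diamondop> y \<diamondop> y \<in> T"
  shows "x \<diamondop> (y [^] n) \<in> T \<longleftrightarrow> (x \<diamondop> y) [^] n \<in> T"
proof -
  note Ts = normal_imp_subgroup[OF T]
  have "x \<diamondop> (y [^] n) \<in> T \<longleftrightarrow> (y [^] n) \<diamondop> x \<in> T"
    using commutator_mem_swap[OF Ts] c by simp
  also have "\<dots> \<longleftrightarrow> (y \<diamondop> x) [^] n \<in> T"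
    by (rule pow_commutator_mem_iff[OF T c(2,1) commutator_flip_mem[OF T c c(2) z]])
  also have "(y \<diamondop> x) [^] n = inv ((x \<diamondop> y) [^] n)"
    unfolding inv_commutator[OF c, symmetric] using c nat_pow_inv[of "x \<diamondop> y" n] by simp
  also have "inv ((x \<diamondop> y) [^] n) \<in> T \<longleftrightarrow> (x \<diamondop> y) [^] n \<in> T"
    using subgroup.m_inv_closed[OF Ts] c inv_inv[of "(x \<diamondop> y) [^] n"] commutator_closed[OF c] nat_pow_closed
    by metis
  finally show ?thesis .
qed

lemma normal_agemo: "agemo p i G \<lhd> G"
  unfolding agemo_def
proof (rule normal_generateI)
  fix h g assume "h \<in> {x [^] p ^ i |x. x \<in> carrier G}" and g: "g \<in> carrier G"
  then obtain x where x: "x \<in> carrier G" "h = x [^] p ^ i" by blast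
  show "g \<otimes> h \<otimes> inv g \<in> {x [^] p ^ i |x. x \<in> carrier G}"
    unfolding x(2) conj_pow[OF g x(1)] using g x(1) by blast
qed auto

lemma subgroup_agemo: "subgroup (agemo p i G) G"
  using normal_agemo by (rule normal_imp_subgroup)

lemma agemo_subset: "agemo p i G \<subseteq> carrier G"
  using subgroup_agemo by (rule subgroup.subset)

lemma pow_mem_agemo: "x \<in> carrier G \<Longrightarrow> x [^] p ^ i \<in> agemo p i G"
  unfolding agemo_def by (rule generate.incl) blast

lemma agemo_least:
  assumes "subgroup S G" "\<And>x. x \<in> carrier G \<Longrightarrow> x [^] p ^ i \<in> S"
  shows "agemo p i G \<subseteq> S"
  unfolding agemo_def using assms by (intro generate_subgroup_incl) auto

lemma agemo_0: "agemo p 0 G = carrier G"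
  using agemo_subset[of p 0] pow_mem_agemo[of _ p 0] by auto

lemma agemo_antimono: "i \<le> j \<Longrightarrow> agemo p j G \<subseteq> agemo p i G"
proof (rule agemo_least[OF subgroup_agemo])
  fix x assume "i \<le> j" "x \<in> carrier G"
  moreover have "x [^] p ^ j = (x [^] p ^ (j - i)) [^] p ^ i"
    using calculation by (simp add: nat_pow_pow flip: power_add)
  ultimately show "x [^] p ^ j \<in> agemo p i G" using pow_mem_agemo by simp
qed

lemma pow_agemo: "x \<in> carrier G \<Longrightarrow> (x [^] p ^ i) [^] p ^ j \<in> agemo p (i + j) G"
  using pow_mem_agemo[of x p "i + j"] by (simp add: nat_pow_pow power_add)

text \<open>
  The \<open>r\<close> for which a \<open>p\<close>-group is powerful if and only if \<open>G' \<le> \<mho>\<^sub>r(G)\<close>.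
\<close>

definition (in -) powerful_depth :: "nat \<Rightarrow> nat" where
  "powerful_depth p = (if p = 2 then 2 else 1)"

text \<open>
  Induction on \<open>i\<close>, with \<open>r\<close> the depth. For the step one works modulo a normal subgroup \<open>T\<close> that
  contains \<open>\<mho>\<^sub>i\<^sub>+\<^sub>1\<^sub>+\<^sub>r\<close> and modulo which all \<open>[u, y]\<close> with \<open>u\<close> in \<open>\<mho>\<^sub>i\<^sub>+\<^sub>1\<close> are central. Then
  \<open>\<mho>\<^sub>i\<^sub>+\<^sub>r\<close> is abelian modulo \<open>T\<close> and hence, being generated by elements of order \<open>p\<close>, of exponent \<open>p\<close>.
  A generator of \<open>\<mho>\<^sub>i\<^sub>+\<^sub>1\<close> has the form \<open>a\<^sup>p\<close> with \<open>a\<close> in \<open>\<mho>\<^sub>i\<close>, and \<open>b = [a, y]\<close> lies in \<open>\<mho>\<^sub>i\<^sub>+\<^sub>r\<close> by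
  induction. In the formula for \<open>[a\<^sup>p, y]\<close> both \<open>b\<^sup>p\<close> and the power of \<open>[a, b]\<close> vanish modulo \<open>T\<close>.
\<close>

lemma powerful_commutator_agemo:
  assumes p: "Factorial_Ring.prime p" and ord: "order G = p ^ n" and pow: "powerful p G"
    and "x \<in> agemo p i G" "g \<in> carrier G"
  shows "x \<diamondop> g \<in> agemo p (i + powerful_depth p) G"
  using assms(4,5)
proof (induction i arbitrary: x g)
  case 0
  have "derived G (carrier G) \<subseteq> agemo p (powerful_depth p) G"
    using pow by (auto simp: powerful_def powerful_depth_def)
  moreover have "x \<diamondop> g \<in> derived G (carrier G)"
    unfolding derived_eq_commutator_subgroup using 0 agemo_0 by (intro commutator_subgroupI) auto
  ultimately show ?case by auto
next
  case (Suc i)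
  define r where "r = powerful_depth p"
  define A where "A j = agemo p j G" for j
  have r: "1 \<le> r" by (simp add: r_def powerful_depth_def)
  have As: "subgroup (A j) G" and Ac: "A j \<subseteq> carrier G" for j
    unfolding A_def by (rule subgroup_agemo agemo_subset)+
  have Am: "x \<in> A k" if "x \<in> A j" "k \<le> j" for x j k
    using agemo_antimono that unfolding A_def by blast
  have Apow: "(x [^] p ^ j) [^] p ^ k \<in> A l" if "x \<in> carrier G" "l \<le> j + k" for x j k l
    using Am[OF pow_agemo[OF that(1), of p j k, folded A_def] that(2)] .
  have IH: "x \<diamondop> g \<in> A (i + r)" if "x \<in> A i" "g \<in> carrier G" for x g
    using Suc.IH that unfolding A_def r_def by blast
  let ?N = "commutator_subgroup G (A (Suc i)) (carrier G)"
  have "?N \<subseteq> A (Suc i + r)"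
  proof (rule subset_if_central_mod[OF p ord])
    show "?N \<lhd> G" "A (Suc i + r) \<lhd> G"
      unfolding A_def by (intro normal_commutator_subgroup normal_agemo normal_self)+
  next
    fix T assume T: "T \<lhd> G" and WT: "A (Suc i + r) \<subseteq> T"
      and "\<And>x g. \<lbrakk>x \<in> ?N; g \<in> carrier G\<rbrakk> \<Longrightarrow> x \<diamondop> g \<in> T"
    then have cen: "u \<diamondop> y \<diamondop> g \<in> T" if "u \<in> A (Suc i)" "y \<in> carrier G" "g \<in> carrier G" for u y g
      using that commutator_subgroupI by blast
    have cen': "u \<diamondop> y \<diamondop> g \<in> T" if "u \<in> carrier G" "y \<in> A (Suc i)" "g \<in> carrier G" for u y g
      using commutator_flip_mem[OF T _ that(1,3) cen[OF that(2,1,3)]] that(2) Ac by blast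
    note Ts = normal_imp_subgroup[OF T]
    have Tpow: "(x [^] p ^ j) [^] p ^ k \<in> T" if "x \<in> carrier G" "Suc i + r \<le> j + k" for x j k
      using Apow[OF that] WT by blast
    \<comment> \<open>reduction of statements on \<open>[\<mho>\<^sub>j, y]\<close> to the generators of \<open>\<mho>\<^sub>j\<close>\<close>
    have left: "A j \<subseteq> {a \<in> A (Suc i). a \<diamondop> y \<in> T}"
      if "Suc i \<le> j" "y \<in> carrier G" "\<And>x. x \<in> carrier G \<Longrightarrow> x [^] p ^ j \<diamondop> y \<in> T" for j y
    proof (subst A_def, rule agemo_least)
      show "subgroup {a \<in> A (Suc i). a \<diamondop> y \<in> T} G"
        by (rule subgroup_commutator_left[OF As Ts that(2)]) (use cen that(2) Ac in blast)
      fix x assume x: "x \<in> carrier G"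
      have "x [^] p ^ j \<in> A (Suc i)"
        using Am[OF _ that(1)] pow_mem_agemo[OF x] unfolding A_def by blast
      then show "x [^] p ^ j \<in> {a \<in> A (Suc i). a \<diamondop> y \<in> T}" using that(3)[OF x] by blast
    qed
    \<comment> \<open>with \<open>q = p\<^sup>i\<^sup>+\<^sup>r\<close> and \<open>v = x\<^sup>q\<close>: \<open>[v, y\<^sup>q] = [v, y]\<^sup>q = [v\<^sup>q, y]\<close> modulo \<open>T\<close>,
      and \<open>v\<^sup>q\<close> lies in \<open>T\<close>\<close>
    have comm: "v \<diamondop> w \<in> T" if v: "v \<in> A (i + r)" and w: "w \<in> A (i + r)" for v w
    proof -
      have wc: "w \<in> carrier G" using w Ac by blast
      have "x [^] p ^ (i + r) \<diamondop> w \<in> T" if x: "x \<in> carrier G" for x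
      proof -
        let ?v = "x [^] p ^ (i + r)"
        have v: "?v \<in> A (Suc i)" and vc: "?v \<in> carrier G"
          using Am[of ?v "i + r" "Suc i"] pow_mem_agemo[OF x] r x unfolding A_def by auto
        have "A (i + r) \<subseteq> {g \<in> carrier G. ?v \<diamondop> g \<in> T}"
        proof (subst A_def, rule agemo_least)
          show "subgroup {g \<in> carrier G. ?v \<diamondop> g \<in> T} G"
            by (rule subgroup_commutator_right[OF subgroup_self Ts vc]) (rule cen[OF v])
          fix y assume y: "y \<in> carrier G"
          have "?v [^] p ^ (i + r) \<in> T" by (rule Tpow[OF x]) (use r in simp)
          then have "?v [^] p ^ (i + r) \<diamondop> y \<in> T" by (rule commutator_mem_normal_left[OF T _ y])
          then have "(?v \<diamondop> y) [^] p ^ (i + r) \<in> T"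
            using pow_commutator_mem_iff[OF T vc y cen[OF v y vc]] by blast
          then have "?v \<diamondop> y [^] p ^ (i + r) \<in> T"
            using commutator_pow_mem_iff[OF T vc y cen[OF v y y]] by blast
          then show "y [^] p ^ (i + r) \<in> {g \<in> carrier G. ?v \<diamondop> g \<in> T}" using y by simp
        qed
        then show ?thesis using w by blast
      qed
      then show ?thesis using left[of "i + r" w] v wc r by auto
    qed
    have expo: "v [^] p \<in> T" if "v \<in> A (i + r)" for v
    proof -
      have "A (i + r) \<subseteq> {x \<in> A (i + r). x [^] p \<in> T}"
        unfolding A_def[of "i + r"]
      proof (rule agemo_least)
        show "subgroup {x \<in> agemo p (i + r) G. x [^] p \<in> T} G"
          using comm unfolding A_def by (intro subgroup_pow_mod[OF subgroup_agemo T])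
        fix x assume x: "x \<in> carrier G"
        show "x [^] p ^ (i + r) \<in> {x \<in> agemo p (i + r) G. x [^] p \<in> T}"
          using Tpow[OF x, of "i + r" 1] pow_mem_agemo[OF x] by simp
      qed
      then show ?thesis using that by blast
    qed
    \<comment> \<open>for \<open>p = 2\<close>, a generator of \<open>\<mho>\<^sub>i\<^sub>+\<^sub>2\<close> is \<open>u\<^sup>2\<close> with \<open>u\<close> in \<open>\<mho>\<^sub>i\<^sub>+\<^sub>1\<close>,
      and \<open>[u\<^sup>2, y] = [u, y]\<^sup>2\<close> modulo \<open>T\<close>\<close>
    have two: "v \<diamondop> y \<in> T" if "p = 2" "v \<in> A (i + r)" and y: "y \<in> carrier G" for v y
    proof -
      have r2: "r = 2" using that by (simp add: r_def powerful_depth_def)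
      have "x [^] p ^ (i + r) \<diamondop> y \<in> T" if x: "x \<in> carrier G" for x
      proof -
        let ?u = "x [^] p ^ (Suc i)"
        have u: "?u \<in> A (Suc i)" and uc: "?u \<in> carrier G"
          unfolding A_def by (rule pow_mem_agemo[OF x]) (use x in simp)
        have "(?u \<diamondop> y) [^] p \<in> T" by (rule expo[OF IH[OF Am[OF u] y]]) simp
        then have "?u [^] p \<diamondop> y \<in> T"
          using pow_commutator_mem_iff[OF T uc y cen[OF u y uc]] by blast
        moreover have "?u [^] p = x [^] p ^ (i + r)"
          unfolding r2 using x by (simp add: nat_pow_pow mult.commute)
        ultimately show ?thesis by simp
      qed
      then show ?thesis using left[of "i + r" y] that r by auto
    qed
    show "?N \<subseteq> T"
    proof (rule commutator_subgroup_least[OF Ts])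
      fix u y assume u: "u \<in> A (Suc i)" and y: "y \<in> carrier G"
      have "x [^] p ^ (Suc i) \<diamondop> y \<in> T" if x: "x \<in> carrier G" for x
      proof -
        let ?a = "x [^] p ^ i"
        let ?b = "?a \<diamondop> y"
        have a: "?a \<in> A i" and ac: "?a \<in> carrier G"
          unfolding A_def by (rule pow_mem_agemo[OF x]) (use x in simp)
        have b: "?b \<in> A (i + r)" by (rule IH[OF a y])
        then have b': "?b \<in> A (Suc i)" by (rule Am) (use r in simp)
        have bc: "?b \<in> carrier G" using ac y by simp
        have ba: "(?b \<diamondop> ?a) [^] (p choose 2) \<in> T"
        proof (rule pow_choose_two_mem[OF p Ts commutator_closed[OF bc ac]])
          show "?b \<diamondop> ?a \<in> T" if "p = 2" by (rule two[OF that b ac])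
          have "?b [^] p \<diamondop> ?a \<in> T" by (rule commutator_mem_normal_left[OF T expo[OF b] ac])
          then show "(?b \<diamondop> ?a) [^] p \<in> T"
            using pow_commutator_mem_iff[OF T bc ac cen[OF b' ac bc]] by blast
        qed
        have "(?a \<diamondop> ?b) [^] (p choose 2) = inv ((?b \<diamondop> ?a) [^] (p choose 2))"
          unfolding inv_commutator[OF bc ac, symmetric]
          using commutator_closed[OF bc ac] by (rule nat_pow_inv)
        then have "(?a \<diamondop> ?b) [^] (p choose 2) \<in> T" using subgroup.m_inv_closed[OF Ts ba] by simp
        then have "(?a [^] p \<diamondop> y) \<otimes> inv (?b [^] p) \<in> T"
          by (rule commutator_pow_mod[OF T ac y cen'[OF ac b' ac] cen'[OF ac b' bc]])
        then have "?a [^] p \<diamondop> y \<in> T"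
          using mem_if_quotient_mem[OF Ts] expo[OF b] ac y bc by simp
        then show ?thesis using x by (simp add: nat_pow_pow mult.commute)
      qed
      then show "u \<diamondop> y \<in> T" using left[of "Suc i" y] u y by auto
    qed
  qed
  moreover have "x \<diamondop> g \<in> ?N" using Suc.prems unfolding A_def by (rule commutator_subgroupI)
  ultimately show ?case unfolding A_def r_def by blast
qed

text \<open>
  Modulo \<open>\<mho>\<^sub>i\<^sub>+\<^sub>1\<close> the subgroup \<open>\<mho>\<^sub>i\<close> is abelian and is generated by elements of order \<open>p\<close>.
\<close>

lemma powerful_pow_agemo:
  assumes p: "Factorial_Ring.prime p" and ord: "order G = p ^ n" and pow: "powerful p G"
    and x: "x \<in> agemo p i G"
  shows "x [^] p \<in> agemo p (Suc i) G"
proof -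
  have "agemo p i G \<subseteq> {x \<in> agemo p i G. x [^] p \<in> agemo p (Suc i) G}"
  proof (rule agemo_least)
    have "x \<diamondop> y \<in> agemo p (Suc i) G" if "x \<in> agemo p i G" "y \<in> agemo p i G" for x y
    proof -
      have "y \<in> carrier G" using that(2) agemo_subset by blast
      then have "x \<diamondop> y \<in> agemo p (i + powerful_depth p) G"
        by (rule powerful_commutator_agemo[OF p ord pow that(1)])
      moreover have "Suc i \<le> i + powerful_depth p" by (simp add: powerful_depth_def)
      ultimately show ?thesis using agemo_antimono by blast
    qed
    then show "subgroup {x \<in> agemo p i G. x [^] p \<in> agemo p (Suc i) G} G"
      by (intro subgroup_pow_mod[OF subgroup_agemo normal_agemo])
    fix x assume x: "x \<in> carrier G"
    show "x [^] p ^ i \<in> {x \<in> agemo p i G. x [^] p \<in> agemo p (Suc i) G}"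
      using pow_agemo[OF x, of p i 1] pow_mem_agemo[OF x] by simp
  qed
  then show ?thesis using x by blast
qed

lemma agemo_trivial:
  assumes "order G = p ^ n" shows "agemo p n G = {\<one>}"
proof
  show "agemo p n G \<subseteq> {\<one>}"
    using pow_order_eq_1 assms by (intro agemo_least triv_subgroup) auto
  show "{\<one>} \<subseteq> agemo p n G" using subgroup.one_closed[OF subgroup_agemo] by simp
qed

end


section \<open>Iterated commutators of a power series\<close>

text \<open>
  The properties of the series \<open>\<mho>\<^sub>i(G)\<close> of a powerful group that are inherited by its preimages
  under an epimorphism onto \<open>G\<close>.
\<close>

locale powerful_filtration = group G for G (structure) +
  fixes p :: nat and P :: "nat \<Rightarrow> 'a set"
  assumes prime: "Factorial_Ring.prime p"
    and normal_P: "P i \<lhd> G"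
    and P_Suc: "P (Suc i) \<subseteq> P i"
    and commutator_P: "\<lbrakk>x \<in> P i; g \<in> carrier G\<rbrakk> \<Longrightarrow> x \<diamondop> g \<in> P (i + powerful_depth p)"
    and pow_P: "x \<in> P i \<Longrightarrow> x [^] p \<in> P (Suc i)"
    and P_generated: "P (Suc i) \<subseteq> generate G ({x [^] p | x. x \<in> P i} \<union> P (Suc (Suc i)))"
begin

definition D :: "nat \<Rightarrow> nat \<Rightarrow> 'a set" where
  "D i j = iterated_commutator G (P i) j"

lemma normal_D: "D i j \<lhd> G"
  unfolding D_def by (rule normal_iterated_commutator[OF normal_P])

lemma subgroup_D: "subgroup (D i j) G"
  using normal_D by (rule normal_imp_subgroup)

lemma D_carrier: "x \<in> D i j \<Longrightarrow> x \<in> carrier G"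
  using subgroup.mem_carrier[OF subgroup_D] .

lemma P_antimono: "i \<le> k \<Longrightarrow> P k \<subseteq> P i"
  using lift_Suc_antimono_le[of P] P_Suc by blast

lemma D_antimono: "i \<le> k \<Longrightarrow> D k j \<subseteq> D i j"
  unfolding D_def by (rule iterated_commutator_mono[OF P_antimono normal_P])

lemma commutator_D: "\<lbrakk>x \<in> D i j; g \<in> carrier G\<rbrakk> \<Longrightarrow> x \<diamondop> g \<in> D i (Suc j)"
  unfolding D_def by (rule commutator_iterated)

text \<open>
  Each further entry \<open>G\<close> can be traded for a step along the series \<open>P\<close>. All error terms below
  are disposed of in this way.
\<close>

lemma D_depth: "D i (Suc j) \<subseteq> D (i + powerful_depth p) j"
  unfolding D_def iterated_commutator_Suc_eq
  by (intro iterated_commutator_mono[OF commutator_subgroup_least[OF normal_imp_subgroup] normal_P]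
      normal_P commutator_P)

lemma D_shift: "D i (Suc j) \<subseteq> D (Suc i) j"
proof -
  have "D (i + powerful_depth p) j \<subseteq> D (Suc i) j"
    by (rule D_antimono) (simp add: powerful_depth_def)
  with D_depth show ?thesis by (rule subset_trans)
qed

lemma D_shift2: "D i (Suc (Suc j)) \<subseteq> D (Suc (Suc i)) j"
  using D_shift[of i "Suc j"] D_shift[of "Suc i" j] by (rule subset_trans)

text \<open>
  Modulo \<open>[P\<^sub>i\<^sub>+\<^sub>1, G, \<dots>, G]\<close> the commutators that generate \<open>[P\<^sub>i, G, \<dots>, G]\<close> are central, so that
  \<open>[h, k]\<^sup>p\<close> agrees with \<open>[h\<^sup>p, k]\<close>.
\<close>

lemma pow_D: "x \<in> D i j \<Longrightarrow> x [^] p \<in> D (Suc i) j"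
proof (induction j arbitrary: x)
  case 0
  then show ?case by (simp add: D_def pow_P)
next
  case (Suc j)
  let ?W = "D (Suc i) (Suc j)"
  have "D i (Suc j) \<subseteq> {x \<in> D i (Suc j). x [^] p \<in> ?W}"
    unfolding D_def[of i "Suc j"] iterated_commutator.simps(2) D_def[of i j, symmetric]
  proof (rule commutator_subgroup_least)
    have "x \<diamondop> y \<in> ?W" if "x \<in> D i (Suc j)" "y \<in> D i (Suc j)" for x y
      using commutator_D[OF that(1) D_carrier[OF that(2)]] D_shift by blast
    then show "subgroup {x \<in> commutator_subgroup G (D i j) (carrier G). x [^] p \<in> ?W} G"
      using subgroup_pow_mod[OF subgroup_D[of i "Suc j"] normal_D[of "Suc i" "Suc j"], of p]
      unfolding D_def[of i "Suc j"] iterated_commutator.simps(2) D_def[of i j, symmetric] by blast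
  next
    fix h k assume h: "h \<in> D i j" and k: "k \<in> carrier G"
    have hk: "h \<diamondop> k \<in> D i (Suc j)" by (rule commutator_D[OF h k])
    have "h \<diamondop> k \<diamondop> h \<in> ?W" using commutator_D[OF hk D_carrier[OF h]] D_shift by blast
    moreover have "h [^] p \<diamondop> k \<in> ?W" by (rule commutator_D[OF Suc.IH[OF h] k])
    ultimately have "(h \<diamondop> k) [^] p \<in> ?W"
      using pow_commutator_mem_iff[OF normal_D D_carrier[OF h] k] by blast
    then show "h \<diamondop> k \<in> {x \<in> commutator_subgroup G (D i j) (carrier G). x [^] p \<in> ?W}"
      using commutator_subgroupI[OF h k] by blast
  qed
  then show ?case using Suc.prems by blast
qed

text \<open>
  A generator \<open>[b, y]\<close> of the left-hand side is, modulo \<open>D (i + 2) (j + 1)\<close>, multiplicative in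
  \<open>b\<close>; so by induction \<open>b = a\<^sup>p\<close> may be assumed, and \<open>[a\<^sup>p, y]\<close> is then congruent to \<open>[a, y]\<^sup>p\<close>. The
  error is a power of \<open>[a, [a, y]]\<close>, an element of \<open>D i (j + 2)\<close>.
\<close>

lemma D_generated: "D (Suc i) j \<subseteq> generate G ({x [^] p | x. x \<in> D i j} \<union> D (Suc (Suc i)) j)"
proof (induction j)
  case 0
  then show ?case using P_generated[of i] by (simp add: D_def)
next
  case (Suc j)
  let ?W = "D (Suc (Suc i)) (Suc j)"
  let ?X = "{x [^] p | x. x \<in> D i (Suc j)} \<union> ?W"
  let ?V = "generate G ?X"
  have "?X \<subseteq> carrier G" using D_carrier nat_pow_closed by blast
  then have V: "subgroup ?V G" by (rule generate_is_subgroup)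
  have WV: "?W \<subseteq> ?V" by (auto intro: generate.incl)
  have "b \<diamondop> y \<in> ?V" if b: "b \<in> D (Suc i) j" and y: "y \<in> carrier G" for b y
  proof -
    have "generate G ({x [^] p | x. x \<in> D i j} \<union> D (Suc (Suc i)) j) \<subseteq> {b \<in> D (Suc i) j. b \<diamondop> y \<in> ?V}"
    proof (rule generate_subgroup_incl)
      have "b \<diamondop> y \<diamondop> g \<in> ?V" if "b \<in> D (Suc i) j" "g \<in> D (Suc i) j" for b g
        using commutator_D[OF commutator_D[OF that(1) y] D_carrier[OF that(2)]]
          D_shift[of "Suc i" "Suc j"] WV by blast
      then show "subgroup {b \<in> D (Suc i) j. b \<diamondop> y \<in> ?V} G"
        by (rule subgroup_commutator_left[OF subgroup_D V y])
      have "a [^] p \<diamondop> y \<in> ?V" if a: "a \<in> D i j" for a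
      proof -
        have ac: "a \<in> carrier G" by (rule D_carrier[OF a])
        let ?b = "a \<diamondop> y" and ?z = "a \<diamondop> (a \<diamondop> y)"
        have b: "?b \<in> D i (Suc j)" by (rule commutator_D[OF a y])
        have bc: "?b \<in> carrier G" by (rule D_carrier[OF b])
        have z: "?z \<in> D i (Suc (Suc j))"
          using commutator_D[OF b ac] commutator_mem_swap[OF subgroup_D ac bc] by blast
        have za: "?z \<diamondop> g \<in> ?W" if "g \<in> carrier G" for g
          using commutator_D[OF z that] D_shift2[of i "Suc j"] by blast
        have "?z [^] (p choose 2) \<in> ?W"
        proof (rule pow_choose_two_mem[OF prime subgroup_D D_carrier[OF z]])
          show "?z \<in> ?W" if "p = 2"
            using D_depth[of i "Suc j"] z that by (auto simp: powerful_depth_def)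
          show "?z [^] p \<in> ?W"
            using pow_D[OF z] D_shift[of "Suc i" "Suc j"] by blast
        qed
        then have "(a [^] p \<diamondop> y) \<otimes> inv (?b [^] p) \<in> ?W"
          by (rule commutator_pow_mod[OF normal_D ac y za[OF ac] za[OF bc]])
        then have "(a [^] p \<diamondop> y) \<otimes> inv (?b [^] p) \<in> ?V" using WV by blast
        moreover have "?b [^] p \<in> ?V" by (rule generate.incl) (use b in blast)
        ultimately show ?thesis using mem_if_quotient_mem[OF V] ac y bc by simp
      qed
      moreover have "a [^] p \<in> D (Suc i) j" if "a \<in> D i j" for a by (rule pow_D[OF that])
      moreover have "b \<diamondop> y \<in> ?V" if "b \<in> D (Suc (Suc i)) j" for b
        using commutator_D[OF that y] WV by blast
      moreover have "D (Suc (Suc i)) j \<subseteq> D (Suc i) j" by (rule D_antimono) simp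
      ultimately show "{x [^] p | x. x \<in> D i j} \<union> D (Suc (Suc i)) j \<subseteq> {b \<in> D (Suc i) j. b \<diamondop> y \<in> ?V}"
        by blast
    qed
    then show ?thesis using Suc.IH b by blast
  qed
  then show ?case
    unfolding D_def[of "Suc i" "Suc j"] iterated_commutator.simps(2) D_def[of "Suc i" j, symmetric]
    by (intro commutator_subgroup_least V)
qed

text \<open>
  The second entry lies in the derived subgroup, and a commutator with an element of \<open>G'\<close> counts
  as two commutators with elements of \<open>G\<close>. At least one entry \<open>G\<close> is required, whence \<open>Suc j\<close>.
\<close>

lemma commutator_D_D:
  assumes "x \<in> D i (Suc j)" "y \<in> D i (Suc j)" shows "x \<diamondop> y \<in> D (Suc (Suc i)) (Suc j)"
proof -
  have "y \<in> iterated_commutator G (carrier G) (Suc j)"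
    using assms(2) iterated_commutator_mono[OF subgroup.subset[OF normal_imp_subgroup[OF normal_P]] normal_self]
    unfolding D_def by blast
  moreover have "iterated_commutator G (carrier G) (Suc j) \<subseteq> iterated_commutator G (carrier G) (Suc 0)"
    using lift_Suc_antimono_le[of "iterated_commutator G (carrier G)" "Suc 0" "Suc j"]
      iterated_commutator_Suc_subset[OF normal_self] by simp
  ultimately have "x \<diamondop> y \<in> iterated_commutator G (D i (Suc j)) (Suc (Suc 0))"
    using commutator_lower_central[OF normal_D assms(1)] by blast
  then have "x \<diamondop> y \<in> D i (Suc (Suc (Suc j)))"
    unfolding D_def by (simp add: iterated_commutator.simps(2))
  then show ?thesis using D_shift2 by blast
qed

end


section \<open>Counting elements of order \<open>p\<close>\<close>

context group
begin

lemma finite_if_fibres: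
  assumes S: "subgroup S G" and K: "finite K" and f: "finite (f ` S)"
    and fib: "\<And>x y. \<lbrakk>x \<in> S; y \<in> S; f x = f y\<rbrakk> \<Longrightarrow> x \<otimes> inv y \<in> K"
  shows "finite S"
proof -
  obtain X where X: "X \<subseteq> S" "finite X" "f ` S = f ` X"
    using finite_subset_image[OF f subset_refl] by blast
  have "S \<subseteq> (\<lambda>(k, x). k \<otimes> x) ` (K \<times> X)"
  proof
    fix y assume y: "y \<in> S"
    then obtain x where x: "x \<in> X" "f y = f x" using X(3) by blast
    then have "x \<in> S" using X(1) by blast
    then have "y \<otimes> inv x \<in> K" "y = (y \<otimes> inv x) \<otimes> x"
      using fib[OF y _ x(2)] subgroup.mem_carrier[OF S] y by (auto simp: group_normalize)
    then show "y \<in> (\<lambda>(k, x). k \<otimes> x) ` (K \<times> X)"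
      using x(1) by (intro image_eqI[of _ _ "(y \<otimes> inv x, x)"]) auto
  qed
  then show ?thesis using K X(2) by (meson finite_SigmaI finite_imageI finite_subset)
qed

text \<open>
  For a homomorphism \<open>f\<close> this is the formula for the order of its image; here \<open>f\<close> need only have
  the cosets of \<open>K\<close> as its fibres, which avoids introducing a codomain for each of the maps used
  below.
\<close>

lemma card_fibres:
  assumes S: "subgroup S G" and fin: "finite S" and K: "K \<subseteq> S"
    and fib: "\<And>x y. \<lbrakk>x \<in> S; y \<in> S\<rbrakk> \<Longrightarrow> f x = f y \<longleftrightarrow> x \<otimes> inv y \<in> K"
  shows "card S = card (f ` S) * card K"
proof -
  interpret S: subgroup S G by (rule S)
  have Sc: "x \<in> carrier G" if "x \<in> S" for x using S.mem_carrier[OF that] .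
  have fibre: "card {x \<in> S. f x = c} = card K" if c: "c \<in> f ` S" for c
  proof -
    obtain y where y: "y \<in> S" "c = f y" using c by blast
    have "bij_betw (\<lambda>k. k \<otimes> y) K {x \<in> S. f x = c}"
    proof (rule bij_betw_byWitness[where f' = "\<lambda>x. x \<otimes> inv y"])
      show "\<forall>k\<in>K. (k \<otimes> y) \<otimes> inv y = k" "\<forall>x\<in>{x \<in> S. f x = c}. (x \<otimes> inv y) \<otimes> y = x"
        using K y(1) Sc by (auto simp: group_normalize subset_iff)
      show "(\<lambda>x. x \<otimes> inv y) ` {x \<in> S. f x = c} \<subseteq> K" using fib y by auto
      show "(\<lambda>k. k \<otimes> y) ` K \<subseteq> {x \<in> S. f x = c}"
      proof (rule image_subsetI)
        fix k assume k: "k \<in> K"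
        then have kS: "k \<in> S" using K by blast
        have "(k \<otimes> y) \<otimes> inv y = k" using kS y Sc by (simp add: group_normalize)
        then have "f (k \<otimes> y) = f y" using fib[OF S.m_closed[OF kS y(1)] y(1)] k by simp
        then show "k \<otimes> y \<in> {x \<in> S. f x = c}" using S.m_closed[OF kS y(1)] y(2) by simp
      qed
    qed
    then show ?thesis by (metis bij_betw_same_card)
  qed
  have "card S = (\<Sum>x\<in>S. 1)" by simp
  also have "\<dots> = (\<Sum>c\<in>f ` S. \<Sum>x\<in>{x \<in> S. f x = c}. 1)" by (rule sum.image_gen[OF fin])
  also have "\<dots> = (\<Sum>c\<in>f ` S. card K)" by (intro sum.cong refl) (simp add: fibre)
  finally show ?thesis by simp
qed

text \<open>
  \<open>S / N\<close> is centralised by \<open>t\<close>, and \<open>t\<^sup>p\<close> lies in \<open>N\<close>: the set in question is the subgroup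
  generated by \<open>t\<close> and \<open>S\<close>.
\<close>

lemma subgroup_power_products:
  fixes p :: nat
  assumes p: "0 < p" and N: "N \<lhd> G" and S: "subgroup S G" "N \<subseteq> S" and t: "t \<in> carrier G"
    and tp: "t [^] p \<in> N" and comm: "\<And>s. s \<in> S \<Longrightarrow> s \<diamondop> t \<in> N"
  shows "subgroup {t [^] j \<otimes> s | j s. j < p \<and> s \<in> S} G"
proof -
  interpret N: normal N G by (rule N)
  interpret S: subgroup S G by (rule S)
  have Sc: "s \<in> carrier G" if "s \<in> S" for s using S.mem_carrier[OF that] .
  have NS: "n \<in> S" if "n \<in> N" for n using that S(2) by blast
  let ?U = "{t [^] j \<otimes> s | j s. j < p \<and> s \<in> S}"
  have red: "t [^] j \<otimes> s \<in> ?U" if s: "s \<in> S" for j :: nat and s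
  proof -
    have "t [^] j = t [^] (j mod p) \<otimes> (t [^] p) [^] (j div p)"
      using t by (simp add: nat_pow_pow nat_pow_mult)
    then have "t [^] j \<otimes> s = t [^] (j mod p) \<otimes> ((t [^] p) [^] (j div p) \<otimes> s)"
      using t Sc[OF s] by (simp add: m_assoc)
    moreover have "(t [^] p) [^] (j div p) \<otimes> s \<in> S"
      using S.m_closed[OF NS[OF pow_mem[OF N.subgroup_axioms tp]] s] .
    ultimately show ?thesis using p by (auto intro!: exI[of _ "j mod p"])
  qed
  have commp: "s \<diamondop> (t [^] j) \<in> N" if s: "s \<in> S" for s and j :: nat
    using commutator_pow_mem_iff[OF N Sc[OF s] t commutator_mem_normal_left[OF N comm[OF s] t]]
      pow_mem[OF N.subgroup_axioms comm[OF s]] by blast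
  have closed: "(t [^] i \<otimes> s) \<otimes> (t [^] j \<otimes> s') \<in> ?U" if s: "s \<in> S" and s': "s' \<in> S" for i j :: nat and s s'
  proof -
    let ?n = "inv (t [^] j) \<otimes> (s \<diamondop> (t [^] j)) \<otimes> (t [^] j)"
    have "?n \<in> N" using N.inv_op_closed1[OF _ commp[OF s]] t by simp
    then have "?n \<otimes> (s \<otimes> s') \<in> S" using NS S.m_closed s s' by simp
    moreover have "(t [^] i \<otimes> s) \<otimes> (t [^] j \<otimes> s') = t [^] (i + j) \<otimes> (?n \<otimes> (s \<otimes> s'))"
      using t Sc[OF s] Sc[OF s'] by (simp add: commutator_def group_normalize flip: nat_pow_mult)
    ultimately show ?thesis using red by simp
  qed
  show ?thesis
  proof (rule subgroup.intro)
    show "?U \<subseteq> carrier G" using t Sc by auto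
    show "\<one> \<in> ?U" using red[OF S.one_closed, of 0] by simp
    fix x assume "x \<in> ?U"
    then obtain i :: nat and s where x: "x = t [^] i \<otimes> s" and s: "s \<in> S" by blast
    { fix y assume "y \<in> ?U"
      then show "x \<otimes> y \<in> ?U" unfolding x using closed[OF s] by blast }
    \<comment> \<open>modulo \<open>N\<close>, the inverse of \<open>t\<^sup>i\<close> is its power with exponent \<open>p - 1\<close>\<close>
    let ?k = "i * (p - 1)"
    have e: "t [^] i \<otimes> t [^] ?k = (t [^] p) [^] i"
      using t p by (simp add: nat_pow_mult nat_pow_pow mult.commute flip: mult_Suc_right)
    have "inv (t [^] i) = t [^] ?k \<otimes> inv ((t [^] p) [^] i)"
      unfolding e[symmetric] using t by (simp add: group_normalize)
    then have "inv x = (t [^] (0::nat) \<otimes> inv s) \<otimes> (t [^] ?k \<otimes> inv ((t [^] p) [^] i))"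
      unfolding x using t Sc[OF s] by (simp add: group_normalize)
    then show "inv x \<in> ?U"
      using closed[OF S.m_inv_closed[OF s] NS[OF N.m_inv_closed[OF pow_mem[OF N.subgroup_axioms tp]]],
          of 0 ?k i] by (simp only:)
  qed
qed

text \<open>
  An abelian group of exponent \<open>p\<close> with \<open>m\<close> generators has at most \<open>p\<^sup>m\<close> elements, since adding one
  generator multiplies the order by at most \<open>p\<close>.
\<close>

lemma card_cosets_generated:
  fixes p :: nat
  assumes p: "0 < p" and N: "N \<lhd> G" and "finite T"
    and "\<And>x. x \<in> generate G (T \<union> N) \<Longrightarrow> x [^] p \<in> N"
    and "\<And>x y. \<lbrakk>x \<in> generate G (T \<union> N); y \<in> generate G (T \<union> N)\<rbrakk> \<Longrightarrow> x \<diamondop> y \<in> N"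
    and "T \<subseteq> carrier G"
  shows "finite ((#>) N ` generate G (T \<union> N)) \<and> card ((#>) N ` generate G (T \<union> N)) \<le> p ^ card T"
  using assms(3-6)
proof (induction T)
  case empty
  have e: "generate G N = N" using generateI[OF normal_imp_subgroup[OF N]] by simp
  have "(#>) N ` N = {N}"
  proof -
    have "N #> x = N" if "x \<in> N" for x
      using coset_join2[OF subgroup.mem_carrier[OF _ that] _ that] normal_imp_subgroup[OF N] by blast
    moreover have "\<one> \<in> N" using subgroup.one_closed[OF normal_imp_subgroup[OF N]] .
    ultimately show ?thesis by auto
  qed
  then show ?case by (simp add: e)
next
  case (insert t T)
  interpret N: normal N G by (rule N)
  let ?S = "generate G (T \<union> N)" and ?S' = "generate G (insert t T \<union> N)"
  have sub: "T \<union> N \<subseteq> carrier G" "insert t T \<union> N \<subseteq> carrier G" using insert.prems N.subset by auto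
  have SS': "?S \<subseteq> ?S'" by (rule mono_generate) blast
  have S: "subgroup ?S G" by (rule generate_is_subgroup[OF sub(1)])
  have IH: "finite ((#>) N ` ?S)" "card ((#>) N ` ?S) \<le> p ^ card T"
    using insert.IH insert.prems SS' by blast+
  have t: "t \<in> carrier G" "t \<in> ?S'" using insert.prems by (auto intro: generate.incl)
  have NS: "N \<subseteq> ?S" by (auto intro: generate.incl)
  let ?U = "{t [^] j \<otimes> s | j s. j < p \<and> s \<in> ?S}"
  have U: "subgroup ?U G"
    using insert.prems(1,2) t SS' by (intro subgroup_power_products[OF p N S NS]) auto
  have "?S' \<subseteq> ?U"
  proof (rule generate_subgroup_incl[OF _ U])
    have Sc: "s \<in> carrier G" if "s \<in> ?S" for s using subgroup.mem_carrier[OF S that] .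
    have "s \<in> ?U" if "s \<in> ?S" for s
      using that p Sc[OF that] by (auto intro!: exI[of _ "0::nat"] exI[of _ s])
    moreover have "t \<in> ?U"
    proof (cases "p = 1")
      case True
      then have "t \<in> ?S" using insert.prems(1)[OF t(2)] t NS by auto
      then show ?thesis using calculation by blast
    next
      case False
      then show ?thesis
        using p t(1) subgroup.one_closed[OF S] by (auto intro!: exI[of _ "1::nat"] exI[of _ \<one>])
    qed
    moreover have "x \<in> ?S" if "x \<in> T \<union> N" for x using that by (auto intro: generate.incl)
    ultimately show "insert t T \<union> N \<subseteq> ?U" by blast
  qed
  have "(#>) N ` ?S' \<subseteq> (\<lambda>(j, c). (N #> t [^] j) <#> c) ` ({..<p} \<times> (#>) N ` ?S)"
  proof (rule image_subsetI)
    fix x assume "x \<in> ?S'"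
    then obtain j :: nat and s where x: "x = t [^] j \<otimes> s" "j < p" "s \<in> ?S" using \<open>?S' \<subseteq> ?U\<close> by blast
    have "N #> x = (N #> t [^] j) <#> (N #> s)"
      unfolding x(1) using N.rcos_sum[of "t [^] j" s] t subgroup.mem_carrier[OF S x(3)] by simp
    then show "N #> x \<in> (\<lambda>(j, c). (N #> t [^] j) <#> c) ` ({..<p} \<times> (#>) N ` ?S)"
      using x by (intro image_eqI[of _ _ "(j, N #> s)"]) auto
  qed
  moreover have fin: "finite ({..<p} \<times> (#>) N ` ?S)" using IH by simp
  ultimately have "finite ((#>) N ` ?S')" "card ((#>) N ` ?S') \<le> card ({..<p} \<times> (#>) N ` ?S)"
    by (meson finite_imageI finite_subset, meson card_image_le card_mono finite_imageI le_trans)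
  moreover have "card ({..<p} \<times> (#>) N ` ?S) \<le> p ^ card (insert t T)"
    using IH(2) insert.hyps by (simp add: card_cartesian_product)
  ultimately show ?case by linarith
qed

end

text \<open>
  The associated graded group, with the map induced by the \<open>p\<close>-th power, is a module over
  \<open>\<bbbF>\<^sub>p[t]\<close> generated in degree 0.
\<close>

locale power_filtration = group G for G (structure) +
  fixes p :: nat and N :: "nat \<Rightarrow> 'a set" and k :: nat
  assumes pos: "0 < p"
    and normal_N: "N i \<lhd> G"
    and N_Suc: "N (Suc i) \<subseteq> N i"
    and commutator_N: "\<lbrakk>x \<in> N i; y \<in> N i\<rbrakk> \<Longrightarrow> x \<diamondop> y \<in> N (Suc (Suc i))"
    and pow_N: "x \<in> N i \<Longrightarrow> x [^] p \<in> N (Suc i)"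
    and N_generated: "N (Suc i) \<subseteq> generate G ({x [^] p | x. x \<in> N i} \<union> N (Suc (Suc i)))"
    and N_trivial: "N k = {\<one>}"
begin

lemma subgroup_N: "subgroup (N i) G"
  using normal_N by (rule normal_imp_subgroup)

lemma N_carrier: "x \<in> N i \<Longrightarrow> x \<in> carrier G"
  using subgroup.mem_carrier[OF subgroup_N] .

lemma N_antimono: "i \<le> j \<Longrightarrow> N j \<subseteq> N i"
  using lift_Suc_antimono_le[of N] N_Suc by blast

text \<open>
  Modulo \<open>N\<^sub>i\<^sub>+\<^sub>2\<close> the \<open>p\<close>-th power is a homomorphism on \<open>N\<^sub>i\<close>.
\<close>

lemma pow_coset_eq_iff:
  assumes x: "x \<in> N i" and y: "y \<in> N i"
  shows "N (Suc (Suc i)) #> x [^] p = N (Suc (Suc i)) #> y [^] p \<longleftrightarrow> (x \<otimes> inv y) [^] p \<in> N (Suc (Suc i))"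
proof -
  let ?W = "N (Suc (Suc i))"
  have c: "x \<in> carrier G" "y \<in> carrier G" "inv y \<in> N i"
    using x y N_carrier subgroup.m_inv_closed[OF subgroup_N] by auto
  have "(x \<otimes> inv y) [^] p \<otimes> inv (x [^] p \<otimes> (inv y) [^] p) \<in> ?W"
    by (rule mult_pow_mod[OF normal_N c(1) inv_closed[OF c(2)] commutator_N[OF x c(3)]])
  then have "(x \<otimes> inv y) [^] p \<in> ?W \<longleftrightarrow> x [^] p \<otimes> (inv y) [^] p \<in> ?W"
    by (rule mem_if_quotient_mem[OF subgroup_N]) (use c in auto)
  also have "(inv y) [^] p = inv (y [^] p)" using c by (simp add: nat_pow_inv)
  finally show ?thesis using rcos_eq_iff[OF normal_N, of "x [^] p" "y [^] p"] c by simp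
qed

text \<open>
  The induced map \<open>N\<^sub>i / N\<^sub>i\<^sub>+\<^sub>1 \<rightarrow> N\<^sub>i\<^sub>+\<^sub>1 / N\<^sub>i\<^sub>+\<^sub>2\<close> is onto: its image is a subgroup that contains
  the generators.
\<close>

lemma root_mod:
  assumes "y \<in> N (Suc i)"
  shows "\<exists>x\<in>N i. N (Suc (Suc i)) #> y = N (Suc (Suc i)) #> x [^] p"
proof -
  let ?W = "N (Suc (Suc i))"
  interpret h: group_hom G "G Mod ?W" "\<lambda>x. ?W #> x" by (rule group_hom_rcos[OF normal_N])
  let ?U = "{y \<in> carrier G. \<exists>x\<in>N i. ?W #> y = ?W #> x [^] p}"
  have "subgroup ?U G"
  proof (rule subgroup.intro)
    show "?U \<subseteq> carrier G" by blast
    show "\<one> \<in> ?U" using subgroup.one_closed[OF subgroup_N] by (auto intro!: bexI[of _ \<one>])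
  next
    fix y y' assume "y \<in> ?U" "y' \<in> ?U"
    then obtain x x' where x: "x \<in> N i" "x' \<in> N i" and y: "y \<in> carrier G" "y' \<in> carrier G"
      and e: "?W #> y = ?W #> x [^] p" "?W #> y' = ?W #> x' [^] p" by blast
    have c: "x \<in> carrier G" "x' \<in> carrier G" using x N_carrier by auto
    have "?W #> (y \<otimes> y') = ?W #> (x [^] p \<otimes> x' [^] p)"
      using h.hom_mult[OF y] h.hom_mult[of "x [^] p" "x' [^] p"] e c by simp
    also have "\<dots> = ?W #> (x \<otimes> x') [^] p"
      by (rule rcos_eq_iff[OF normal_N, THEN iffD2, symmetric])
        (use mult_pow_mod[OF normal_N c commutator_N[OF x]] c in auto)
    finally show "y \<otimes> y' \<in> ?U" using subgroup.m_closed[OF subgroup_N x] y by blast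
  next
    fix y assume "y \<in> ?U"
    then obtain x where x: "x \<in> N i" and y: "y \<in> carrier G" and e: "?W #> y = ?W #> x [^] p" by blast
    have c: "x \<in> carrier G" using x N_carrier by auto
    have "?W #> inv y = ?W #> (inv x) [^] p"
      using h.hom_inv[OF y] h.hom_inv[of "x [^] p"] e c by (simp add: nat_pow_inv)
    then show "inv y \<in> ?U" using subgroup.m_inv_closed[OF subgroup_N x] y by blast
  qed
  moreover have "x [^] p \<in> ?U" if "x \<in> N i" for x using that N_carrier by blast
  moreover have "w \<in> ?U" if "w \<in> ?W" for w
  proof -
    have "?W #> w = ?W #> \<one> [^] p"
      by (rule rcos_eq_iff[OF normal_N, THEN iffD2]) (use that N_carrier[OF that] in auto)
    then show ?thesis using subgroup.one_closed[OF subgroup_N] N_carrier[OF that] by blast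
  qed
  ultimately have "generate G ({x [^] p | x. x \<in> N i} \<union> ?W) \<subseteq> ?U"
    by (intro generate_subgroup_incl) blast+
  then show ?thesis using N_generated[of i] assms by blast
qed

text \<open>
  Each factor of the series is an image of the previous one.
\<close>

lemma finite_cosets:
  assumes "finite ((#>) (N 1) ` N 0)"
  shows "finite ((#>) (N (Suc i)) ` N i)"
proof (induction i)
  case (Suc i)
  let ?W = "N (Suc (Suc i))"
  obtain X where X: "X \<subseteq> N i" "finite X" "(#>) (N (Suc i)) ` N i = (#>) (N (Suc i)) ` X"
    using finite_subset_image[OF Suc subset_refl] by blast
  have "(#>) ?W ` N (Suc i) \<subseteq> (\<lambda>x. ?W #> x [^] p) ` X"
  proof (rule image_subsetI)
    fix y assume "y \<in> N (Suc i)"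
    then obtain x where x: "x \<in> N i" "?W #> y = ?W #> x [^] p" using root_mod by blast
    then obtain x' where x': "x' \<in> X" "N (Suc i) #> x = N (Suc i) #> x'" using X(3) by blast
    then have x'N: "x' \<in> N i" using X(1) by blast
    have "x \<otimes> inv x' \<in> N (Suc i)"
      using rcos_eq_iff[OF normal_N N_carrier[OF x(1)] N_carrier[OF x'N]] x'(2) by blast
    then have "?W #> x [^] p = ?W #> x' [^] p"
      using pow_coset_eq_iff[OF x(1) x'N] pow_N by blast
    then show "?W #> y \<in> (\<lambda>x. ?W #> x [^] p) ` X" using x(2) x'(1) by blast
  qed
  then show ?case using X(2) by (meson finite_imageI finite_subset)
qed (use assms in simp)

lemma finite_N:
  assumes "finite ((#>) (N 1) ` N 0)"
  shows "finite (N i)"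
proof (cases "i \<le> k")
  case True
  then show ?thesis
  proof (induction i rule: inc_induct)
    case base
    show ?case unfolding N_trivial by simp
  next
    case (step i)
    show ?case
    proof (rule finite_if_fibres[OF subgroup_N step.IH finite_cosets[OF assms]])
      fix x y assume *: "x \<in> N i" "y \<in> N i" "N (Suc i) #> x = N (Suc i) #> y"
      show "x \<otimes> inv y \<in> N (Suc i)"
        using rcos_eq_iff[OF normal_N N_carrier[OF *(1)] N_carrier[OF *(2)]] *(3) by blast
    qed
  qed
next
  case False
  then have "N i \<subseteq> {\<one>}" using N_antimono[of k i] N_trivial by simp
  then show ?thesis by (rule finite_subset) simp
qed

text \<open>
  Let \<open>V\<^sub>i = N\<^sub>i / N\<^sub>i\<^sub>+\<^sub>1\<close> and let \<open>B / N\<^sub>i\<^sub>+\<^sub>1\<close> be the kernel of \<open>V\<^sub>i \<rightarrow> V\<^sub>i\<^sub>+\<^sub>1\<close>. The image of \<open>A \<inter> N\<^sub>i\<close> in \<open>V\<^sub>i\<close> lies in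
  this kernel, whose order is \<open>|V\<^sub>i| / |V\<^sub>i\<^sub>+\<^sub>1|\<close>. Multiplying these bounds from \<open>i\<close> up to \<open>k\<close> gives a
  telescoping product, so that \<open>|A \<inter> N\<^sub>i| \<le> |V\<^sub>i|\<close>; the statement is this inequality without
  quotients.
\<close>

lemma card_exponent_subgroup:
  assumes fin: "finite (N 0)" and A: "subgroup A G" and exp: "\<And>x. x \<in> A \<Longrightarrow> x [^] p = \<one>"
  shows "i \<le> k \<Longrightarrow> card (A \<inter> N i) * card (N (Suc i)) \<le> card (N i)"
proof (induction i rule: inc_induct)
  case base
  have "N (Suc k) = {\<one>}"
    using N_Suc[of k] N_trivial subgroup.one_closed[OF subgroup_N[of "Suc k"]] by auto
  moreover have "A \<inter> {\<one>} = {\<one>}" using subgroup.one_closed[OF A] by auto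
  ultimately show ?case by (simp add: N_trivial)
next
  case (step i)
  let ?V = "N (Suc i)" and ?W = "N (Suc (Suc i))"
  have finN: "finite (N j)" for j using fin N_antimono[of 0 j] by (meson finite_subset zero_le)
  have pos: "0 < card (N j)" for j
    using finN subgroup.one_closed[OF subgroup_N] by (metis card_gt_0_iff empty_iff)
  define B where "B = {x \<in> N i. x [^] p \<in> ?W}"
  have WV: "?W \<subseteq> ?V" "?V \<subseteq> N i" using N_Suc by blast+
  have Bs: "subgroup B G"
    unfolding B_def by (rule subgroup_pow_mod[OF subgroup_N normal_N commutator_N])
  have VB: "?V \<subseteq> B" unfolding B_def using WV pow_N by blast
  have AB: "A \<inter> N i \<subseteq> B"
    unfolding B_def using exp subgroup.one_closed[OF subgroup_N[of "Suc (Suc i)"]] by auto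
  have finB: "finite B" unfolding B_def using finN[of i] by simp
  have As: "subgroup (A \<inter> N i) G" by (rule subgroups_Inter_pair[OF A subgroup_N])
  have rc: "N j #> x = N j #> y \<longleftrightarrow> x \<otimes> inv y \<in> N j" if "x \<in> N i" "y \<in> N i" for x y j
    by (rule rcos_eq_iff[OF normal_N N_carrier[OF that(1)] N_carrier[OF that(2)]])
  have 1: "card (N i) = card ((\<lambda>x. ?W #> x [^] p) ` N i) * card B"
  proof (rule card_fibres[OF subgroup_N finN])
    fix x y assume *: "x \<in> N i" "y \<in> N i"
    have "x \<otimes> inv y \<in> N i"
      using subgroup.m_closed[OF subgroup_N *(1) subgroup.m_inv_closed[OF subgroup_N *(2)]] .
    then show "?W #> x [^] p = ?W #> y [^] p \<longleftrightarrow> x \<otimes> inv y \<in> B"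
      unfolding B_def using pow_coset_eq_iff[OF *] by simp
  qed (simp add: B_def)
  have 2: "card ?V = card ((#>) ?W ` ?V) * card ?W"
    by (rule card_fibres[OF subgroup_N finN WV(1)]) (rule rc; use WV(2) in blast)
  have 3: "(\<lambda>x. ?W #> x [^] p) ` N i = (#>) ?W ` ?V"
  proof
    show "(\<lambda>x. ?W #> x [^] p) ` N i \<subseteq> (#>) ?W ` ?V" using pow_N by blast
    show "(#>) ?W ` ?V \<subseteq> (\<lambda>x. ?W #> x [^] p) ` N i"
    proof (rule image_subsetI)
      fix y assume "y \<in> ?V"
      then obtain x where "x \<in> N i" "?W #> y = ?W #> x [^] p" using root_mod by blast
      then show "?W #> y \<in> (\<lambda>x. ?W #> x [^] p) ` N i" by (rule rev_image_eqI)
    qed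
  qed
  have 4: "card B = card ((#>) ?V ` B) * card ?V"
    by (rule card_fibres[OF Bs finB VB]) (rule rc; simp add: B_def)
  have 5: "card (A \<inter> N i) = card ((#>) ?V ` (A \<inter> N i)) * card (A \<inter> ?V)"
  proof (rule card_fibres[OF As])
    fix x y assume *: "x \<in> A \<inter> N i" "y \<in> A \<inter> N i"
    have "x \<otimes> inv y \<in> A" using * subgroup.m_closed[OF A _ subgroup.m_inv_closed[OF A]] by simp
    then show "?V #> x = ?V #> y \<longleftrightarrow> x \<otimes> inv y \<in> A \<inter> ?V"
      using rc[OF IntD2[OF *(1)] IntD2[OF *(2)], of "Suc i"] by blast
  qed (use finN WV in auto)
  have 6: "card ((#>) ?V ` (A \<inter> N i)) \<le> card ((#>) ?V ` B)"
    using AB finB by (intro card_mono finite_imageI image_mono)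
  have "card (A \<inter> N i) * card ?V * card ?W =
      card ((#>) ?V ` (A \<inter> N i)) * card ?V * (card (A \<inter> ?V) * card ?W)"
    unfolding 5 by simp
  also have "\<dots> \<le> card ((#>) ?V ` B) * card ?V * card ?V"
    using 6 step.IH by (intro mult_le_mono) auto
  also have "\<dots> = card B * card ?V" using 4 by simp
  also have "\<dots> = card (N i) * card ?W" unfolding 1 3 using 2 by simp
  finally show ?case using pos[of "Suc (Suc i)"] by simp
qed

lemma card_exponent_subgroup_le:
  assumes A: "subgroup A G" "A \<subseteq> N 0" and exp: "\<And>x. x \<in> A \<Longrightarrow> x [^] p = \<one>"
    and T: "finite T" "T \<subseteq> carrier G" "generate G (T \<union> N 1) = N 0"
  shows "finite (N 0)" "card A \<le> p ^ card T"
proof -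
  have "finite ((#>) (N 1) ` N 0) \<and> card ((#>) (N 1) ` N 0) \<le> p ^ card T"
    using card_cosets_generated[OF pos normal_N[of 1] T(1) _ _ T(2)] pow_N[of _ 0]
      commutator_N[of _ 0] N_Suc[of 1] unfolding T(3) by auto
  then have f: "finite ((#>) (N 1) ` N 0)" and c: "card ((#>) (N 1) ` N 0) \<le> p ^ card T" by auto
  show fin: "finite (N 0)" by (rule finite_N[OF f])
  have N10: "N 1 \<subseteq> N 0" using N_Suc[of 0] by simp
  have pos1: "0 < card (N 1)"
    using finite_subset[OF N10 fin] subgroup.one_closed[OF subgroup_N] by (metis card_gt_0_iff empty_iff)
  have "card (N 0) = card ((#>) (N 1) ` N 0) * card (N 1)"
    by (rule card_fibres[OF subgroup_N fin N10]) (rule rcos_eq_iff[OF normal_N N_carrier N_carrier])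
  moreover have "card A * card (N 1) \<le> card (N 0)"
    using card_exponent_subgroup[OF fin A(1) exp, of 0] A(2) by (simp add: Int_absorb2)
  ultimately have "card A \<le> card ((#>) (N 1) ` N 0)" using pos1 by simp
  with c show "card A \<le> p ^ card T" by simp
qed

lemma pow_k_N: "x \<in> N 0 \<Longrightarrow> x [^] p ^ k = \<one>"
proof -
  assume x: "x \<in> N 0"
  have "x [^] p ^ i \<in> N i" for i
  proof (induction i)
    case (Suc i)
    then show ?case using pow_N[OF Suc] N_carrier[OF x] by (simp add: nat_pow_pow mult.commute)
  qed (use x N_carrier[OF x] in simp)
  then show ?thesis using N_trivial by blast
qed

end


section \<open>Generators of finite abelian \<open>p\<close>-groups\<close>

context comm_group
begin

lemma subgroup_pow_image: "subgroup {x [^] (n::nat) | x. x \<in> carrier G} G"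
proof (rule subgroup.intro)
  show "\<one> \<in> {x [^] n | x. x \<in> carrier G}" by (auto intro!: exI[of _ \<one>])
next
  fix u v assume "u \<in> {x [^] n | x. x \<in> carrier G}" "v \<in> {x [^] n | x. x \<in> carrier G}"
  then obtain x y where "x \<in> carrier G" "u = x [^] n" "y \<in> carrier G" "v = y [^] n" by blast
  then show "u \<otimes> v \<in> {x [^] n | x. x \<in> carrier G}"
    by (auto intro!: exI[of _ "x \<otimes> y"] simp: nat_pow_distrib)
next
  fix u assume "u \<in> {x [^] n | x. x \<in> carrier G}"
  then obtain x where "x \<in> carrier G" "u = x [^] n" by blast
  then show "inv u \<in> {x [^] n | x. x \<in> carrier G}"
    by (auto intro!: exI[of _ "inv x"] simp: nat_pow_inv)
qed auto

text \<open>
  Generators are added greedily: each new one multiplies the order of the subgroup generated so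
  far by at least \<open>p\<close>, as all orders are powers of \<open>p\<close>.
\<close>

lemma exists_generators_over:
  assumes p: "Factorial_Ring.prime p" and ord: "order G = p ^ e"
  shows "subgroup T G \<Longrightarrow>
    \<exists>S. finite S \<and> S \<subseteq> carrier G \<and> generate G (S \<union> T) = carrier G \<and> p ^ card S * card T \<le> order G"
proof (induction "order G - card T" arbitrary: T rule: less_induct)
  case less
  have fin: "finite (carrier G)" using ord p order_gt_0_iff_finite by (simp add: prime_gt_0_nat)
  have Tc: "T \<subseteq> carrier G" using less.prems by (rule subgroup.subset)
  have card: "\<exists>a. card K = p ^ a" if K: "subgroup K G" for K
  proof -
    have "card K dvd p ^ e" using lagrange[OF K] ord by (metis dvd_triv_right)
    then show ?thesis using divides_primepow_nat[OF p] by blast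
  qed
  show ?case
  proof (cases "T = carrier G")
    case True
    have "generate G T = carrier G" using generateI[OF less.prems] True by simp
    then show ?thesis using True by (intro exI[of _ "{}"]) (simp add: order_def)
  next
    case False
    then obtain x where x: "x \<in> carrier G" "x \<notin> T" using Tc by blast
    let ?T = "generate G (insert x T)"
    have xT: "insert x T \<subseteq> carrier G" using x Tc by blast
    have T': "subgroup ?T G" by (rule generate_is_subgroup[OF xT])
    have "insert x T \<subseteq> ?T" by (auto intro: generate.incl)
    then have sub: "T \<subset> ?T" using x by blast
    have finT: "finite ?T" using fin subgroup.subset[OF T'] finite_subset by blast
    obtain a b where a: "card T = p ^ a" and b: "card ?T = p ^ b"
      using card[OF less.prems] card[OF T'] by blast
    have "card T < card ?T" using psubset_card_mono[OF finT sub] .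
    then have "a < b" unfolding a b using p prime_gt_1_nat power_less_imp_less_exp by metis
    then have "p ^ Suc a \<le> p ^ b" using prime_ge_1_nat[OF p] by (intro power_increasing) auto
    then have le: "p * card T \<le> card ?T" unfolding a b by simp
    have "card ?T \<le> order G" unfolding order_def by (rule card_mono[OF fin subgroup.subset[OF T']])
    then have "order G - card ?T < order G - card T" using \<open>card T < card ?T\<close> by simp
    from less.hyps[OF this T'] obtain S where S: "finite S" "S \<subseteq> carrier G"
      "generate G (S \<union> ?T) = carrier G" "p ^ card S * card ?T \<le> order G" by blast
    let ?S = "insert x S"
    have sc: "?S \<union> T \<subseteq> carrier G" using S(2) x Tc by blast
    have "carrier G = generate G (?S \<union> T)"
    proof
      have "?T \<subseteq> generate G (?S \<union> T)" by (rule mono_generate) blast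
      moreover have "S \<subseteq> generate G (?S \<union> T)" by (auto intro: generate.incl)
      ultimately have "generate G (S \<union> ?T) \<subseteq> generate G (?S \<union> T)"
        by (intro generate_subgroup_incl generate_is_subgroup sc) blast
      then show "carrier G \<subseteq> generate G (?S \<union> T)" using S(3) by simp
      show "generate G (?S \<union> T) \<subseteq> carrier G" by (rule generate_incl[OF sc])
    qed
    moreover have "p ^ card ?S * card T \<le> order G"
    proof -
      have "p ^ card ?S \<le> p ^ Suc (card S)"
        using card_insert_le_m1[of "Suc (card S)" S x] prime_ge_1_nat[OF p]
        by (intro power_increasing) auto
      then have "p ^ card ?S * card T \<le> p ^ card S * (p * card T)"
        using mult_le_mono1[of "p ^ card ?S" "p ^ Suc (card S)" "card T"] by (simp add: algebra_simps)
      also have "\<dots> \<le> p ^ card S * card ?T" using le by (rule mult_le_mono2)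
      finally show ?thesis using S(4) by simp
    qed
    ultimately show ?thesis using S sc by (intro exI[of _ ?S]) auto
  qed
qed

text \<open>
  The \<open>p\<close>-th powers lie in the Frattini subgroup: if \<open>G = \<langle>S\<rangle> G\<^sup>p\<close>, then the elements of
  \<open>G\<close> are products of an element of \<open>\<langle>S\<rangle>\<close> and a \<open>p\<^sup>i\<close>-th power for every \<open>i\<close>, by repeated
  substitution.
\<close>

lemma generators_if_generate_mod_pow:
  fixes p :: nat
  assumes S: "S \<subseteq> carrier G" and gen: "generate G (S \<union> {x [^] p | x. x \<in> carrier G}) = carrier G"
    and exp: "\<And>x. x \<in> carrier G \<Longrightarrow> x [^] p ^ e = \<one>"
  shows "generate G S = carrier G"
proof
  let ?K = "generate G S"
  have K: "subgroup ?K G" by (rule generate_is_subgroup[OF S])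
  interpret K: subgroup ?K G by (rule K)
  have Kc: "y \<in> carrier G" if "y \<in> ?K" for y using subgroup.mem_carrier[OF K that] .
  let ?U = "{y \<otimes> x [^] p | y x. y \<in> ?K \<and> x \<in> carrier G}"
  have "subgroup ?U G"
  proof (rule subgroup.intro)
    show "?U \<subseteq> carrier G" using Kc by auto
    show "\<one> \<in> ?U" using K.one_closed by (auto intro!: exI[of _ \<one>])
  next
    fix u v assume "u \<in> ?U" "v \<in> ?U"
    then obtain y x y' x' where u: "y \<in> ?K" "x \<in> carrier G" "u = y \<otimes> x [^] p"
      and v: "y' \<in> ?K" "x' \<in> carrier G" "v = y' \<otimes> x' [^] p" by blast
    have "u \<otimes> v = (y \<otimes> y') \<otimes> (x \<otimes> x') [^] p"
      using u v Kc by (simp add: nat_pow_distrib m_ac)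
    then show "u \<otimes> v \<in> ?U" using u v K.m_closed by blast
  next
    fix u assume "u \<in> ?U"
    then obtain y x where u: "y \<in> ?K" "x \<in> carrier G" "u = y \<otimes> x [^] p" by blast
    have "inv u = inv y \<otimes> (inv x) [^] p"
      using u Kc by (simp add: nat_pow_inv inv_mult)
    then show "inv u \<in> ?U" using u K.m_inv_closed by blast
  qed
  moreover have "s \<in> ?U" if "s \<in> ?K" for s
  proof -
    have "s = s \<otimes> \<one> [^] p" using Kc[OF that] by simp
    then show ?thesis using that by blast
  qed
  moreover have "x [^] p \<in> ?U" if "x \<in> carrier G" for x
  proof -
    have "x [^] p = \<one> \<otimes> x [^] p" using that by simp
    then show ?thesis using that K.one_closed by blast
  qed
  moreover have "S \<subseteq> ?K" by (auto intro: generate.incl)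
  ultimately have "generate G (S \<union> {x [^] p | x. x \<in> carrier G}) \<subseteq> ?U"
    by (intro generate_subgroup_incl) blast+
  then have U: "\<exists>y x'. y \<in> ?K \<and> x' \<in> carrier G \<and> x = y \<otimes> x' [^] p" if "x \<in> carrier G" for x
    using that unfolding gen by blast
  have "\<exists>y x'. y \<in> ?K \<and> x' \<in> carrier G \<and> x = y \<otimes> x' [^] p ^ i" if x: "x \<in> carrier G" for x i
  proof (induction i)
    case 0
    then show ?case using x K.one_closed by (intro exI[of _ \<one>] exI[of _ x]) simp
  next
    case (Suc i)
    then obtain y x' where 1: "y \<in> ?K" "x' \<in> carrier G" "x = y \<otimes> x' [^] p ^ i" by blast
    obtain y' z where 2: "y' \<in> ?K" "z \<in> carrier G" "x' = y' \<otimes> z [^] p" using U[OF 1(2)] by blast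
    have "x = (y \<otimes> y' [^] p ^ i) \<otimes> z [^] p ^ Suc i"
      unfolding 1(3) 2(3) using 1 2 Kc by (simp add: nat_pow_distrib nat_pow_pow m_assoc)
    then show ?case using 2(2) K.m_closed[OF 1(1) pow_mem[OF K 2(1)]] by blast
  qed
  from this[of _ e] show "carrier G \<subseteq> ?K" using exp Kc by fastforce
  show "?K \<subseteq> carrier G" by (rule generate_incl[OF S])
qed

text \<open>
  The kernel and the cokernel of \<open>x \<mapsto> x\<^sup>p\<close> have the same order, and the cokernel determines the
  number of generators.
\<close>

lemma exists_generators_card_le:
  assumes p: "Factorial_Ring.prime p" and fin: "finite (carrier G)"
    and exp: "\<And>x. x \<in> carrier G \<Longrightarrow> x [^] p ^ e = \<one>"
    and bound: "card {x \<in> carrier G. x [^] p = \<one>} \<le> p ^ m"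
  shows "\<exists>S. finite S \<and> S \<subseteq> carrier G \<and> generate G S = carrier G \<and> card S \<le> m"
proof -
  have "p_group p G"
    unfolding p_group_def
  proof (intro conjI ballI)
    fix x assume x: "x \<in> carrier G"
    have "ord x dvd p ^ e" using exp[OF x] pow_eq_id[OF x] by blast
    then show "\<exists>k. ord x = p ^ k" using divides_primepow_nat[OF p] by blast
  qed (rule group_axioms)
  then obtain n where n: "order G = p ^ n" using p_group_order[OF p _ fin] by blast
  let ?T = "{x [^] p | x. x \<in> carrier G}" and ?\<Omega> = "{x \<in> carrier G. x [^] p = \<one>}"
  obtain S where S: "finite S" "S \<subseteq> carrier G" "generate G (S \<union> ?T) = carrier G"
    "p ^ card S * card ?T \<le> order G"
    using exists_generators_over[OF p n subgroup_pow_image[of p]] by blast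
  have "card (carrier G) = card ((\<lambda>x. x [^] p) ` carrier G) * card ?\<Omega>"
  proof (rule card_fibres[OF subgroup_self fin])
    fix x y assume xy: "x \<in> carrier G" "y \<in> carrier G"
    have "(x \<otimes> inv y) [^] p = x [^] p \<otimes> inv (y [^] p)"
      using xy by (simp add: nat_pow_distrib nat_pow_inv)
    moreover have "x [^] p \<otimes> inv (y [^] p) = \<one> \<longleftrightarrow> x [^] p = y [^] p"
      using inv_solve_right'[of \<one> "x [^] p" "y [^] p"] xy by simp
    ultimately show "x [^] p = y [^] p \<longleftrightarrow> x \<otimes> inv y \<in> ?\<Omega>" using xy by auto
  qed blast
  moreover have "(\<lambda>x. x [^] p) ` carrier G = ?T" by blast
  ultimately have "p ^ card S * card ?T \<le> card ?T * card ?\<Omega>" using S(4) by (simp add: order_def)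
  moreover have "0 < card ?T"
  proof -
    have "finite ?T" using fin by simp
    moreover have "?T \<noteq> {}" by blast
    ultimately show ?thesis by (simp add: card_gt_0_iff)
  qed
  ultimately have "p ^ card S \<le> card ?\<Omega>" by (simp add: mult.commute)
  then have "p ^ card S \<le> p ^ m" using bound by simp
  then have "card S \<le> m" using prime_gt_1_nat[OF p] power_le_imp_le_exp by blast
  moreover have "generate G S = carrier G" by (rule generators_if_generate_mod_pow[OF S(2,3) exp])
  ultimately show ?thesis using S by blast
qed

end


section \<open>Basic commutators generate the lower central factors\<close>

lemma (in group) iterated_commutator_add:
  "iterated_commutator G (iterated_commutator G H m) n = iterated_commutator G H (m + n)"
  by (induction n) (simp_all add: iterated_commutator.simps(2))

lemma weight_pos: "0 < weight t"
  by (induction t) simp_all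

text \<open>
  The quotients of \<open>\<Gamma> n = \<gamma>\<^sub>n\<^sub>+\<^sub>1(G)\<close> by \<open>E n = [Q, G, \<dots>, G]\<close>, with \<open>n\<close> entries \<open>G\<close>, form a graded Lie
  ring, which is generated by the images of the \<open>d\<close> elements \<open>x i\<close>. The index is one less than the
  weight throughout.
\<close>

locale generated_mod = group G for G (structure) +
  fixes Q :: "'a set" and d :: nat and x :: "nat \<Rightarrow> 'a"
  assumes normal_Q: "Q \<lhd> G"
    and commutator_Q: "\<lbrakk>a \<in> carrier G; b \<in> carrier G\<rbrakk> \<Longrightarrow> a \<diamondop> b \<in> Q"
    and x_carrier: "i < d \<Longrightarrow> x i \<in> carrier G"
    and generated: "generate G (x ` {..<d} \<union> Q) = carrier G"
begin

abbreviation "\<Gamma> \<equiv> iterated_commutator G (carrier G)"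
abbreviation "E \<equiv> iterated_commutator G Q"

lemma normal_\<Gamma>: "\<Gamma> n \<lhd> G"
  by (rule normal_iterated_commutator[OF normal_self])

lemma subgroup_\<Gamma>: "subgroup (\<Gamma> n) G"
  using normal_\<Gamma> by (rule normal_imp_subgroup)

lemma \<Gamma>_carrier: "a \<in> \<Gamma> n \<Longrightarrow> a \<in> carrier G"
  using subgroup.mem_carrier[OF subgroup_\<Gamma>] .

lemma E_subset_\<Gamma>: "E n \<subseteq> \<Gamma> n"
  by (rule iterated_commutator_mono[OF subgroup.subset[OF normal_imp_subgroup[OF normal_Q]] normal_self])

lemma \<Gamma>_Suc_subset_E: "\<Gamma> (Suc n) \<subseteq> E n"
  unfolding iterated_commutator_Suc_eq
  by (intro iterated_commutator_mono[OF commutator_subgroup_least normal_Q]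
      normal_imp_subgroup[OF normal_Q] commutator_Q)

lemma \<Gamma>_antimono: "m \<le> n \<Longrightarrow> \<Gamma> n \<subseteq> \<Gamma> m"
  using lift_Suc_antimono_le[of \<Gamma>] iterated_commutator_Suc_subset[OF normal_self] by blast

lemma commutator_\<Gamma>: "\<lbrakk>a \<in> \<Gamma> m; b \<in> \<Gamma> n\<rbrakk> \<Longrightarrow> a \<diamondop> b \<in> \<Gamma> (Suc (m + n))"
  using commutator_lower_central[OF normal_\<Gamma>] unfolding iterated_commutator_add by simp

lemma commutator_E: "\<lbrakk>a \<in> E m; b \<in> \<Gamma> n\<rbrakk> \<Longrightarrow> a \<diamondop> b \<in> E (Suc (m + n))"
  using commutator_lower_central[OF normal_iterated_commutator[OF normal_Q]]
  unfolding iterated_commutator_add by simp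

primrec eval_comm :: "comm \<Rightarrow> 'a" where
  "eval_comm (Letter i) = x i"
| "eval_comm (Br u v) = eval_comm u \<diamondop> eval_comm v"

definition basic_values :: "nat \<Rightarrow> 'a set" where
  "basic_values n = eval_comm ` {t. basic_commutator d t \<and> weight t = Suc n}"

text \<open>
  The preimage of the span of the basic commutators of weight \<open>n + 1\<close> in \<open>\<Gamma> n / E n\<close>.
\<close>

definition basic_span :: "nat \<Rightarrow> 'a set" where
  "basic_span n = generate G (basic_values n \<union> E n)"

lemma eval_comm_mem: "\<lbrakk>basic_commutator d t; weight t = Suc n\<rbrakk> \<Longrightarrow> eval_comm t \<in> \<Gamma> n"
proof (induction t arbitrary: n)
  case (Letter i)
  from Letter.prems(1) have "i < d" by cases auto
  then show ?case using Letter.prems(2) x_carrier by simp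
next
  case (Br u v)
  from Br.prems(1) have uv: "basic_commutator d u" "basic_commutator d v" by (cases, simp)+
  obtain k l where kl: "weight u = Suc k" "weight v = Suc l"
    using weight_pos[of u] weight_pos[of v] gr0_implies_Suc by blast
  then have "n = Suc (k + l)" using Br.prems(2) by simp
  then show ?case using commutator_\<Gamma>[OF Br.IH(1)[OF uv(1) kl(1)] Br.IH(2)[OF uv(2) kl(2)]] by simp
qed

lemma basic_values_subset: "basic_values n \<subseteq> \<Gamma> n"
  unfolding basic_values_def using eval_comm_mem by blast

lemma subgroup_basic_span: "subgroup (basic_span n) G"
  unfolding basic_span_def
  using basic_values_subset E_subset_\<Gamma> \<Gamma>_carrier by (intro generate_is_subgroup) blast

lemma E_subset_basic_span: "E n \<subseteq> basic_span n"
  unfolding basic_span_def by (auto intro: generate.incl)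

lemma basic_values_subset_basic_span: "basic_values n \<subseteq> basic_span n"
  unfolding basic_span_def by (auto intro: generate.incl)

lemma \<Gamma>_Suc_basic_span: "Suc n \<le> m \<Longrightarrow> a \<in> \<Gamma> m \<Longrightarrow> a \<in> basic_span n"
  using \<Gamma>_antimono[of "Suc n" m] \<Gamma>_Suc_subset_E[of n] E_subset_basic_span[of n] by blast

lemma basic_span_subset: "basic_span n \<subseteq> \<Gamma> n"
  unfolding basic_span_def
  using basic_values_subset E_subset_\<Gamma> by (intro generate_subgroup_incl[OF _ subgroup_\<Gamma>]) blast

text \<open>
  Bracketing with \<open>k\<close> is additive on \<open>\<Gamma> m / E m\<close>.
\<close>

lemma commutator_basic_span:
  assumes k: "k \<in> \<Gamma> n" and g: "g \<in> basic_span m"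
    and basic: "\<And>t. \<lbrakk>basic_commutator d t; weight t = Suc m\<rbrakk> \<Longrightarrow> eval_comm t \<diamondop> k \<in> basic_span (Suc (m + n))"
  shows "g \<diamondop> k \<in> basic_span (Suc (m + n))"
proof -
  let ?S = "{g \<in> \<Gamma> m. g \<diamondop> k \<in> basic_span (Suc (m + n))}"
  have "subgroup ?S G"
  proof (rule subgroup_commutator_left[OF subgroup_\<Gamma> subgroup_basic_span \<Gamma>_carrier[OF k]])
    fix a g assume "a \<in> \<Gamma> m" "g \<in> \<Gamma> m"
    then show "a \<diamondop> k \<diamondop> g \<in> basic_span (Suc (m + n))"
      using commutator_\<Gamma>[OF commutator_\<Gamma>[OF _ k]] by (intro \<Gamma>_Suc_basic_span[rotated]) auto
  qed
  moreover have "basic_values m \<subseteq> ?S"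
    unfolding basic_values_def using basic eval_comm_mem by blast
  moreover have "E m \<subseteq> ?S"
    using commutator_E[OF _ k] E_subset_basic_span E_subset_\<Gamma> by blast
  ultimately have "basic_span m \<subseteq> ?S"
    unfolding basic_span_def[of m] by (intro generate_subgroup_incl) blast+
  then show ?thesis using g by blast
qed

text \<open>
  Here \<open>u z u\<inverse> = [u, z] z\<close>, so that conjugating the last entry changes the commutator only by
  terms of higher degree.
\<close>

lemma commutator_conj_mem:
  assumes S: "subgroup S G" and c: "w \<in> carrier G" "u \<in> carrier G" "z \<in> carrier G"
    and "w \<diamondop> (u \<diamondop> z) \<in> S" "u \<diamondop> z \<diamondop> (w \<diamondop> z) \<in> S"
  shows "w \<diamondop> (u \<otimes> z \<otimes> inv u) \<in> S \<longleftrightarrow> w \<diamondop> z \<in> S"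
proof -
  interpret S: subgroup S G by (rule S)
  have e: "u \<otimes> z \<otimes> inv u = (u \<diamondop> z) \<otimes> z" using c by (simp add: commutator_def group_normalize)
  have "w \<diamondop> (u \<otimes> z \<otimes> inv u) = ((w \<diamondop> (u \<diamondop> z)) \<otimes> (u \<diamondop> z \<diamondop> (w \<diamondop> z))) \<otimes> (w \<diamondop> z)"
    unfolding e using c by (intro commutator_mult_right) auto
  then have "(w \<diamondop> (u \<otimes> z \<otimes> inv u)) \<otimes> inv (w \<diamondop> z) = (w \<diamondop> (u \<diamondop> z)) \<otimes> (u \<diamondop> z \<diamondop> (w \<diamondop> z))"
    using c by (simp add: m_assoc)
  then have "(w \<diamondop> (u \<otimes> z \<otimes> inv u)) \<otimes> inv (w \<diamondop> z) \<in> S"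
    using S.m_closed[OF assms(5,6)] by simp
  then show ?thesis by (rule mem_if_quotient_mem[OF S]) (use c in auto)
qed

text \<open>
  The Jacobi identity \<open>[[s, t], k] = [[s, k], t] - [[t, k], s]\<close>, obtained from the Hall-Witt
  identity by neglecting the conjugations.
\<close>

lemma Jacobi_basic_span:
  assumes s: "s \<in> \<Gamma> a" and t: "t \<in> \<Gamma> b" and k: "k \<in> \<Gamma> c"
    and n: "n = Suc (Suc (a + b + c))"
    and skt: "s \<diamondop> k \<diamondop> t \<in> basic_span n" and tks: "t \<diamondop> k \<diamondop> s \<in> basic_span n"
  shows "s \<diamondop> t \<diamondop> k \<in> basic_span n"
proof -
  note S = subgroup_basic_span[of n]
  have c: "s \<in> carrier G" "t \<in> carrier G" "k \<in> carrier G" using s t k \<Gamma>_carrier by auto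
  \<comment> \<open>a conjugated third entry may be replaced by the entry itself\<close>
  have conj: "y \<diamondop> z \<diamondop> (z \<otimes> w \<otimes> inv z) \<in> basic_span n \<longleftrightarrow> y \<diamondop> z \<diamondop> w \<in> basic_span n"
    if y: "y \<in> \<Gamma> i" and z: "z \<in> \<Gamma> j" and w: "w \<in> \<Gamma> l" and "i + j + l = a + b + c" for y z w i j l
  proof (rule commutator_conj_mem[OF S])
    show "y \<diamondop> z \<in> carrier G" "z \<in> carrier G" "w \<in> carrier G" using y z w \<Gamma>_carrier by auto
    have yz: "y \<diamondop> z \<in> \<Gamma> (Suc (i + j))" and zw: "z \<diamondop> w \<in> \<Gamma> (Suc (j + l))"
      using commutator_\<Gamma> y z w by auto
    show "y \<diamondop> z \<diamondop> (z \<diamondop> w) \<in> basic_span n"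
      using commutator_\<Gamma>[OF yz zw] by (rule \<Gamma>_Suc_basic_span[rotated]) (use that n in simp)
    show "z \<diamondop> w \<diamondop> (y \<diamondop> z \<diamondop> w) \<in> basic_span n"
      using commutator_\<Gamma>[OF zw commutator_\<Gamma>[OF yz w]]
      by (rule \<Gamma>_Suc_basic_span[rotated]) (use that n in simp)
  qed
  have "k \<diamondop> s \<diamondop> t \<in> basic_span n"
  proof -
    have sk: "s \<diamondop> k \<in> \<Gamma> (Suc (a + c))" by (rule commutator_\<Gamma>[OF s k])
    have "s \<diamondop> k \<diamondop> t \<diamondop> inv (s \<diamondop> k) \<in> basic_span n"
      using commutator_\<Gamma>[OF commutator_\<Gamma>[OF sk t], of "inv (s \<diamondop> k)" 0] c n
      by (intro \<Gamma>_Suc_basic_span[of n]) auto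
    then have "inv (s \<diamondop> k) \<diamondop> t \<in> basic_span n"
      by (intro commutator_inv_left_mem[OF S _ _ skt]) (use c in auto)
    then show ?thesis using inv_commutator[OF c(1,3)] by simp
  qed
  then have 1: "k \<diamondop> s \<diamondop> (s \<otimes> t \<otimes> inv s) \<in> basic_span n" using conj[OF k s t] by simp
  have 2: "t \<diamondop> k \<diamondop> (k \<otimes> s \<otimes> inv k) \<in> basic_span n" using conj[OF t k s] tks by simp
  let ?X = "s \<diamondop> t \<diamondop> (t \<otimes> k \<otimes> inv t)"
  have "?X \<otimes> (t \<diamondop> k \<diamondop> (k \<otimes> s \<otimes> inv k)) \<otimes> (k \<diamondop> s \<diamondop> (s \<otimes> t \<otimes> inv s)) = \<one>"
    by (rule Hall_Witt[OF c(2,1,3)])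
  then have "?X \<otimes> ((t \<diamondop> k \<diamondop> (k \<otimes> s \<otimes> inv k)) \<otimes> (k \<diamondop> s \<diamondop> (s \<otimes> t \<otimes> inv s))) = \<one>"
    using c by (simp add: m_assoc)
  then have "inv ((t \<diamondop> k \<diamondop> (k \<otimes> s \<otimes> inv k)) \<otimes> (k \<diamondop> s \<diamondop> (s \<otimes> t \<otimes> inv s))) = ?X"
    by (rule inv_equality) (use c in auto)
  then have "?X \<in> basic_span n"
    using subgroup.m_inv_closed[OF S subgroup.m_closed[OF S 2 1]] by simp
  then show ?thesis using conj[OF s t k] by simp
qed

text \<open>
  The rewriting process of Hall. Let \<open>v < u\<close>. If \<open>[u, v]\<close> is not basic, then \<open>u = [s, t]\<close> with
  \<open>v < t < s\<close>, and by the Jacobi identity \<open>[u, v]\<close> is a combination of \<open>[[s, v], t]\<close> and \<open>[[t, v], s]\<close>.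
  By induction on the weight, \<open>[s, v]\<close> and \<open>[t, v]\<close> are combinations of basic commutators \<open>z\<close>; these
  have greater weight than \<open>v\<close> and so are greater than \<open>v\<close>. Thus \<open>[u, v]\<close> becomes a combination of
  brackets of the same total weight, whose smaller entry is greater than \<open>v\<close>. As there are only
  finitely many basic commutators of bounded weight, this terminates.
\<close>

lemma commutator_basic_in_span:
  assumes "basic_commutator d u" "basic_commutator d v" "weight u + weight v = Suc n"
  shows "eval_comm u \<diamondop> eval_comm v \<in> basic_span n"
  using assms
proof (induction n arbitrary: u v rule: less_induct)
  case (less n)
  note S = subgroup_basic_span[of n]
  have evc: "eval_comm t \<in> carrier G" if "basic_commutator d t" for t
    using eval_comm_mem[OF that, of "weight t - 1"] weight_pos[of t] \<Gamma>_carrier by simp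
  let ?F = "{t. basic_commutator d t \<and> weight t \<le> n}"
  have finF: "finite ?F"
  proof -
    have "?F = (\<Union>m\<le>n. {t. basic_commutator d t \<and> weight t = m})" by blast
    then show ?thesis using finite_basic_commutators by simp
  qed
  let ?above = "\<lambda>v. {t \<in> ?F. comm_less v t}"
  have ordered: "eval_comm u \<diamondop> eval_comm v \<in> basic_span n"
    if "basic_commutator d u" "basic_commutator d v" "weight u + weight v = Suc n" "comm_less v u" for u v
    using that
  proof (induction "card (?above v)" arbitrary: u v rule: less_induct)
    case inner: less
    \<comment> \<open>the inner induction hypothesis, for pairs with both entries greater than \<open>v\<close> in either order\<close>
    have above: "eval_comm z \<diamondop> eval_comm y \<in> basic_span n"
      if z: "basic_commutator d z" "comm_less v z" and y: "basic_commutator d y" "comm_less v y"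
        and w: "weight z + weight y = Suc n" for z y
    proof -
      have dec: "card (?above y') < card (?above v)"
        if "comm_less v y'" "basic_commutator d y'" "weight y' \<le> n" for y'
      proof (rule psubset_card_mono)
        show "finite (?above v)" by (rule finite_subset[OF _ finF]) blast
        show "?above y' \<subset> ?above v"
          using comm_less_trans[OF that(1)] comm_less_irrefl[of y'] that by blast
      qed
      have le: "weight z \<le> n" "weight y \<le> n" using w weight_pos[of z] weight_pos[of y] by auto
      consider "comm_less y z" | "z = y" | "comm_less z y" using comm_less_total by blast
      then show ?thesis
      proof cases
        case 1
        then show ?thesis using inner.hyps[OF dec[OF y(2,1) le(2)] z(1) y(1) w] by simp
      next
        case 2
        then have "eval_comm z \<diamondop> eval_comm y = \<one>" using commutator_one_iff evc y by simp
        then show ?thesis using subgroup.one_closed[OF S] by simp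
      next
        case 3
        then have "eval_comm y \<diamondop> eval_comm z \<in> basic_span n"
          using inner.hyps[OF dec[OF z(2,1) le(1)] y(1) z(1)] w by (simp add: add.commute)
        then show ?thesis using commutator_mem_swap[OF S evc[OF z(1)] evc[OF y(1)]] by blast
      qed
    qed
    show ?case
    proof (cases "basic_commutator d (Br u v)")
      case True
      have "eval_comm (Br u v) \<in> basic_values n"
        unfolding basic_values_def using True inner.prems(3) by (intro imageI) simp
      then show ?thesis using basic_values_subset_basic_span by auto
    next
      case False
      then obtain s t where st: "u = Br s t" "comm_less v t"
        using basic_commutator.bracket[OF inner.prems(1,2,4)] by blast
      from inner.prems(1) have b: "basic_commutator d s" "basic_commutator d t" "comm_less t s"
        unfolding st(1) by (cases, simp)+
      obtain ws wt wv where w: "weight s = Suc ws" "weight t = Suc wt" "weight v = Suc wv"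
        using weight_pos[of s] weight_pos[of t] weight_pos[of v] gr0_implies_Suc by metis
      have n: "n = Suc (Suc (ws + wt + wv))" using inner.prems(3) w unfolding st(1) by simp
      \<comment> \<open>used with \<open>(y, y')\<close> equal to \<open>(s, t)\<close> and to \<open>(t, s)\<close>\<close>
      have swap: "eval_comm y \<diamondop> eval_comm v \<diamondop> eval_comm y' \<in> basic_span n"
        if y: "basic_commutator d y" "weight y = Suc wy"
          and y': "basic_commutator d y'" "weight y' = Suc wy'" "comm_less v y'"
          and eq: "wy + wy' = ws + wt" for y y' wy wy'
      proof -
        have n': "n = Suc (Suc (wy + wv) + wy')" using n eq by simp
        have "eval_comm y \<diamondop> eval_comm v \<in> basic_span (Suc (wy + wv))"
          by (rule less.IH) (use n' y(1,2) inner.prems(2) w(3) in simp_all)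
        then show ?thesis
          unfolding n'
        proof (rule commutator_basic_span[OF eval_comm_mem[OF y'(1,2)]])
          fix z assume z: "basic_commutator d z" "weight z = Suc (Suc (wy + wv))"
          have "comm_less v z" by (rule weight_less_comm_less) (use z(2) w(3) in simp)
          then show "eval_comm z \<diamondop> eval_comm y' \<in> basic_span (Suc (Suc (wy + wv) + wy'))"
            using above[OF z(1) _ y'(1,3)] z(2) y'(2) n' by simp
        qed
      qed
      have "comm_less v s" by (rule comm_less_trans[OF st(2) b(3)])
      then have "eval_comm s \<diamondop> eval_comm t \<diamondop> eval_comm v \<in> basic_span n"
        using swap[OF b(1) w(1) b(2) w(2) st(2)] swap[OF b(2) w(2) b(1) w(1)]
        by (intro Jacobi_basic_span[OF eval_comm_mem[OF b(1) w(1)] eval_comm_mem[OF b(2) w(2)]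
            eval_comm_mem[OF inner.prems(2) w(3)] n]) simp_all
      then show ?thesis by (simp add: st(1))
    qed
  qed
  consider "comm_less v u" | "u = v" | "comm_less u v" using comm_less_total by blast
  then show ?case
  proof cases
    case 1
    then show ?thesis using ordered less.prems by blast
  next
    case 2
    then have "eval_comm u \<diamondop> eval_comm v = \<one>" using commutator_one_iff evc less.prems by simp
    then show ?thesis using subgroup.one_closed[OF S] by simp
  next
    case 3
    then have "eval_comm v \<diamondop> eval_comm u \<in> basic_span n"
      using ordered[of v u] less.prems by (simp add: add.commute)
    then show ?thesis using commutator_mem_swap[OF S evc[OF less.prems(1)] evc[OF less.prems(2)]] by blast
  qed
qed

text \<open>
  \<open>\<Gamma> (n + 1)\<close> is generated modulo \<open>E (n + 1)\<close> by the brackets of a basic commutator of weight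
  \<open>n + 1\<close> with a letter.
\<close>

lemma \<Gamma>_subset_basic_span: "\<Gamma> n \<subseteq> basic_span n"
proof (induction n)
  case 0
  have "x ` {..<d} \<subseteq> basic_values 0"
  proof (rule image_subsetI)
    fix i assume "i \<in> {..<d}"
    then have "basic_commutator d (Letter i) \<and> weight (Letter i) = Suc 0"
      by (simp add: basic_commutator.letter)
    then have "eval_comm (Letter i) \<in> basic_values 0" unfolding basic_values_def by blast
    then show "x i \<in> basic_values 0" by simp
  qed
  then have "generate G (x ` {..<d} \<union> Q) \<subseteq> basic_span 0"
    unfolding basic_span_def by (intro mono_generate) auto
  then show ?case unfolding generated by simp
next
  case (Suc n)
  note S = subgroup_basic_span[of "Suc n"]
  have "g \<diamondop> f \<in> basic_span (Suc (n + 0))" if g: "g \<in> \<Gamma> n" and f: "f \<in> carrier G" for g f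
  proof (rule commutator_basic_span)
    show "f \<in> \<Gamma> 0" "g \<in> basic_span n" using f g Suc.IH by auto
    fix t assume t: "basic_commutator d t" "weight t = Suc n"
    have tn: "eval_comm t \<in> \<Gamma> n" by (rule eval_comm_mem[OF t])
    have tc: "eval_comm t \<in> carrier G" by (rule \<Gamma>_carrier[OF tn])
    let ?U = "{f \<in> carrier G. eval_comm t \<diamondop> f \<in> basic_span (Suc n)}"
    have "subgroup ?U G"
    proof (rule subgroup_commutator_right[OF subgroup_self S tc])
      fix g h assume gh: "g \<in> carrier G" "h \<in> carrier G"
      have "eval_comm t \<diamondop> g \<diamondop> h \<in> \<Gamma> (Suc (Suc n))"
        by (intro commutator_iterated tn gh)
      then show "eval_comm t \<diamondop> g \<diamondop> h \<in> basic_span (Suc n)" by (rule \<Gamma>_Suc_basic_span[rotated]) simp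
    qed
    moreover have "x ` {..<d} \<subseteq> ?U"
    proof (rule image_subsetI)
      fix i assume i: "i \<in> {..<d}"
      have "eval_comm t \<diamondop> eval_comm (Letter i) \<in> basic_span (Suc n)"
        using i t by (intro commutator_basic_in_span) (auto intro: basic_commutator.letter)
      then show "x i \<in> ?U" using x_carrier i by simp
    qed
    moreover have "Q \<subseteq> ?U"
    proof
      fix q assume q: "q \<in> Q"
      have qc: "q \<in> carrier G" using subgroup.mem_carrier[OF normal_imp_subgroup[OF normal_Q] q] .
      have "q \<diamondop> eval_comm t \<in> E (Suc n)" using commutator_E[of q 0 "eval_comm t" n] q tn by simp
      then have "q \<diamondop> eval_comm t \<in> basic_span (Suc n)" using E_subset_basic_span by blast
      then show "q \<in> ?U" using commutator_mem_swap[OF S qc tc] qc by blast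
    qed
    ultimately have "generate G (x ` {..<d} \<union> Q) \<subseteq> ?U" by (intro generate_subgroup_incl) blast+
    then show "eval_comm t \<diamondop> f \<in> basic_span (Suc (n + 0))" using f unfolding generated by auto
  qed
  then show ?case
    unfolding iterated_commutator.simps(2) by (intro commutator_subgroup_least[OF S]) simp
qed

lemma lower_central_generated: "generate G (basic_values n \<union> E n) = \<Gamma> n"
  using \<Gamma>_subset_basic_span[of n] basic_span_subset[of n] unfolding basic_span_def by simp

lemma card_basic_values: "finite (basic_values n)" "card (basic_values n) \<le> num_basic_commutators (Suc n) d"
  unfolding basic_values_def num_basic_commutators_def
  using finite_basic_commutators by (auto intro: card_image_le)

end


section \<open>The nilpotent multiplier\<close>

context group_hom
begin

lemma subgroup_vimage:
  assumes "subgroup K H" shows "subgroup {x \<in> carrier G. h x \<in> K} G"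
proof -
  interpret K: subgroup K H by (rule assms)
  show ?thesis by (rule subgroup.intro) auto
qed

lemma normal_vimage:
  assumes "K \<lhd> H" shows "{x \<in> carrier G. h x \<in> K} \<lhd> G"
  unfolding G.normal_inv_iff
proof (intro conjI ballI subgroup_vimage normal_imp_subgroup[OF assms])
  fix g x assume g: "g \<in> carrier G" and x: "x \<in> {x \<in> carrier G. h x \<in> K}"
  then have "h g \<otimes>\<^bsub>H\<^esub> h x \<otimes>\<^bsub>H\<^esub> inv\<^bsub>H\<^esub> h g \<in> K"
    using normal.inv_op_closed2[OF assms] by simp
  then show "g \<otimes> x \<otimes> inv g \<in> {x \<in> carrier G. h x \<in> K}" using g x by simp
qed

lemma mem_if_hom_mem:
  assumes V: "subgroup V G" and ker: "kernel G H h \<subseteq> V" and x: "x \<in> carrier G" "h x \<in> h ` V"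
  shows "x \<in> V"
proof -
  obtain v where v: "v \<in> V" "h x = h v" using x(2) by blast
  have vc: "v \<in> carrier G" using subgroup.mem_carrier[OF V v(1)] .
  have "h (x \<otimes> inv v) = \<one>\<^bsub>H\<^esub>" using x(1) vc v(2) by simp
  then have "x \<otimes> inv v \<in> V" using ker x(1) vc by (auto simp: kernel_def)
  then show ?thesis using G.mem_if_quotient_mem[OF V _ x(1) vc] v(1) by simp
qed

lemma generate_carrier_if_hom:
  assumes X: "X \<subseteq> carrier G" and ker: "kernel G H h \<subseteq> X" and gen: "generate H (h ` X) = carrier H"
  shows "generate G X = carrier G"
proof
  show "generate G X \<subseteq> carrier G" by (rule G.generate_incl[OF X])
  have V: "subgroup (generate G X) G" by (rule G.generate_is_subgroup[OF X])
  have "kernel G H h \<subseteq> generate G X" using ker by (auto intro: generate.incl)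
  moreover have "h ` generate G X = carrier H" using generate_img[OF X] gen by simp
  ultimately show "carrier G \<subseteq> generate G X" using mem_if_hom_mem[OF V] hom_closed by blast
qed

text \<open>
  For the generation property: a \<open>p\<^sup>i\<^sup>+\<^sup>1\<close>-th power in \<open>H\<close> lifts to the \<open>p\<close>-th power of an element of
  the \<open>i\<close>-th preimage, and all preimages contain the kernel.
\<close>

lemma powerful_filtration_vimage_agemo:
  assumes p: "Factorial_Ring.prime p" and ord: "order H = p ^ n" and pow: "powerful p H"
    and surj: "h ` carrier G = carrier H"
  shows "powerful_filtration G p (\<lambda>i. {x \<in> carrier G. h x \<in> agemo p i H})"
proof (intro powerful_filtration.intro powerful_filtration_axioms.intro)
  let ?P = "\<lambda>i. {x \<in> carrier G. h x \<in> agemo p i H}"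
  fix i
  show "?P i \<lhd> G" by (rule normal_vimage[OF H.normal_agemo])
  show "?P (Suc i) \<subseteq> ?P i" using H.agemo_antimono[of i "Suc i" p] by auto
  show "x \<diamondop> g \<in> ?P (i + powerful_depth p)" if "x \<in> ?P i" "g \<in> carrier G" for x g
    using that H.powerful_commutator_agemo[OF p ord pow, of "h x" i "h g"] by (simp add: hom_commutator)
  show "x [^] p \<in> ?P (Suc i)" if "x \<in> ?P i" for x
    using that H.powerful_pow_agemo[OF p ord pow, of "h x" i] by (simp add: hom_nat_pow)
  let ?X = "{x [^] p | x. x \<in> ?P i} \<union> ?P (Suc (Suc i))"
  have X: "?X \<subseteq> carrier G" by auto
  have V: "subgroup (generate G ?X) G" by (rule G.generate_is_subgroup[OF X])
  have "kernel G H h \<subseteq> ?P (Suc (Suc i))"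
    using subgroup.one_closed[OF H.subgroup_agemo] by (auto simp: kernel_def)
  then have ker: "kernel G H h \<subseteq> generate G ?X" by (auto intro: generate.incl)
  have "agemo p (Suc i) H \<subseteq> h ` generate G ?X"
  proof (rule H.agemo_least[OF subgroup_img_is_subgroup[OF V]])
    fix y assume "y \<in> carrier H"
    then obtain x where x: "x \<in> carrier G" "y = h x" using surj by blast
    have "x [^] p ^ i \<in> ?P i" using x(1) H.pow_mem_agemo by (simp add: hom_nat_pow)
    then have "(x [^] p ^ i) [^] p \<in> generate G ?X" by (intro generate.incl) blast
    then have "h ((x [^] p ^ i) [^] p) \<in> h ` generate G ?X" by (rule imageI)
    then show "y [^]\<^bsub>H\<^esub> p ^ Suc i \<in> h ` generate G ?X"
      using x by (simp add: hom_nat_pow H.nat_pow_pow mult.commute)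
  qed
  then show "?P (Suc i) \<subseteq> generate G ?X" using mem_if_hom_mem[OF V ker] by blast
qed (rule p G.group_axioms)+

end

lemma (in powerful_filtration) power_filtration_quotient:
  "power_filtration (G Mod D k (Suc j)) p (\<lambda>i. (#>) (D k (Suc j)) ` D i (Suc j)) k"
proof -
  let ?L = "D k (Suc j)"
  let ?Q = "G Mod ?L"
  interpret h: group_hom G ?Q "\<lambda>x. ?L #> x" by (rule group_hom_rcos[OF normal_D])
  let ?N = "\<lambda>i. (#>) ?L ` D i (Suc j)"
  have surj: "(#>) ?L ` carrier G = carrier ?Q" by (simp add: carrier_FactGroup)
  show ?thesis
  proof (intro power_filtration.intro power_filtration_axioms.intro)
    fix i
    show "0 < p" by (rule prime_gt_0_nat[OF prime])
    show "?N i \<lhd> ?Q" by (rule normal.surj_hom_normal_subgroup[OF normal_D h.group_hom_axioms surj])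
    show "?N (Suc i) \<subseteq> ?N i" by (intro image_mono D_antimono) simp
    show "X \<diamondop>\<^bsub>?Q\<^esub> Y \<in> ?N (Suc (Suc i))" if XY: "X \<in> ?N i" "Y \<in> ?N i" for X Y
    proof -
      obtain x y where xy: "x \<in> D i (Suc j)" "X = ?L #> x" "y \<in> D i (Suc j)" "Y = ?L #> y"
        using XY by blast
      then show ?thesis
        using commutator_D_D[OF xy(1,3)] h.hom_commutator[OF D_carrier[OF xy(1)] D_carrier[OF xy(3)]]
        by (metis imageI)
    qed
    show "X [^]\<^bsub>?Q\<^esub> p \<in> ?N (Suc i)" if X: "X \<in> ?N i" for X
    proof -
      obtain x where x: "x \<in> D i (Suc j)" "X = ?L #> x" using X by blast
      then show ?thesis using pow_D[OF x(1)] h.hom_nat_pow[OF D_carrier[OF x(1)], of p] by (metis imageI)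
    qed
    let ?X = "{x [^] p | x. x \<in> D i (Suc j)} \<union> D (Suc (Suc i)) (Suc j)"
    have X: "?X \<subseteq> carrier G" using D_carrier by auto
    have "?N (Suc i) \<subseteq> (#>) ?L ` generate G ?X" by (rule image_mono[OF D_generated])
    also have "\<dots> = generate ?Q ((#>) ?L ` ?X)" by (rule h.generate_img[OF X, symmetric])
    also have "(#>) ?L ` ?X = {X [^]\<^bsub>?Q\<^esub> p | X. X \<in> ?N i} \<union> ?N (Suc (Suc i))"
    proof -
      have "(#>) ?L ` {x [^] p | x. x \<in> D i (Suc j)} = (\<lambda>x. (?L #> x) [^]\<^bsub>?Q\<^esub> p) ` D i (Suc j)"
        unfolding Setcompr_eq_image image_image Collect_mem_eq
        by (rule image_cong[OF refl h.hom_nat_pow[OF D_carrier]])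
      then show ?thesis unfolding image_Un Setcompr_eq_image Collect_mem_eq image_image by simp
    qed
    finally show "?N (Suc i) \<subseteq> generate ?Q ({X [^]\<^bsub>?Q\<^esub> p | X. X \<in> ?N i} \<union> ?N (Suc (Suc i)))" .
    have "?L #> x = ?L" if "x \<in> ?L" for x using rcos_eq_self_iff[OF normal_D D_carrier[OF that]] that by simp
    then show "?N k = {\<one>\<^bsub>?Q\<^esub>}" using subgroup.one_closed[OF subgroup_D[of k "Suc j"]] by auto
  qed (rule h.H.group_axioms)
qed

lemma min_generators_le:
  assumes "finite S" "S \<subseteq> carrier G" "generate G S = carrier G" "card S \<le> m"
  shows "min_generators G \<le> enat m"
proof -
  have "min_generators G \<le> enat (card S)"
    unfolding min_generators_def by (rule INF_lower) (use assms in simp)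
  also have "\<dots> \<le> enat m" using assms(4) by simp
  finally show ?thesis .
qed

lemma min_generators_attained:
  assumes "min_generators G = enat d"
  shows "\<exists>S. finite S \<and> S \<subseteq> carrier G \<and> generate G S = carrier G \<and> card S = d"
proof -
  let ?A = "{S. S \<subseteq> carrier G \<and> finite S \<and> generate G S = carrier G}"
  have "?A \<noteq> {}"
  proof
    assume "?A = {}"
    then have "min_generators G = \<infinity>"
      unfolding min_generators_def by (simp only: image_empty Inf_empty top_enat_def)
    then show False using assms by simp
  qed
  then have ne: "(\<lambda>S. enat (card S)) ` ?A \<noteq> {}" by blast
  have "min_generators G = (LEAST e. e \<in> (\<lambda>S. enat (card S)) ` ?A)"
    unfolding min_generators_def Inf_enat_def by (simp only: ne if_False)
  also have "\<dots> \<in> (\<lambda>S. enat (card S)) ` ?A"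
    by (rule LeastI_ex) (use ne in blast)
  finally have "min_generators G \<in> (\<lambda>S. enat (card S)) ` ?A" .
  then obtain S where "S \<in> ?A" "min_generators G = enat (card S)" by blast
  then show ?thesis using assms by auto
qed

lemma (in group) Mod_subgroup_eq:
  assumes "K \<subseteq> carrier G"
  shows "(G\<lparr>carrier := K\<rparr>) Mod L = (G Mod L)\<lparr>carrier := (#>) L ` K\<rparr>"
  by (auto simp: FactGroup_def RCOSETS_def fun_eq_iff)

text \<open>
  The multiplier, embedded in \<open>\<gamma>\<^sub>c\<^sub>+\<^sub>1(F) / [R, F, \<dots>, F]\<close>, meets the hypotheses of the counting
  argument, with the basic commutators of weight \<open>c + 1\<close> in \<open>d\<close> lifts of generators of \<open>G\<close> as
  generators of the first factor.
\<close>

lemma nilpotent_multiplier_generators: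
  fixes F :: "('b, 'n) monoid_scheme" and G :: "('a, 'm) monoid_scheme"
  assumes p: "Factorial_Ring.prime p" and c: "c \<ge> 1"
    and fin: "finite (carrier G)" and pG: "p_group p G" and pow: "powerful p G"
    and S: "finite S" "S \<subseteq> carrier G" "generate G S = carrier G" "card S = d"
    and hom: "group_hom F G h" and surj: "h ` carrier F = carrier G"
  shows "\<exists>X. finite X \<and> X \<subseteq> carrier (nilpotent_multiplier c F (kernel F G h)) \<and>
    generate (nilpotent_multiplier c F (kernel F G h)) X =
      carrier (nilpotent_multiplier c F (kernel F G h)) \<and> card X \<le> num_basic_commutators (c + 1) d"
proof -
  interpret h: group_hom F G h by (rule hom)
  define R where "R = kernel F G h"
  obtain j where j: "c = Suc j" using c by (cases c) auto
  obtain k where k: "order G = p ^ k" using h.H.p_group_order[OF p pG fin] by blast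
  define P where "P i = {x \<in> carrier F. h x \<in> agemo p i G}" for i
  interpret P: powerful_filtration F p P
    unfolding P_def by (rule h.powerful_filtration_vimage_agemo[OF p k pow surj])
  have P0: "P 0 = carrier F" unfolding P_def h.H.agemo_0 by auto
  have Pk: "P k = R" unfolding P_def R_def kernel_def h.H.agemo_trivial[OF k] by simp
  have R: "R \<lhd> F" using P.normal_P[of k] unfolding Pk .
  have RP: "R \<subseteq> P i" for i
    unfolding P_def R_def kernel_def using subgroup.one_closed[OF h.H.subgroup_agemo] by auto

  \<comment> \<open>the \<open>x i\<close> are lifts of generators of \<open>G\<close>; together with \<open>P 1\<close>,
    which contains the kernel, they generate \<open>F\<close>\<close>
  obtain f where f: "f ` {..<d} = S"
    using ex_bij_betw_nat_finite[OF S(1)] S(4) by (auto simp: bij_betw_def atLeast0LessThan)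
  have "\<exists>x\<in>carrier F. h x = f i" if "i < d" for i
  proof -
    have "f i \<in> h ` carrier F" unfolding surj using f that S(2) by auto
    then show ?thesis by auto
  qed
  then have "\<forall>i. \<exists>x. i < d \<longrightarrow> x \<in> carrier F \<and> h x = f i" by auto
  from choice[OF this] obtain x where x: "\<And>i. i < d \<Longrightarrow> x i \<in> carrier F \<and> h (x i) = f i" by auto
  have xX: "x ` {..<d} \<union> P 1 \<subseteq> carrier F" using x unfolding P_def by auto
  have "generate G (h ` (x ` {..<d} \<union> P 1)) = carrier G"
  proof
    have hX: "h ` (x ` {..<d} \<union> P 1) \<subseteq> carrier G" using xX h.hom_closed by blast
    then show "generate G (h ` (x ` {..<d} \<union> P 1)) \<subseteq> carrier G" by (rule h.H.generate_incl)
    have "S \<subseteq> h ` (x ` {..<d} \<union> P 1)" using f x by (force simp: image_iff)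
    from h.H.mono_generate[OF this]
    show "carrier G \<subseteq> generate G (h ` (x ` {..<d} \<union> P 1))" using S(3) by simp
  qed
  then have gen: "generate F (x ` {..<d} \<union> P 1) = carrier F"
    using RP by (intro h.generate_carrier_if_hom[OF xX]) (auto simp: R_def)
  interpret Hall: generated_mod F "P 1" d x
  proof (intro generated_mod.intro generated_mod_axioms.intro)
    show "P 1 \<lhd> F" by (rule P.normal_P)
    show "a \<diamondop>\<^bsub>F\<^esub> b \<in> P 1" if "a \<in> carrier F" "b \<in> carrier F" for a b
      using P.commutator_P[of a 0 b] P.P_antimono[of 1 "powerful_depth p"] that
      by (auto simp: P0 powerful_depth_def split: if_splits)
  qed (use x gen h.G.group_axioms in auto)

  \<comment> \<open>in \<open>Q = F / [R, F, \<dots>, F]\<close> the images of the \<open>N\<^sub>i\<close> form a power filtration that reaches 1\<close>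
  let ?N = "\<lambda>i. P.D i c"
  define L where "L = ?N k"
  have L: "L \<lhd> F" unfolding L_def by (rule P.normal_D)
  define Q where "Q = F Mod L"
  interpret pi: group_hom F Q "\<lambda>x. L #>\<^bsub>F\<^esub> x" unfolding Q_def by (rule h.G.group_hom_rcos[OF L])
  interpret N: power_filtration Q p "\<lambda>i. (#>\<^bsub>F\<^esub>) L ` ?N i" k
    unfolding Q_def L_def j by (rule P.power_filtration_quotient)
  let ?\<gamma> = "iterated_commutator F (carrier F) c"
  have N0: "?N 0 = ?\<gamma>" and N1: "?N 1 = iterated_commutator F (P 1) c"
    and L_eq: "L = iterated_commutator F R c"
    unfolding L_def P.D_def P0 Pk by simp_all
  define T where "T = (#>\<^bsub>F\<^esub>) L ` Hall.basic_values c"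
  have vals: "Hall.basic_values c \<subseteq> carrier F" using Hall.basic_values_subset Hall.\<Gamma>_carrier by blast
  have T: "finite T" "T \<subseteq> carrier Q"
    using Hall.card_basic_values(1) vals pi.hom_closed unfolding T_def by auto
  have cardT: "card T \<le> num_basic_commutators (c + 1) d"
    using card_image_le[OF Hall.card_basic_values(1)] Hall.card_basic_values(2)[of c]
    unfolding T_def by (metis Suc_eq_plus1 le_trans)
  have genT: "generate Q (T \<union> (#>\<^bsub>F\<^esub>) L ` ?N 1) = (#>\<^bsub>F\<^esub>) L ` ?N 0"
  proof -
    have "Hall.basic_values c \<union> ?N 1 \<subseteq> carrier F" using vals P.D_carrier by blast
    from pi.generate_img[OF this] show ?thesis
      unfolding T_def image_Un[symmetric] N0 N1 Hall.lower_central_generated[of c] by simp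
  qed

  \<comment> \<open>the multiplier as an abelian subgroup \<open>M\<close> of \<open>Q\<close>\<close>
  define K where "K = R \<inter> ?\<gamma>"
  define M where "M = (#>\<^bsub>F\<^esub>) L ` K"
  have Ks: "subgroup K F"
    unfolding K_def by (rule h.G.subgroups_Inter_pair[OF normal_imp_subgroup[OF R] Hall.subgroup_\<Gamma>])
  have Kc: "x \<in> carrier F" if "x \<in> K" for x using subgroup.mem_carrier[OF Ks that] .
  have Ms: "subgroup M Q" unfolding M_def by (rule pi.subgroup_img_is_subgroup[OF Ks])
  have MN: "M \<subseteq> (#>\<^bsub>F\<^esub>) L ` ?N 0" unfolding M_def K_def N0 by blast
  have Mc: "X \<in> carrier Q" if "X \<in> M" for X using subgroup.mem_carrier[OF Ms that] .
  have comm: "X \<diamondop>\<^bsub>Q\<^esub> Y = \<one>\<^bsub>Q\<^esub>" if XY: "X \<in> M" "Y \<in> M" for X Y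
  proof -
    obtain x y where xy: "x \<in> K" "X = L #>\<^bsub>F\<^esub> x" "y \<in> K" "Y = L #>\<^bsub>F\<^esub> y"
      using XY unfolding M_def by blast
    have "x \<diamondop>\<^bsub>F\<^esub> y \<in> iterated_commutator F R (Suc c)"
      using h.G.commutator_lower_central[OF R] xy(1,3) unfolding K_def by blast
    then have mem: "x \<diamondop>\<^bsub>F\<^esub> y \<in> L" using h.G.iterated_commutator_Suc_subset[OF R] unfolding L_eq by blast
    have "L #>\<^bsub>F\<^esub> (x \<diamondop>\<^bsub>F\<^esub> y) = L"
      using h.G.rcos_eq_self_iff[OF L h.G.commutator_closed[OF Kc[OF xy(1)] Kc[OF xy(3)]]] mem by blast
    then show ?thesis
      using pi.hom_commutator[OF Kc[OF xy(1)] Kc[OF xy(3)]] unfolding xy(2,4) by (simp add: Q_def)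
  qed
  have mult_comm: "X \<otimes>\<^bsub>Q\<^esub> Y = Y \<otimes>\<^bsub>Q\<^esub> X" if "X \<in> M" "Y \<in> M" for X Y
    using comm[OF that] pi.H.commutator_one_iff[OF Mc[OF that(1)] Mc[OF that(2)]] by blast
  let ?M = "Q\<lparr>carrier := M\<rparr>"
  have multiplier: "nilpotent_multiplier c F R = ?M"
    unfolding nilpotent_multiplier_def lower_central_def Q_def M_def L_eq[symmetric]
    using h.G.Mod_subgroup_eq[of K L] Kc unfolding K_def by auto
  interpret M: comm_group ?M
  proof (rule group.group_comm_groupI)
    show "group ?M" by (rule pi.H.subgroup_imp_group[OF Ms])
  qed (use mult_comm in simp)
  let ?\<Omega> = "{X \<in> M. X [^]\<^bsub>Q\<^esub> p \<in> {\<one>\<^bsub>Q\<^esub>}}"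
  have \<Omega>: "subgroup ?\<Omega> Q"
    using comm by (intro pi.H.subgroup_pow_mod[OF Ms pi.H.one_is_normal]) simp
  have "finite ((#>\<^bsub>F\<^esub>) L ` ?N 0)" "card ?\<Omega> \<le> p ^ card T"
    using N.card_exponent_subgroup_le[OF \<Omega> _ _ T genT] MN by blast+
  then have finM: "finite M" using MN finite_subset by blast
  have "p ^ card T \<le> p ^ num_basic_commutators (c + 1) d"
    using cardT prime_ge_1_nat[OF p] by (intro power_increasing)
  then have "card ?\<Omega> \<le> p ^ num_basic_commutators (c + 1) d"
    using \<open>card ?\<Omega> \<le> p ^ card T\<close> by simp
  moreover have "?\<Omega> = {X \<in> carrier ?M. X [^]\<^bsub>?M\<^esub> p = \<one>\<^bsub>?M\<^esub>}"
    by (simp add: pi.H.nat_pow_consistent[symmetric])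
  ultimately have bound: "card {X \<in> carrier ?M. X [^]\<^bsub>?M\<^esub> p = \<one>\<^bsub>?M\<^esub>} \<le> p ^ num_basic_commutators (c + 1) d"
    by simp
  have exp: "X [^]\<^bsub>?M\<^esub> p ^ k = \<one>\<^bsub>?M\<^esub>" if "X \<in> carrier ?M" for X
    using N.pow_k_N[of X] that MN by (auto simp: pi.H.nat_pow_consistent[symmetric])
  show ?thesis
    using M.exists_generators_card_le[OF p _ exp bound] finM
    unfolding R_def[symmetric] multiplier by simp
qed

theorem corollary3p2:
  fixes p c d :: nat
    and G :: "('a, 'm) monoid_scheme"
    and F :: "('b, 'n) monoid_scheme"
    and B :: "'x set"
    and R :: "'b set"
  assumes "Factorial_Ring.prime p"
    and "c \<ge> 1"
    and "group G"
    and "finite (carrier G)"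
    and "p_group p G"
    and "powerful p G"
    and "min_generators G = enat d"
    and "group F"
    and "F \<cong> free_group B"
    and "R \<lhd> F"
    and "G \<cong> F Mod R"
  shows "min_generators (nilpotent_multiplier c F R) \<le> enat (num_basic_commutators (c + 1) d)"
proof -
  interpret F: group F by fact
  interpret Q: group "F Mod R" by (rule normal.factorgroup_is_group) fact
  interpret pi: group_hom F "F Mod R" "\<lambda>x. R #>\<^bsub>F\<^esub> x" by (rule F.group_hom_rcos) fact
  obtain \<theta> where \<theta>: "\<theta> \<in> iso (F Mod R) G"
    using group.iso_sym[OF assms(3,11)] by (auto simp: is_iso_def)
  define h where "h = (\<lambda>x. \<theta> (R #>\<^bsub>F\<^esub> x))"
  have bij: "bij_betw \<theta> (carrier (F Mod R)) (carrier G)" using \<theta> by (simp add: iso_def)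
  have \<theta>_hom: "group_hom (F Mod R) G \<theta>"
    using \<theta> assms(3) Q.group_axioms by (simp add: group_hom_def group_hom_axioms_def iso_def)
  have hom: "group_hom F G h"
    using hom_compose[OF pi.homh group_hom.homh[OF \<theta>_hom]] assms(3,8)
    by (simp add: group_hom_def group_hom_axioms_def h_def comp_def)
  have surj: "h ` carrier F = carrier G"
    using bij unfolding h_def bij_betw_def carrier_FactGroup by (simp add: image_image)
  have ker: "kernel F G h = R"
  proof -
    have "h x = \<one>\<^bsub>G\<^esub> \<longleftrightarrow> x \<in> R" if x: "x \<in> carrier F" for x
    proof -
      have "h x = \<one>\<^bsub>G\<^esub> \<longleftrightarrow> R #>\<^bsub>F\<^esub> x = \<one>\<^bsub>F Mod R\<^esub>"
        unfolding h_def group_hom.hom_one[OF \<theta>_hom, symmetric]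
        using bij_betw_imp_inj_on[OF bij] pi.hom_closed[OF x] Q.one_closed by (rule inj_on_eq_iff)
      then show ?thesis using F.rcos_eq_self_iff[OF assms(10) x] by simp
    qed
    then show ?thesis
      using subgroup.subset[OF normal_imp_subgroup[OF assms(10)]] by (auto simp: kernel_def)
  qed
  obtain S where S: "finite S" "S \<subseteq> carrier G" "generate G S = carrier G" "card S = d"
    using min_generators_attained[OF assms(7)] by blast
  show ?thesis
    using nilpotent_multiplier_generators[OF assms(1,2,4,5,6) S hom surj] min_generators_le
    unfolding ker by blast
qed

end
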